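(* Let $\mu\ge 0$ be fixed, let $T=T(\mathbf{u})$, $\mathbf{u}\in\mathbb{R}^3$, be the self-adjoint operator $Ty=\tau y$ with domain $D(T)$ defined in the context, and suppose that $\Lambda_0$ is an eigenvalue of $T(\mathbf{u}_0)$ for some given parameter vector $\mathbf{u}_0\in\mathbb{R}^3$. Then there exist a domain $U\subset\mathbb{R}^3$ with $\mathbf{u}_0\in U$ and eigenvalues $\Lambda(\mathbf{u})$ of $T(\mathbf{u})$, $\mathbf{u}\in U$, with $\Lambda(\mathbf{u}_0)=\Lambda_0$, such that $\Lambda=\Lambda(\mathbf{u})$ depends analytically on $\mathbf{u}=(u_1,u_2,u_3)\in U$. In addition, $\Lambda$ satisfies on $U$ the first-order quasilinear partial differential equation $$\begin{aligned} 2u_1\frac{\partial\Lambda}{\partial u_1} &+\left((\Lambda+2)(u_1+u_2^2)+\Lambda+u_2+u_3\right)\frac{\partial\Lambda}{\partial u_2}\\ &+\left((2\Lambda+u_3+2)(2\Lambda u_2-2\mu-1)-2(\mu+1)(u_1+u_2^2)+2\mu\right)\frac{\partial\Lambda}{\partial u_3}\\ &=(1+2\mu-2\Lambda u_2)(\Lambda+2)-2\mu . \end{aligned}$$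
   Context: Fix a real number $\mu\ge 0$ and set $\alpha:=\frac12(\mu+1)$. A domain is a nonempty open connected set. For $\mathbf{u}=(u_1,u_2,u_3)\in\mathbb{R}^3$ and $0<z<1$ define $$J:=\begin{pmatrix}0&-1\\1&0\end{pmatrix},\quad W(z):=\begin{pmatrix}\frac{1}{1-z}&0\\0&\frac1z\end{pmatrix},\quad H(z,\mathbf{u}):=\begin{pmatrix}2&-\frac{\alpha}{z}+\frac{\alpha}{1-z}+2u_2\\-\frac{\alpha}{z}+\frac{\alpha}{1-z}+2u_2&\frac{u_3}{z}+2(u_1+u_2^2)\end{pmatrix},$$ and the differential expression $\tau y:=W(z)^{-1}\left(Jy'(z)-H(z,\mathbf{u})y(z)\right)$. Let $L^2_W((0,1),\mathbb{C}^2)$ be the Hilbert space of (classes of measurable) functions $f:(0,1)\to\mathbb{C}^2$ with $\int_0^1 f(z)^*W(z)f(z)\,\mathrm{d}z<\infty$, with scalar product $\langle f,g\rangle_W=\int_0^1 f(z)^*W(z)g(z)\,\mathrm{d}z$. The operator $T=T(\mathbf{u})$ is $Ty:=\tau y$ with domain $$D(T)=\{y\in L^2_W((0,1),\mathbb{C}^2): y \text{ is locally absolutely continuous on }(0,1)\text{ and }\tau y\in L^2_W((0,1),\mathbb{C}^2)\}.$$ It is self-adjoint ($\tau$ is in the limit point case at both endpoints). *)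

theory Defs
  imports "HOL-Analysis.Analysis"
begin

definition abs_cont_on :: "real set \<Rightarrow> (real \<Rightarrow> 'a::real_normed_vector) \<Rightarrow> bool" where
  "abs_cont_on S f \<longleftrightarrow>
     (\<forall>\<epsilon>>0. \<exists>\<delta>>0. \<forall>D A. D division_of A \<and> A \<subseteq> S \<and> (\<Sum>K\<in>D. Sup K - Inf K) < \<delta>
        \<longrightarrow> (\<Sum>K\<in>D. norm (f (Sup K) - f (Inf K))) < \<epsilon>)"

definition loc_abs_cont :: "(real \<Rightarrow> 'a::real_normed_vector) \<Rightarrow> bool" where
  "loc_abs_cont f \<longleftrightarrow> (\<forall>a b. 0 < a \<and> a < b \<and> b < 1 \<longrightarrow> abs_cont_on {a..b} f)"

definition J_mat :: "complex^2^2" where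
  "J_mat = vector [vector [0, -1], vector [1, 0]]"

definition W_mat :: "real \<Rightarrow> complex^2^2" where
  "W_mat z = vector [vector [of_real (1 / (1 - z)), 0], vector [0, of_real (1 / z)]]"

definition H_mat :: "real \<Rightarrow> real^3 \<Rightarrow> real \<Rightarrow> complex^2^2" where
  "H_mat \<mu> u z =
     (let \<alpha> = (\<mu> + 1) / 2;
          h = - \<alpha> / z + \<alpha> / (1 - z) + 2 * u$2
      in vector [vector [2, of_real h],
                 vector [of_real h, of_real (u$3 / z + 2 * (u$1 + (u$2)\<^sup>2))]])"

text \<open>The value of the differential expression at \<open>z\<close>, where \<open>v\<close> and \<open>v'\<close> stand for
  \<open>y z\<close> and the derivative of \<open>y\<close> at \<open>z\<close>.\<close>

definition tau :: "real \<Rightarrow> real^3 \<Rightarrow> real \<Rightarrow> complex^2 \<Rightarrow> complex^2 \<Rightarrow> complex^2" where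
  "tau \<mu> u z v v' = matrix_inv (W_mat z) *v (J_mat *v v' - H_mat \<mu> u z *v v)"

definition W_form :: "real \<Rightarrow> complex^2 \<Rightarrow> complex^2 \<Rightarrow> complex" where
  "W_form z v w = (\<Sum>i\<in>UNIV. cnj (v$i) * (W_mat z *v w)$i)"

text \<open>Functions rather than equivalence classes: equality in the Hilbert space is equality
  almost everywhere on \<open>{0<..<1}\<close>.\<close>

definition L2W :: "(real \<Rightarrow> complex^2) set" where
  "L2W = {f. f \<in> borel_measurable (lebesgue_on {0<..<1}) \<and>
             integrable (lebesgue_on {0<..<1}) (\<lambda>z. W_form z (f z) (f z))}"

text \<open>The operator is given by its graph: \<open>(y, f)\<close> is a member iff \<open>y\<close> lies in the domain and
  \<open>f\<close> equals the differential expression applied to \<open>y\<close> almost everywhere. A locally absolutely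
  continuous \<open>y\<close> is differentiable almost everywhere, so the existence of the derivative
  is not an additional restriction on \<open>y\<close>.\<close>

definition op_T :: "real \<Rightarrow> real^3 \<Rightarrow> ((real \<Rightarrow> complex^2) \<times> (real \<Rightarrow> complex^2)) set" where
  "op_T \<mu> u =
     {(y, f). y \<in> L2W \<and> loc_abs_cont y \<and> f \<in> L2W \<and>
        (AE z in lebesgue_on {0<..<1}.
           \<exists>y'. (y has_vector_derivative y') (at z) \<and> f z = tau \<mu> u z (y z) y')}"

definition eigenvalue_T :: "real \<Rightarrow> real^3 \<Rightarrow> complex \<Rightarrow> bool" where
  "eigenvalue_T \<mu> u \<Lambda> \<longleftrightarrow>
     (\<exists>y. (y, \<lambda>z. \<Lambda> *s y z) \<in> op_T \<mu> u \<and> \<not> (AE z in lebesgue_on {0<..<1}. y z = 0))"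

text \<open>Analyticity in several real variables: a convergent power series around every point,
  indexed by multi-indices \<open>m\<close>.\<close>

definition real_analytic_on :: "(real^'n \<Rightarrow> real) \<Rightarrow> (real^'n) set \<Rightarrow> bool" where
  "real_analytic_on f U \<longleftrightarrow>
     (\<forall>p\<in>U. \<exists>r>0. \<exists>c :: ('n \<Rightarrow> nat) \<Rightarrow> real. \<forall>x\<in>ball p r.
        ((\<lambda>m. c m * (\<Prod>i\<in>UNIV. (x$i - p$i) ^ m i)) has_sum f x) UNIV)"

definition partial_deriv :: "'n \<Rightarrow> (real^'n \<Rightarrow> real) \<Rightarrow> real^'n \<Rightarrow> real" where
  "partial_deriv i f x = deriv (\<lambda>t. f (x + t *\<^sub>R axis i 1)) 0"

end

theory Submission
  imports Defs "HOL-Complex_Analysis.Complex_Analysis"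
begin

text \<open>
  Put \<open>\<alpha> = (\<mu> + 1) / 2\<close>. In components the equation \<open>\<tau> y = \<Lambda> y\<close> is a linear first-order system of
  trace zero with regular singular points at \<open>0\<close> and \<open>1\<close>, and at both of them its exponents are
  \<open>\<alpha>\<close> and \<open>-\<alpha>\<close>. The Wronskian \<open>y\<^sub>1 w\<^sub>2 - y\<^sub>2 w\<^sub>1\<close> of two solutions is constant. Since
  \<open>2 \<alpha> \<ge> 1\<close>, a solution whose Wronskian with the recessive one (exponent \<open>\<alpha>\<close>) does not vanish grows
  so fast at the endpoint that it is not square integrable. Hence \<open>\<Lambda>\<close> is an eigenvalue if and only
  if the solution \<open>left1, left2\<close> that is recessive at \<open>0\<close> and the solution \<open>right1, right2\<close> that is
  recessive at \<open>1\<close> are proportional, that is, if and only if their Wronskian \<open>connection\<close> vanishes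
  (\<open>eigenvalue_imp_connection_zero\<close>, \<open>connection_zero_imp_eigenvalue\<close>). Both solutions are given by
  Frobenius series that converge in the unit disc and whose coefficients are polynomials in \<open>u\<close> and
  \<open>\<Lambda>\<close>; so \<open>connection\<close> is defined for complex arguments, continuous, and entire in each of them.

  Everything else rests on one identity, \<open>wronskian_derivative\<close>: the derivative of the Wronskian of
  two solutions for different parameters is a quadratic expression in them, linear in the change of
  the coefficient matrix. Integrated over \<open>(0, 1)\<close> for an eigenfunction and its conjugate it shows
  that eigenvalues are real. Integrated over the two halves of the interval for \<open>\<Lambda>\<close> and a nearby
  value it computes the \<open>\<Lambda>\<close>-derivative of \<open>connection\<close> at an eigenvalue, up to a nonzero factor, as
  the squared norm of an eigenfunction; so the zeros are simple (\<open>connection_simple_zero\<close>).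

  A simple zero persists under small complex changes of \<open>u\<close>, and the nearby zero is the quotient of
  two contour integrals over a fixed circle (\<open>simple_root_persists\<close>); so it is continuous and
  holomorphic in each variable. Iterating Cauchy's formula three times turns this into a convergent
  power series in three variables (\<open>separately_holomorphic_power_series\<close>).

  For the differential equation the identity is integrated once more, now for eigenfunctions that
  belong to \<open>u\<close> and to \<open>u + t e\<close>. In the limit \<open>t \<rightarrow> 0\<close> it expresses the partial derivatives of
  \<open>\<Lambda>\<close>, multiplied by the squared norm of \<open>y\<close>, as integrals of quadratic expressions in the
  eigenfunction \<open>y\<close> (\<open>hellmann_feynman\<close>). The coefficients of the equation are such that the
  corresponding combination of these integrands is the derivative of an explicit quadratic form in
  \<open>y\<close> that vanishes at both endpoints (\<open>quadratic_exact_form\<close>), and therefore integrates to zero.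
\<close>

text \<open>Frees the sign for the components of vectors.\<close>

no_notation fps_nth (infixl "$" 75)

section \<open>Frobenius series of a system with two regular singular points\<close>

text \<open>
  The system is \<open>t y' = (A\<^sub>0 + t / (1 - t) A\<^sub>1 + t A\<^sub>2) y\<close> with the matrices
  \<open>A\<^sub>0 = (-\<alpha>, b0; c0, \<alpha>)\<close>, \<open>A\<^sub>1 = (\<alpha>, b1; c1, -\<alpha>)\<close>, \<open>A\<^sub>2 = (\<beta>, \<kappa>; \<gamma>, -\<beta>)\<close>, written row by
  row, and with \<open>b0 c0 = 0\<close>. For \<open>y = t\<^sup>\<alpha> \<Sum>\<^sub>n (p\<^sub>n, q\<^sub>n) t\<^sup>n\<close> the factor \<open>1 / (1 - t)\<close> couples \<open>(p\<^sub>n, q\<^sub>n)\<close> to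
  all earlier coefficients, but only through their partial sums. Keeping these sums as the third and
  fourth component makes the recursion one of first order. It starts with an eigenvector of \<open>A\<^sub>0\<close> for
  the eigenvalue \<open>\<alpha>\<close>; since \<open>A\<^sub>0\<^sup>2 = \<alpha>\<^sup>2\<close>, the inverse of \<open>N + \<alpha> - A\<^sub>0\<close> is
  \<open>(N + \<alpha> + A\<^sub>0) / (N (N + 2 \<alpha>))\<close>.
\<close>

primrec frob :: "real \<Rightarrow> complex \<Rightarrow> complex \<Rightarrow> complex \<Rightarrow> complex \<Rightarrow> complex \<Rightarrow> complex \<Rightarrow> complex
    \<Rightarrow> nat \<Rightarrow> complex \<times> complex \<times> complex \<times> complex" where
  "frob \<alpha> b0 c0 b1 c1 \<beta> \<kappa> \<gamma> 0 = (b0 / (2 * of_real \<alpha>), 1, b0 / (2 * of_real \<alpha>), 1)"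
| "frob \<alpha> b0 c0 b1 c1 \<beta> \<kappa> \<gamma> (Suc n) =
    (let v = frob \<alpha> b0 c0 b1 c1 \<beta> \<kappa> \<gamma> n;
         p = fst v; q = fst (snd v); sp = fst (snd (snd v)); sq = snd (snd (snd v));
         r = of_real \<alpha> * sp + b1 * sq + \<beta> * p + \<kappa> * q;
         s = c1 * sp - of_real \<alpha> * sq + \<gamma> * p - \<beta> * q;
         N = of_nat (Suc n); M = of_nat (Suc n) + 2 * of_real \<alpha>;
         p' = (N * r + b0 * s) / (N * M);
         q' = (c0 * r + M * s) / (N * M)
     in (p', q', sp + p', sq + q'))"

definition frobP where "frobP \<alpha> b0 c0 b1 c1 \<beta> \<kappa> \<gamma> n = fst (frob \<alpha> b0 c0 b1 c1 \<beta> \<kappa> \<gamma> n)"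

definition frobQ where "frobQ \<alpha> b0 c0 b1 c1 \<beta> \<kappa> \<gamma> n = fst (snd (frob \<alpha> b0 c0 b1 c1 \<beta> \<kappa> \<gamma> n))"

definition frobSP where "frobSP \<alpha> b0 c0 b1 c1 \<beta> \<kappa> \<gamma> n = fst (snd (snd (frob \<alpha> b0 c0 b1 c1 \<beta> \<kappa> \<gamma> n)))"

definition frobSQ where "frobSQ \<alpha> b0 c0 b1 c1 \<beta> \<kappa> \<gamma> n = snd (snd (snd (frob \<alpha> b0 c0 b1 c1 \<beta> \<kappa> \<gamma> n)))"

lemmas frob_parts = frobP_def frobQ_def frobSP_def frobSQ_def

text \<open>
  The inverse matrix in the recursion is of size \<open>O(1 / N)\<close>, so one step multiplies a bound for the
  coefficients and their partial sums by at most \<open>1 + O(1 / N)\<close>. Such a product grows only polynomially,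
  and the ratio test gives convergence in the unit disc.
\<close>

primrec frob_majorant :: "real \<Rightarrow> nat \<Rightarrow> real" where
  "frob_majorant K 0 = K"
| "frob_majorant K (Suc n) = frob_majorant K n * (1 + 4 * K * (1 + K) / Suc n)"

lemma frob_majorant_nonneg: "K \<ge> 0 \<Longrightarrow> frob_majorant K n \<ge> 0"
  by (induction n) auto

lemma summable_frob_majorant:
  assumes "K \<ge> 0" "0 \<le> r" "r < 1"
  shows "summable (\<lambda>n. frob_majorant K n * r ^ n)"
proof -
  define B where "B = 4 * K * (1 + K)"
  have B: "B \<ge> 0" using assms by (simp add: B_def)
  define c where "c = (1 + r) / 2"
  have c: "c < 1" "r < c" using assms by (auto simp: c_def)
  have "((\<lambda>n. (1 + B / real (Suc n)) * r) \<longlonglongrightarrow> (1 + 0) * r)"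
    by (intro tendsto_intros lim_const_over_n[THEN LIMSEQ_Suc])
  then have "eventually (\<lambda>n. (1 + B / real (Suc n)) * r < c) sequentially"
    using c(2) by (intro order_tendstoD) auto
  then obtain N where N: "\<And>n. n \<ge> N \<Longrightarrow> (1 + B / real (Suc n)) * r < c"
    by (auto simp: eventually_sequentially)
  show ?thesis
  proof (rule summable_ratio_test[OF c(1)])
    fix n assume "n \<ge> N"
    have "norm (frob_majorant K (Suc n) * r ^ Suc n)
        = ((1 + B / real (Suc n)) * r) * norm (frob_majorant K n * r ^ n)"
      using frob_majorant_nonneg[OF assms(1), of n] assms B
      by (simp add: B_def abs_mult field_simps)
    also have "\<dots> \<le> c * norm (frob_majorant K n * r ^ n)"
      by (intro mult_right_mono less_imp_le[OF N[OF \<open>n \<ge> N\<close>]]) auto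
    finally show "norm (frob_majorant K (Suc n) * r ^ Suc n) \<le> c * norm (frob_majorant K n * r ^ n)" .
  qed
qed

text \<open>
  A single constant bounds all parameters, so that estimates are uniform on bounded parameter sets.
\<close>

definition frob_bounded where
  "frob_bounded K \<alpha> b0 c0 b1 c1 \<beta> \<kappa> \<gamma> \<longleftrightarrow> \<alpha> \<ge> 1 / 2 \<and> \<alpha> \<le> K \<and> 1 \<le> K \<and> norm b0 \<le> K \<and> norm c0 \<le> K
     \<and> norm b1 \<le> K \<and> norm c1 \<le> K \<and> norm \<beta> \<le> K \<and> norm \<kappa> \<le> K \<and> norm (\<gamma>::complex) \<le> K"

lemma norm_lin4_bound:
  assumes "norm (a::complex) \<le> K" "norm b \<le> K" "norm c \<le> K" "norm d \<le> K"
    and "norm p \<le> G" "norm q \<le> G" "norm r \<le> G" "norm s \<le> G"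
  shows "norm (a * p + b * q + c * r + d * s) \<le> 4 * K * G"
proof -
  have K: "K \<ge> 0" using assms(1) norm_ge_zero order_trans by blast
  have "norm (a * p + b * q + c * r + d * s) \<le> norm (a * p) + norm (b * q) + norm (c * r) + norm (d * s)"
    by (meson add_mono norm_triangle_ineq norm_triangle_le order_refl)
  also have "\<dots> \<le> K * G + K * G + K * G + K * G"
    unfolding norm_mult by (intro add_mono mult_mono) (use assms K in auto)
  finally show ?thesis by (simp add: algebra_simps)
qed

lemma frob_bound:
  assumes "frob_bounded K \<alpha> b0 c0 b1 c1 \<beta> \<kappa> \<gamma>"
  shows "norm (frobP \<alpha> b0 c0 b1 c1 \<beta> \<kappa> \<gamma> n) \<le> frob_majorant K n \<and>
    norm (frobQ \<alpha> b0 c0 b1 c1 \<beta> \<kappa> \<gamma> n) \<le> frob_majorant K n \<and>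
    norm (frobSP \<alpha> b0 c0 b1 c1 \<beta> \<kappa> \<gamma> n) \<le> frob_majorant K n \<and>
    norm (frobSQ \<alpha> b0 c0 b1 c1 \<beta> \<kappa> \<gamma> n) \<le> frob_majorant K n"
proof (induction n)
  case 0
  have "norm (b0 / (2 * of_real \<alpha>)) \<le> K"
  proof -
    have "norm (b0 / (2 * of_real \<alpha>)) = norm b0 / (2 * \<alpha>)"
      using assms by (simp add: norm_divide norm_mult frob_bounded_def)
    also have "\<dots> \<le> K / 1"
      by (intro frac_le) (use assms in \<open>auto simp: frob_bounded_def\<close>)
    finally show ?thesis by simp
  qed
  then show ?case using assms by (simp add: frob_parts frob_bounded_def)
next
  case (Suc n)
  note b = assms[unfolded frob_bounded_def]
  let ?G = "frob_majorant K n"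
  define p q sp sq where "p = frobP \<alpha> b0 c0 b1 c1 \<beta> \<kappa> \<gamma> n" and "q = frobQ \<alpha> b0 c0 b1 c1 \<beta> \<kappa> \<gamma> n"
    and "sp = frobSP \<alpha> b0 c0 b1 c1 \<beta> \<kappa> \<gamma> n" and "sq = frobSQ \<alpha> b0 c0 b1 c1 \<beta> \<kappa> \<gamma> n"
  define r where "r = of_real \<alpha> * sp + b1 * sq + \<beta> * p + \<kappa> * q"
  define s where "s = c1 * sp + (- of_real \<alpha>) * sq + \<gamma> * p + (- \<beta>) * q"
  define N :: complex where "N = of_nat (Suc n)"
  define M :: complex where "M = N + 2 * of_real \<alpha>"
  have IH: "norm p \<le> ?G" "norm q \<le> ?G" "norm sp \<le> ?G" "norm sq \<le> ?G"
    using Suc by (auto simp: p_def q_def sp_def sq_def)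
  have G: "?G \<ge> 0" using frob_majorant_nonneg b by auto
  have r: "norm r \<le> 4 * K * ?G" and s: "norm s \<le> 4 * K * ?G"
    unfolding r_def s_def by (intro norm_lin4_bound; use b IH in simp)+
  have nN: "norm N = real (Suc n)" by (simp add: N_def norm_of_nat del: of_nat_Suc)
  have "M = complex_of_real (real (Suc n) + 2 * \<alpha>)" by (simp add: M_def N_def)
  then have nM: "norm M = real (Suc n) + 2 * \<alpha>" using b by (metis norm_of_real abs_of_nonneg
     add_nonneg_nonneg of_nat_0_le_iff mult_nonneg_nonneg zero_le_numeral order_trans half_bounded_equal le_divide_eq_numeral1(1) mult_zero_left zero_le_one)
  have eqs: "frobP \<alpha> b0 c0 b1 c1 \<beta> \<kappa> \<gamma> (Suc n) = (N * r + b0 * s) / (N * M)"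
    "frobQ \<alpha> b0 c0 b1 c1 \<beta> \<kappa> \<gamma> (Suc n) = (c0 * r + M * s) / (N * M)"
    "frobSP \<alpha> b0 c0 b1 c1 \<beta> \<kappa> \<gamma> (Suc n) = sp + (N * r + b0 * s) / (N * M)"
    "frobSQ \<alpha> b0 c0 b1 c1 \<beta> \<kappa> \<gamma> (Suc n) = sq + (c0 * r + M * s) / (N * M)"
    by (simp_all add: frob_parts Let_def r_def s_def M_def N_def p_def q_def sp_def sq_def)
  have K: "K \<ge> 1" "\<alpha> \<ge> 1/2" using b by auto
  have NM: "norm N * norm M > 0" using nN nM K by auto
  \<comment> \<open>both rows of \<open>N + \<alpha> + A\<^sub>0\<close> have sums at most \<open>(1 + K) |M|\<close>; division by \<open>N M\<close> leaves \<open>(1 + K) / N\<close>\<close>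
  have key: "(norm N + K) \<le> (1 + K) * norm M" "(K + norm M) \<le> (1 + K) * norm M"
  proof -
    have "norm N \<le> norm M" "K * 1 \<le> K * norm M" using nN nM K by (auto intro!: mult_left_mono)
    then show "(norm N + K) \<le> (1 + K) * norm M" "(K + norm M) \<le> (1 + K) * norm M"
      by (auto simp: algebra_simps)
  qed
  have X: "X / (norm N * norm M) \<le> 4 * K * (1 + K) * ?G / real (Suc n)"
    if "X \<le> (1 + K) * norm M * (4 * K * ?G)" for X
  proof -
    have "X / (norm N * norm M) \<le> (1 + K) * norm M * (4 * K * ?G) / (norm N * norm M)"
      by (intro divide_right_mono that) (use NM in auto)
    also have "\<dots> = 4 * K * (1 + K) * ?G / real (Suc n)"
      using NM nN by (simp add: field_simps)
    finally show ?thesis .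
  qed
  have P: "norm ((N * r + b0 * s) / (N * M)) \<le> 4 * K * (1 + K) * ?G / real (Suc n)"
    unfolding norm_divide norm_mult
  proof (rule X)
    have "norm (N * r + b0 * s) \<le> norm N * (4 * K * ?G) + K * (4 * K * ?G)"
      by (rule order_trans[OF norm_triangle_ineq]) (unfold norm_mult, intro add_mono mult_mono, use r s b in auto)
    also have "\<dots> = (norm N + K) * (4 * K * ?G)" by (simp add: algebra_simps)
    also have "\<dots> \<le> (1 + K) * norm M * (4 * K * ?G)"
      by (intro mult_right_mono key) (use G K in auto)
    finally show "norm (N * r + b0 * s) \<le> (1 + K) * norm M * (4 * K * ?G)" .
  qed
  have Q: "norm ((c0 * r + M * s) / (N * M)) \<le> 4 * K * (1 + K) * ?G / real (Suc n)"
    unfolding norm_divide norm_mult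
  proof (rule X)
    have "norm (c0 * r + M * s) \<le> K * (4 * K * ?G) + norm M * (4 * K * ?G)"
      by (rule order_trans[OF norm_triangle_ineq]) (unfold norm_mult, intro add_mono mult_mono, use r s b in auto)
    also have "\<dots> = (K + norm M) * (4 * K * ?G)" by (simp add: algebra_simps)
    also have "\<dots> \<le> (1 + K) * norm M * (4 * K * ?G)"
      by (intro mult_right_mono key) (use G K in auto)
    finally show "norm (c0 * r + M * s) \<le> (1 + K) * norm M * (4 * K * ?G)" .
  qed
  have S: "frob_majorant K (Suc n) = ?G + 4 * K * (1 + K) * ?G / real (Suc n)"
    by (simp add: field_simps)
  show ?case unfolding eqs S using P Q IH G
    by (smt (verit) norm_triangle_ineq)
qed

text \<open>
  Comparison of coefficients in the differential equation, that is, the recursion before the matrix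
  \<open>N + \<alpha> - A\<^sub>0\<close> is inverted.
\<close>

lemma frob_recurrence:
  assumes "\<alpha> \<ge> 1 / 2" "b0 * c0 = 0"
  shows "(of_nat (Suc n) + 2 * of_real \<alpha>) * frobP \<alpha> b0 c0 b1 c1 \<beta> \<kappa> \<gamma> (Suc n) - b0 * frobQ \<alpha> b0 c0 b1 c1 \<beta> \<kappa> \<gamma> (Suc n)
      = of_real \<alpha> * frobSP \<alpha> b0 c0 b1 c1 \<beta> \<kappa> \<gamma> n + b1 * frobSQ \<alpha> b0 c0 b1 c1 \<beta> \<kappa> \<gamma> n
        + \<beta> * frobP \<alpha> b0 c0 b1 c1 \<beta> \<kappa> \<gamma> n + \<kappa> * frobQ \<alpha> b0 c0 b1 c1 \<beta> \<kappa> \<gamma> n" (is ?A)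
    and "of_nat (Suc n) * frobQ \<alpha> b0 c0 b1 c1 \<beta> \<kappa> \<gamma> (Suc n) - c0 * frobP \<alpha> b0 c0 b1 c1 \<beta> \<kappa> \<gamma> (Suc n)
      = c1 * frobSP \<alpha> b0 c0 b1 c1 \<beta> \<kappa> \<gamma> n - of_real \<alpha> * frobSQ \<alpha> b0 c0 b1 c1 \<beta> \<kappa> \<gamma> n
        + \<gamma> * frobP \<alpha> b0 c0 b1 c1 \<beta> \<kappa> \<gamma> n - \<beta> * frobQ \<alpha> b0 c0 b1 c1 \<beta> \<kappa> \<gamma> n" (is ?B)
    and "frobSP \<alpha> b0 c0 b1 c1 \<beta> \<kappa> \<gamma> (Suc n) = frobSP \<alpha> b0 c0 b1 c1 \<beta> \<kappa> \<gamma> n + frobP \<alpha> b0 c0 b1 c1 \<beta> \<kappa> \<gamma> (Suc n)"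
    and "frobSQ \<alpha> b0 c0 b1 c1 \<beta> \<kappa> \<gamma> (Suc n) = frobSQ \<alpha> b0 c0 b1 c1 \<beta> \<kappa> \<gamma> n + frobQ \<alpha> b0 c0 b1 c1 \<beta> \<kappa> \<gamma> (Suc n)"
proof -
  have lin: "M * ((N * r + b0 * s) / (N * M)) - b0 * ((c0 * r + M * s) / (N * M)) = r"
     "N * ((c0 * r + M * s) / (N * M)) - c0 * ((N * r + b0 * s) / (N * M)) = s"
    if "N \<noteq> 0" "M \<noteq> 0" for r s M N
  proof -
    have bc: "b0 * (c0 * x) = 0" "c0 * (b0 * x) = 0" for x
      using assms(2) by (auto)
    have "M * ((N * r + b0 * s) / (N * M)) - b0 * ((c0 * r + M * s) / (N * M))
        = (M * (N * r + b0 * s) - b0 * (c0 * r + M * s)) / (N * M)"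
      by (simp add: diff_divide_distrib)
    also have "\<dots> = (M * N * r) / (N * M)" by (simp add: algebra_simps bc)
    finally show "M * ((N * r + b0 * s) / (N * M)) - b0 * ((c0 * r + M * s) / (N * M)) = r" using that by simp
    have "N * ((c0 * r + M * s) / (N * M)) - c0 * ((N * r + b0 * s) / (N * M))
        = (N * (c0 * r + M * s) - c0 * (N * r + b0 * s)) / (N * M)"
      by (simp add: diff_divide_distrib)
    also have "\<dots> = (M * N * s) / (N * M)" by (simp add: algebra_simps bc)
    finally show "N * ((c0 * r + M * s) / (N * M)) - c0 * ((N * r + b0 * s) / (N * M)) = s" using that by simp
  qed
  have "Re (of_nat (Suc n) + 2 * complex_of_real \<alpha>) > 0" using assms by simp
  then have M: "of_nat (Suc n) + 2 * complex_of_real \<alpha> \<noteq> 0"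
    by (metis less_irrefl zero_complex.simps(1))
  have N: "of_nat (Suc n) \<noteq> (0::complex)" by (simp only: of_nat_eq_0_iff)
  show ?A unfolding frob_parts frob.simps Let_def fst_conv snd_conv by (rule lin(1)[OF N M])
  show ?B unfolding frob_parts frob.simps Let_def fst_conv snd_conv by (rule lin(2)[OF N M])
qed (simp_all add: frob_parts Let_def)

definition serP where "serP \<alpha> b0 c0 b1 c1 \<beta> \<kappa> \<gamma> t = (\<Sum>n. frobP \<alpha> b0 c0 b1 c1 \<beta> \<kappa> \<gamma> n * t ^ n)"

definition serQ where "serQ \<alpha> b0 c0 b1 c1 \<beta> \<kappa> \<gamma> t = (\<Sum>n. frobQ \<alpha> b0 c0 b1 c1 \<beta> \<kappa> \<gamma> n * t ^ n)"

lemma frob_bounded_exists: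
  assumes "\<alpha> \<ge> 1 / 2"
  shows "\<exists>K. frob_bounded K \<alpha> b0 c0 b1 c1 \<beta> \<kappa> \<gamma>"
proof
  show "frob_bounded (1 + \<alpha> + norm b0 + norm c0 + norm b1 + norm c1 + norm \<beta> + norm \<kappa> + norm \<gamma>)
    \<alpha> b0 c0 b1 c1 \<beta> \<kappa> \<gamma>"
    using assms norm_ge_zero[of b0] norm_ge_zero[of c0] norm_ge_zero[of b1] norm_ge_zero[of c1]
      norm_ge_zero[of \<beta>] norm_ge_zero[of \<kappa>] norm_ge_zero[of \<gamma>]
    unfolding frob_bounded_def by (intro conjI; linarith)
qed

lemma frob_bounded_ge_1: "frob_bounded K \<alpha> b0 c0 b1 c1 \<beta> \<kappa> \<gamma> \<Longrightarrow> K \<ge> 1"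
  by (simp add: frob_bounded_def)

lemma frob_term_bound:
  assumes "frob_bounded K \<alpha> b0 c0 b1 c1 \<beta> \<kappa> \<gamma>" "norm t \<le> r"
  shows "norm (frobP \<alpha> b0 c0 b1 c1 \<beta> \<kappa> \<gamma> n * t ^ n) \<le> frob_majorant K n * r ^ n"
    and "norm (frobQ \<alpha> b0 c0 b1 c1 \<beta> \<kappa> \<gamma> n * t ^ n) \<le> frob_majorant K n * r ^ n"
    and "norm (frobSP \<alpha> b0 c0 b1 c1 \<beta> \<kappa> \<gamma> n * t ^ n) \<le> frob_majorant K n * r ^ n"
    and "norm (frobSQ \<alpha> b0 c0 b1 c1 \<beta> \<kappa> \<gamma> n * t ^ n) \<le> frob_majorant K n * r ^ n"
  using frob_bound[OF assms(1), of n] assms(2) frob_majorant_nonneg[of K n] frob_bounded_ge_1[OF assms(1)]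
  unfolding norm_mult norm_power by (auto intro!: mult_mono power_mono)

lemma frob_summable:
  assumes "\<alpha> \<ge> 1 / 2" "norm t < 1"
  shows "summable (\<lambda>n. frobP \<alpha> b0 c0 b1 c1 \<beta> \<kappa> \<gamma> n * t ^ n)"
    and "summable (\<lambda>n. frobQ \<alpha> b0 c0 b1 c1 \<beta> \<kappa> \<gamma> n * t ^ n)"
    and "summable (\<lambda>n. frobSP \<alpha> b0 c0 b1 c1 \<beta> \<kappa> \<gamma> n * t ^ n)"
    and "summable (\<lambda>n. frobSQ \<alpha> b0 c0 b1 c1 \<beta> \<kappa> \<gamma> n * t ^ n)"
proof -
  obtain K where K: "frob_bounded K \<alpha> b0 c0 b1 c1 \<beta> \<kappa> \<gamma>"
    using frob_bounded_exists[OF assms(1)] by blast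
  have "summable (\<lambda>n. frob_majorant K n * norm t ^ n)"
    using summable_frob_majorant assms frob_bounded_ge_1[OF K] by simp
  then show "summable (\<lambda>n. frobP \<alpha> b0 c0 b1 c1 \<beta> \<kappa> \<gamma> n * t ^ n)"
    and "summable (\<lambda>n. frobQ \<alpha> b0 c0 b1 c1 \<beta> \<kappa> \<gamma> n * t ^ n)"
    and "summable (\<lambda>n. frobSP \<alpha> b0 c0 b1 c1 \<beta> \<kappa> \<gamma> n * t ^ n)"
    and "summable (\<lambda>n. frobSQ \<alpha> b0 c0 b1 c1 \<beta> \<kappa> \<gamma> n * t ^ n)"
    by (auto intro: summable_comparison_test' frob_term_bound[OF K order_refl])
qed

lemma ser_bound:
  assumes "frob_bounded K \<alpha> b0 c0 b1 c1 \<beta> \<kappa> \<gamma>" "norm t \<le> r" "r < 1"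
  shows "norm (serP \<alpha> b0 c0 b1 c1 \<beta> \<kappa> \<gamma> t) \<le> (\<Sum>n. frob_majorant K n * r ^ n)"
    and "norm (serQ \<alpha> b0 c0 b1 c1 \<beta> \<kappa> \<gamma> t) \<le> (\<Sum>n. frob_majorant K n * r ^ n)"
proof -
  have "0 \<le> r" using assms(2) norm_ge_zero order_trans by blast
  then have s: "summable (\<lambda>n. frob_majorant K n * r ^ n)"
    using summable_frob_majorant assms frob_bounded_ge_1[OF assms(1)] by simp
  show "norm (serP \<alpha> b0 c0 b1 c1 \<beta> \<kappa> \<gamma> t) \<le> (\<Sum>n. frob_majorant K n * r ^ n)"
    "norm (serQ \<alpha> b0 c0 b1 c1 \<beta> \<kappa> \<gamma> t) \<le> (\<Sum>n. frob_majorant K n * r ^ n)"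
    unfolding serP_def serQ_def by (intro norm_suminf_le s frob_term_bound assms)+
qed

lemma shifted_power_series:
  fixes a :: "nat \<Rightarrow> complex"
  assumes "summable (\<lambda>n. a n * t ^ n)"
  shows "summable (\<lambda>n. a (Suc n) * t ^ n)" "(\<Sum>n. a n * t ^ n) = a 0 + t * (\<Sum>n. a (Suc n) * t ^ n)"
proof -
  show s: "summable (\<lambda>n. a (Suc n) * t ^ n)"
    using assms by (simp add: summable_powser_split_head)
  show "(\<Sum>n. a n * t ^ n) = a 0 + t * (\<Sum>n. a (Suc n) * t ^ n)"
    using powser_split_head(1)[OF assms] by (simp add: mult.commute)
qed

text \<open>
  The partial sums of the coefficients are the coefficients of \<open>P / (1 - t)\<close> and \<open>Q / (1 - t)\<close>, so
  summing the recurrence against \<open>t\<^sup>n\<close> gives the equation at once. The first coefficients drop out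
  because they form an eigenvector of the residue matrix.
\<close>

lemma ser_ode:
  fixes t b0 c0 b1 c1 \<beta> \<kappa> \<gamma> :: complex
  assumes "\<alpha> \<ge> 1 / 2" "b0 * c0 = 0" "norm t < 1"
  defines "P \<equiv> serP \<alpha> b0 c0 b1 c1 \<beta> \<kappa> \<gamma>" and "Q \<equiv> serQ \<alpha> b0 c0 b1 c1 \<beta> \<kappa> \<gamma>"
  shows "\<exists>P' Q'. (P has_field_derivative P') (at t) \<and> (Q has_field_derivative Q') (at t) \<and>
    t * P' = - 2 * of_real \<alpha> * P t + b0 * Q t + t * ((of_real \<alpha> * P t + b1 * Q t) / (1 - t) + \<beta> * P t + \<kappa> * Q t) \<and>
    t * Q' = c0 * P t + t * ((c1 * P t - of_real \<alpha> * Q t) / (1 - t) + \<gamma> * P t - \<beta> * Q t)"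
proof -
  define p where "p = frobP \<alpha> b0 c0 b1 c1 \<beta> \<kappa> \<gamma>"
  define q where "q = frobQ \<alpha> b0 c0 b1 c1 \<beta> \<kappa> \<gamma>"
  define sp where "sp = frobSP \<alpha> b0 c0 b1 c1 \<beta> \<kappa> \<gamma>"
  define sq where "sq = frobSQ \<alpha> b0 c0 b1 c1 \<beta> \<kappa> \<gamma>"
  note sm = frob_summable[OF assms(1), of _ b0 c0 b1 c1 \<beta> \<kappa> \<gamma>, folded p_def q_def sp_def sq_def]
  note rec = frob_recurrence(1)[OF assms(1,2), of _ b1 c1 \<beta> \<kappa> \<gamma>, folded p_def q_def sp_def sq_def]
    frob_recurrence(2)[OF assms(1,2), of _ b1 c1 \<beta> \<kappa> \<gamma>, folded p_def q_def sp_def sq_def]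
    frob_recurrence(3)[OF assms(1,2), of b1 c1 \<beta> \<kappa> \<gamma>, folded p_def q_def sp_def sq_def]
    frob_recurrence(4)[OF assms(1,2), of b1 c1 \<beta> \<kappa> \<gamma>, folded p_def q_def sp_def sq_def]
  obtain k where k: "norm t < k" "k < 1" using assms(3) dense by blast
  have kn: "norm (complex_of_real k) = k" unfolding norm_of_real using k norm_ge_zero[of t] by linarith
  have DP: "(P has_field_derivative (\<Sum>n. diffs p n * t ^ n)) (at t)"
    unfolding P_def serP_def p_def[symmetric]
    by (rule termdiffs_strong[OF sm(1)[of "of_real k"]]) (simp_all only: kn k)
  have DQ: "(Q has_field_derivative (\<Sum>n. diffs q n * t ^ n)) (at t)"
    unfolding Q_def serQ_def q_def[symmetric]
    by (rule termdiffs_strong[OF sm(2)[of "of_real k"]]) (simp_all only: kn k)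
  have sdP: "summable (\<lambda>n. diffs p n * t ^ n)"
    by (rule termdiff_converges[of t 1]) (use sm assms(3) in auto)
  have sdQ: "summable (\<lambda>n. diffs q n * t ^ n)"
    by (rule termdiff_converges[of t 1]) (use sm assms(3) in auto)
  define A where "A = (\<Sum>n. p (Suc n) * t ^ n)"
  define B where "B = (\<Sum>n. q (Suc n) * t ^ n)"
  define X where "X = (\<Sum>n. sp n * t ^ n)"
  define Y where "Y = (\<Sum>n. sq n * t ^ n)"
  note s = sm[OF assms(3)]
  note sh = shifted_power_series[OF s(1)] shifted_power_series[OF s(2)]
     shifted_power_series[OF s(3)] shifted_power_series[OF s(4)]
  have P: "P t = p 0 + t * A" and Q: "Q t = q 0 + t * B"
    using sh by (auto simp: P_def Q_def serP_def serQ_def p_def q_def A_def B_def)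
  have sA: "(\<lambda>n. p (Suc n) * t ^ n) sums A" and sB: "(\<lambda>n. q (Suc n) * t ^ n) sums B"
    and sX: "(\<lambda>n. sp n * t ^ n) sums X" and sY: "(\<lambda>n. sq n * t ^ n) sums Y"
    unfolding A_def B_def X_def Y_def by (intro summable_sums sh s)+
  have sP: "(\<lambda>n. p n * t ^ n) sums P t" and sQ: "(\<lambda>n. q n * t ^ n) sums Q t"
    unfolding P_def Q_def serP_def serQ_def p_def[symmetric] q_def[symmetric] by (intro summable_sums s)+
  have "(\<lambda>n. sp (Suc n) * t ^ n) sums (X + A)" "(\<lambda>n. sq (Suc n) * t ^ n) sums (Y + B)"
    unfolding rec(3,4) distrib_right by (intro sums_add sA sB sX sY)+
  then have "X = sp 0 + t * (X + A)" "Y = sq 0 + t * (Y + B)"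
    using sh by (auto simp: X_def Y_def sums_iff)
  moreover have "sp 0 = p 0" "sq 0 = q 0"
    by (auto simp: p_def q_def sp_def sq_def frob_parts)
  ultimately have "(1 - t) * X = P t" "(1 - t) * Y = Q t" unfolding P Q by (auto simp: algebra_simps)
  moreover have t1: "1 - t \<noteq> 0" using assms(3) by auto
  ultimately have X: "X = P t / (1 - t)" and Y: "Y = Q t / (1 - t)" by (auto simp: field_simps)
  define P' where "P' = (\<Sum>n. diffs p n * t ^ n)"
  define Q' where "Q' = (\<Sum>n. diffs q n * t ^ n)"
  have "(\<lambda>n. diffs p n * t ^ n + 2 * of_real \<alpha> * (p (Suc n) * t ^ n) - b0 * (q (Suc n) * t ^ n)) sums (P' + 2 * of_real \<alpha> * A - b0 * B)"
    unfolding P'_def by (intro sums_add sums_diff sums_mult sA sB summable_sums sdP)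
  moreover have "(\<lambda>n. of_real \<alpha> * (sp n * t ^ n) + b1 * (sq n * t ^ n) + \<beta> * (p n * t ^ n) + \<kappa> * (q n * t ^ n)) sums
      (of_real \<alpha> * X + b1 * Y + \<beta> * P t + \<kappa> * Q t)"
    by (intro sums_add sums_mult sX sY sP sQ)
  moreover have "diffs p n * t ^ n + 2 * of_real \<alpha> * (p (Suc n) * t ^ n) - b0 * (q (Suc n) * t ^ n)
     = of_real \<alpha> * (sp n * t ^ n) + b1 * (sq n * t ^ n) + \<beta> * (p n * t ^ n) + \<kappa> * (q n * t ^ n)" for n
    using arg_cong[OF rec(1)[of n], of "\<lambda>x. x * t ^ n"]
    by (simp only: diffs_def algebra_simps)
  ultimately have 1: "P' + 2 * of_real \<alpha> * A - b0 * B = of_real \<alpha> * X + b1 * Y + \<beta> * P t + \<kappa> * Q t"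
    using sums_unique2 by simp
  have "(\<lambda>n. diffs q n * t ^ n - c0 * (p (Suc n) * t ^ n)) sums (Q' - c0 * A)"
    unfolding Q'_def by (intro sums_add sums_diff sums_mult sA sB summable_sums sdQ)
  moreover have "(\<lambda>n. c1 * (sp n * t ^ n) - of_real \<alpha> * (sq n * t ^ n) + \<gamma> * (p n * t ^ n) - \<beta> * (q n * t ^ n)) sums
      (c1 * X - of_real \<alpha> * Y + \<gamma> * P t - \<beta> * Q t)"
    by (intro sums_add sums_diff sums_mult sX sY sP sQ)
  moreover have "diffs q n * t ^ n - c0 * (p (Suc n) * t ^ n)
     = c1 * (sp n * t ^ n) - of_real \<alpha> * (sq n * t ^ n) + \<gamma> * (p n * t ^ n) - \<beta> * (q n * t ^ n)" for n
    using arg_cong[OF rec(2)[of n], of "\<lambda>x. x * t ^ n"]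
    by (simp only: diffs_def algebra_simps)
  ultimately have 2: "Q' - c0 * A = c1 * X - of_real \<alpha> * Y + \<gamma> * P t - \<beta> * Q t"
    using sums_unique2 by simp
  have \<alpha>: "of_real \<alpha> \<noteq> (0::complex)" using assms(1) by simp
  have p0: "2 * of_real \<alpha> * p 0 = b0" "q 0 = 1" "c0 * p 0 = 0"
    using \<alpha> assms(2) by (auto simp: p_def q_def frob_parts)
  have "t * P' = t * (of_real \<alpha> * X + b1 * Y + \<beta> * P t + \<kappa> * Q t) - 2 * of_real \<alpha> * (P t - p 0) + b0 * (Q t - q 0)"
    using arg_cong[OF 1, of "\<lambda>x. t * x"] unfolding P Q by (simp add: algebra_simps)
  then have e1: "t * P' = - 2 * of_real \<alpha> * P t + b0 * Q t + t * ((of_real \<alpha> * P t + b1 * Q t) / (1 - t) + \<beta> * P t + \<kappa> * Q t)"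
    using p0 unfolding X Y by (simp add: algebra_simps add_divide_distrib)
  have "t * Q' = t * (c1 * X - of_real \<alpha> * Y + \<gamma> * P t - \<beta> * Q t) + c0 * (P t - p 0)"
    using arg_cong[OF 2, of "\<lambda>x. t * x"] unfolding P Q by (simp add: algebra_simps)
  then have e2: "t * Q' = c0 * P t + t * ((c1 * P t - of_real \<alpha> * Q t) / (1 - t) + \<gamma> * P t - \<beta> * Q t)"
    using p0 unfolding X Y by (simp add: algebra_simps diff_divide_distrib)
  show ?thesis using DP DQ e1 e2 unfolding P'_def Q'_def by blast
qed

text \<open>
  The factor \<open>t\<^sup>\<alpha>\<close> moves the exponent back into the residue matrix.
\<close>

lemma frob_system_solution:
  fixes t :: real and b0 c0 b1 c1 \<beta> \<kappa> \<gamma> :: complex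
  assumes "\<alpha> \<ge> 1 / 2" "b0 * c0 = 0" "0 < t" "t < 1"
  defines "y1 \<equiv> \<lambda>t. of_real (t powr \<alpha>) * serP \<alpha> b0 c0 b1 c1 \<beta> \<kappa> \<gamma> (of_real t)"
    and "y2 \<equiv> \<lambda>t. of_real (t powr \<alpha>) * serQ \<alpha> b0 c0 b1 c1 \<beta> \<kappa> \<gamma> (of_real t)"
    and "h \<equiv> of_real (- \<alpha> / t + \<alpha> / (1 - t)) + \<beta>"
  shows "(y1 has_vector_derivative
      h * y1 t + (b0 / of_real t + b1 / of_real (1 - t) + \<kappa>) * y2 t) (at t)"
   and "(y2 has_vector_derivative
      (c0 / of_real t + c1 / of_real (1 - t) + \<gamma>) * y1 t - h * y2 t) (at t)"
proof -
  have nt: "norm (complex_of_real t) < 1" using assms by simp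
  define P Q where "P = serP \<alpha> b0 c0 b1 c1 \<beta> \<kappa> \<gamma>" and "Q = serQ \<alpha> b0 c0 b1 c1 \<beta> \<kappa> \<gamma>"
  obtain P' Q' :: complex where D: "(P has_field_derivative P') (at (of_real t))" "(Q has_field_derivative Q') (at (of_real t))"
   and e: "t * P' = - 2 * of_real \<alpha> * P t + b0 * Q t + t * ((of_real \<alpha> * P t + b1 * Q t) / (1 - of_real t) + \<beta> * P t + \<kappa> * Q t)"
     "t * Q' = c0 * P t + t * ((c1 * P t - of_real \<alpha> * Q t) / (1 - of_real t) + \<gamma> * P t - \<beta> * Q t)"
    using ser_ode[OF assms(1,2) nt, of b1 c1 \<beta> \<kappa> \<gamma>] unfolding P_def Q_def by blast
  have ne: "complex_of_real t \<noteq> 0" "1 - complex_of_real t \<noteq> 0" using assms(3,4)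
    by (auto simp: of_real_def) (metis less_irrefl of_real_1 of_real_def of_real_eq_iff)
  have DW: "((\<lambda>t. complex_of_real (t powr \<alpha>)) has_vector_derivative of_real (t powr \<alpha>) * (of_real \<alpha> / of_real t)) (at t)"
  proof -
    have "((\<lambda>t. t powr \<alpha>) has_real_derivative \<alpha> * t powr (\<alpha> - 1)) (at t)"
      using has_real_derivative_powr[OF assms(3)] by simp
    moreover have "\<alpha> * t powr (\<alpha> - 1) = t powr \<alpha> * (\<alpha> / t)"
      using assms(3) by (simp add: powr_diff)
    ultimately have "((\<lambda>t. t powr \<alpha>) has_real_derivative t powr \<alpha> * (\<alpha> / t)) (at t)"
      by simp
    then show ?thesis
      by (intro has_vector_derivative_eq_rhs[OF has_vector_derivative_of_real])
         (assumption, simp only: of_real_mult of_real_divide)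
  qed
  have DP: "((\<lambda>t. P (of_real t)) has_vector_derivative P') (at t)"
    and DQ: "((\<lambda>t. Q (of_real t)) has_vector_derivative Q') (at t)"
    using D by (auto intro: has_vector_derivative_real_field)
  have P': "P' = (- 2 * of_real \<alpha> * P t + b0 * Q t) / t + ((of_real \<alpha> * P t + b1 * Q t) / (1 - of_real t) + \<beta> * P t + \<kappa> * Q t)"
    using ne e(1) by (simp add: field_simps)
  have Q': "Q' = c0 * P t / t + ((c1 * P t - of_real \<alpha> * Q t) / (1 - of_real t) + \<gamma> * P t - \<beta> * Q t)"
    using ne e(2) by (simp add: field_simps)
  show "(y1 has_vector_derivative h * y1 t + (b0 / of_real t + b1 / of_real (1 - t) + \<kappa>) * y2 t) (at t)"
    unfolding y1_def y2_def P_def[symmetric] Q_def[symmetric]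
    by (rule has_vector_derivative_eq_rhs[OF has_vector_derivative_mult[OF DW DP]])
       (simp add: P' h_def divide_inverse algebra_simps)
  show "(y2 has_vector_derivative (c0 / of_real t + c1 / of_real (1 - t) + \<gamma>) * y1 t - h * y2 t) (at t)"
    unfolding y1_def y2_def P_def[symmetric] Q_def[symmetric]
    by (rule has_vector_derivative_eq_rhs[OF has_vector_derivative_mult[OF DW DQ]])
       (simp add: Q' h_def divide_inverse algebra_simps)
qed

lemma ser_zero: "serQ \<alpha> b0 c0 b1 c1 \<beta> \<kappa> \<gamma> 0 = 1"
  unfolding serQ_def powser_zero by (simp add: frobQ_def)

lemma frob_continuous:
  assumes "\<alpha> \<ge> 1 / 2" "continuous_on S b0" "continuous_on S c0" "continuous_on S b1" "continuous_on S c1"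
    "continuous_on S \<beta>" "continuous_on S \<kappa>" "continuous_on S \<gamma>"
  shows "continuous_on S (\<lambda>x. frob \<alpha> (b0 x) (c0 x) (b1 x) (c1 x) (\<beta> x) (\<kappa> x) (\<gamma> x) n)"
proof (induction n)
  case 0
  then show ?case using assms by (auto intro!: continuous_intros)
next
  case (Suc n)
  have "Re (of_nat (Suc n) + 2 * complex_of_real \<alpha>) > 0" using assms by simp
  then have M: "of_nat (Suc n) + 2 * complex_of_real \<alpha> \<noteq> 0"
    by (metis less_irrefl zero_complex.simps(1))
  have N: "of_nat (Suc n) \<noteq> (0::complex)" by (simp only: of_nat_eq_0_iff)
  show ?case unfolding frob.simps Let_def
    by (intro continuous_intros assms Suc) (use M N in auto)
qed

lemma frob_holomorphic:
  assumes "\<alpha> \<ge> 1 / 2" "b0 holomorphic_on S" "c0 holomorphic_on S" "b1 holomorphic_on S" "c1 holomorphic_on S"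
    "\<beta> holomorphic_on S" "\<kappa> holomorphic_on S" "\<gamma> holomorphic_on S"
  defines "f \<equiv> \<lambda>n x. frob \<alpha> (b0 x) (c0 x) (b1 x) (c1 x) (\<beta> x) (\<kappa> x) (\<gamma> x) n"
  shows "(\<lambda>x. fst (f n x)) holomorphic_on S \<and> (\<lambda>x. fst (snd (f n x))) holomorphic_on S
    \<and> (\<lambda>x. fst (snd (snd (f n x)))) holomorphic_on S \<and> (\<lambda>x. snd (snd (snd (f n x)))) holomorphic_on S"
proof (induction n)
  case 0
  then show ?case using assms(1-8) by (auto simp: f_def intro!: holomorphic_intros)
next
  case (Suc n)
  have "Re (of_nat (Suc n) + 2 * complex_of_real \<alpha>) > 0" using assms by simp
  then have M: "of_nat (Suc n) + 2 * complex_of_real \<alpha> \<noteq> 0"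
    by (metis less_irrefl zero_complex.simps(1))
  have N: "of_nat (Suc n) \<noteq> (0::complex)" by (simp only: of_nat_eq_0_iff)
  from Suc show ?case unfolding f_def frob.simps Let_def fst_conv snd_conv
    by (intro conjI; intro holomorphic_intros assms(2-8); elim conjE; (assumption | (use M N in auto; fail)))
qed

text \<open>
  The partial sums are polynomials in the parameters. Their uniform convergence on bounded parameter
  sets, with the argument in a disc of radius less than \<open>1\<close>, makes the sums jointly continuous and
  holomorphic along every holomorphic family of parameters.
\<close>

lemma ser_uniform_limit:
  assumes "\<And>x. x \<in> S \<Longrightarrow> frob_bounded K \<alpha> (b0 x) (c0 x) (b1 x) (c1 x) (\<beta> x) (\<kappa> x) (\<gamma> x)"
    and "\<And>x. x \<in> S \<Longrightarrow> norm (t x) \<le> r" "0 \<le> r" "r < 1"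
  shows "uniform_limit S (\<lambda>N x. \<Sum>n<N. frobP \<alpha> (b0 x) (c0 x) (b1 x) (c1 x) (\<beta> x) (\<kappa> x) (\<gamma> x) n * t x ^ n)
      (\<lambda>x. serP \<alpha> (b0 x) (c0 x) (b1 x) (c1 x) (\<beta> x) (\<kappa> x) (\<gamma> x) (t x)) sequentially"
   and "uniform_limit S (\<lambda>N x. \<Sum>n<N. frobQ \<alpha> (b0 x) (c0 x) (b1 x) (c1 x) (\<beta> x) (\<kappa> x) (\<gamma> x) n * t x ^ n)
      (\<lambda>x. serQ \<alpha> (b0 x) (c0 x) (b1 x) (c1 x) (\<beta> x) (\<kappa> x) (\<gamma> x) (t x)) sequentially"
proof -
  have sm: "summable (\<lambda>n. frob_majorant K n * r ^ n)" if ne: "S \<noteq> {}"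
  proof -
    obtain x where "x \<in> S" using ne by blast
    then show ?thesis using assms frob_bounded_ge_1[OF assms(1)] by (intro summable_frob_majorant) (auto intro: order_trans[of 0 1])
  qed
  from sm show "uniform_limit S (\<lambda>N x. \<Sum>n<N. frobP \<alpha> (b0 x) (c0 x) (b1 x) (c1 x) (\<beta> x) (\<kappa> x) (\<gamma> x) n * t x ^ n)
      (\<lambda>x. serP \<alpha> (b0 x) (c0 x) (b1 x) (c1 x) (\<beta> x) (\<kappa> x) (\<gamma> x) (t x)) sequentially"
  proof (cases "S = {}")
    case False
    show ?thesis unfolding serP_def
      by (rule Weierstrass_m_test[OF frob_term_bound(1)[OF assms(1,2)] sm[OF False]])
  qed simp
  from sm show "uniform_limit S (\<lambda>N x. \<Sum>n<N. frobQ \<alpha> (b0 x) (c0 x) (b1 x) (c1 x) (\<beta> x) (\<kappa> x) (\<gamma> x) n * t x ^ n)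
      (\<lambda>x. serQ \<alpha> (b0 x) (c0 x) (b1 x) (c1 x) (\<beta> x) (\<kappa> x) (\<gamma> x) (t x)) sequentially"
  proof (cases "S = {}")
    case False
    show ?thesis unfolding serQ_def
      by (rule Weierstrass_m_test[OF frob_term_bound(2)[OF assms(1,2)] sm[OF False]])
  qed simp
qed

lemma ser_continuous:
  assumes "\<And>x. x \<in> S \<Longrightarrow> frob_bounded K \<alpha> (b0 x) (c0 x) (b1 x) (c1 x) (\<beta> x) (\<kappa> x) (\<gamma> x)"
    and "\<And>x. x \<in> S \<Longrightarrow> norm (t x) \<le> r" "0 \<le> r" "r < 1"
    and "\<alpha> \<ge> 1 / 2" "continuous_on S b0" "continuous_on S c0" "continuous_on S b1" "continuous_on S c1"
    "continuous_on S \<beta>" "continuous_on S \<kappa>" "continuous_on S \<gamma>" "continuous_on S t"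
  shows "continuous_on S (\<lambda>x. serP \<alpha> (b0 x) (c0 x) (b1 x) (c1 x) (\<beta> x) (\<kappa> x) (\<gamma> x) (t x))"
    and "continuous_on S (\<lambda>x. serQ \<alpha> (b0 x) (c0 x) (b1 x) (c1 x) (\<beta> x) (\<kappa> x) (\<gamma> x) (t x))"
proof -
  note F = frob_continuous[OF assms(5-12)]
  show "continuous_on S (\<lambda>x. serP \<alpha> (b0 x) (c0 x) (b1 x) (c1 x) (\<beta> x) (\<kappa> x) (\<gamma> x) (t x))"
  proof (rule uniform_limit_theorem[OF always_eventually ser_uniform_limit(1)[OF assms(1-4)]], intro allI)
    show "continuous_on S (\<lambda>x. \<Sum>n<N. frobP \<alpha> (b0 x) (c0 x) (b1 x) (c1 x) (\<beta> x) (\<kappa> x) (\<gamma> x) n * t x ^ n)" for N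
      unfolding frob_parts
      by (intro continuous_on_sum continuous_on_mult continuous_on_power continuous_on_fst F assms(13))
  qed simp_all
  show "continuous_on S (\<lambda>x. serQ \<alpha> (b0 x) (c0 x) (b1 x) (c1 x) (\<beta> x) (\<kappa> x) (\<gamma> x) (t x))"
  proof (rule uniform_limit_theorem[OF always_eventually ser_uniform_limit(2)[OF assms(1-4)]], intro allI)
    show "continuous_on S (\<lambda>x. \<Sum>n<N. frobQ \<alpha> (b0 x) (c0 x) (b1 x) (c1 x) (\<beta> x) (\<kappa> x) (\<gamma> x) n * t x ^ n)" for N
      unfolding frob_parts
      by (intro continuous_on_sum continuous_on_mult continuous_on_power continuous_on_fst continuous_on_snd F assms(13))
  qed simp_all
qed

lemma ser_holomorphic:
  assumes "\<And>x. x \<in> S \<Longrightarrow> frob_bounded K \<alpha> (b0 x) (c0 x) (b1 x) (c1 x) (\<beta> x) (\<kappa> x) (\<gamma> x)"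
    and "norm t < 1" "open S"
    and "\<alpha> \<ge> 1 / 2" "b0 holomorphic_on S" "c0 holomorphic_on S" "b1 holomorphic_on S" "c1 holomorphic_on S"
    "\<beta> holomorphic_on S" "\<kappa> holomorphic_on S" "\<gamma> holomorphic_on S"
  shows "(\<lambda>x. serP \<alpha> (b0 x) (c0 x) (b1 x) (c1 x) (\<beta> x) (\<kappa> x) (\<gamma> x) t) holomorphic_on S"
    and "(\<lambda>x. serQ \<alpha> (b0 x) (c0 x) (b1 x) (c1 x) (\<beta> x) (\<kappa> x) (\<gamma> x) t) holomorphic_on S"
proof -
  note U = ser_uniform_limit[OF assms(1) order_refl norm_ge_zero assms(2)]
  note H = frob_holomorphic[OF assms(4-11)]
  have hP: "(\<lambda>x. \<Sum>n<N. frobP \<alpha> (b0 x) (c0 x) (b1 x) (c1 x) (\<beta> x) (\<kappa> x) (\<gamma> x) n * t ^ n) holomorphic_on S"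
    and hQ: "(\<lambda>x. \<Sum>n<N. frobQ \<alpha> (b0 x) (c0 x) (b1 x) (c1 x) (\<beta> x) (\<kappa> x) (\<gamma> x) n * t ^ n) holomorphic_on S" for N
    unfolding frob_parts
    by (intro holomorphic_on_sum holomorphic_on_mult holomorphic_on_const H[THEN conjunct1] H[THEN conjunct2, THEN conjunct1])+
  show "(\<lambda>x. serP \<alpha> (b0 x) (c0 x) (b1 x) (c1 x) (\<beta> x) (\<kappa> x) (\<gamma> x) t) holomorphic_on S"
  proof (rule holomorphic_uniform_sequence[OF assms(3) hP])
    fix x assume "x \<in> S"
    then obtain d where d: "d > 0" "cball x d \<subseteq> S" using assms(3) open_contains_cball by blast
    then show "\<exists>d>0. cball x d \<subseteq> S \<and> uniform_limit (cball x d)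
        (\<lambda>N x. \<Sum>n<N. frobP \<alpha> (b0 x) (c0 x) (b1 x) (c1 x) (\<beta> x) (\<kappa> x) (\<gamma> x) n * t ^ n)
        (\<lambda>x. serP \<alpha> (b0 x) (c0 x) (b1 x) (c1 x) (\<beta> x) (\<kappa> x) (\<gamma> x) t) sequentially"
      by (intro exI[of _ d] conjI d uniform_limit_on_subset[OF U(1)]) auto
  qed
  show "(\<lambda>x. serQ \<alpha> (b0 x) (c0 x) (b1 x) (c1 x) (\<beta> x) (\<kappa> x) (\<gamma> x) t) holomorphic_on S"
  proof (rule holomorphic_uniform_sequence[OF assms(3) hQ])
    fix x assume "x \<in> S"
    then obtain d where d: "d > 0" "cball x d \<subseteq> S" using assms(3) open_contains_cball by blast
    then show "\<exists>d>0. cball x d \<subseteq> S \<and> uniform_limit (cball x d)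
        (\<lambda>N x. \<Sum>n<N. frobQ \<alpha> (b0 x) (c0 x) (b1 x) (c1 x) (\<beta> x) (\<kappa> x) (\<gamma> x) n * t ^ n)
        (\<lambda>x. serQ \<alpha> (b0 x) (c0 x) (b1 x) (c1 x) (\<beta> x) (\<kappa> x) (\<gamma> x) t) sequentially"
      by (intro exI[of _ d] conjI d uniform_limit_on_subset[OF U(2)]) auto
  qed
qed

lemma ser_real:
  assumes "\<alpha> \<ge> 1 / 2" "b0 \<in> \<real>" "c0 \<in> \<real>" "b1 \<in> \<real>" "c1 \<in> \<real>" "\<beta> \<in> \<real>" "\<kappa> \<in> \<real>" "\<gamma> \<in> \<real>" "t \<in> \<real>" "norm t < 1"
  shows "serP \<alpha> b0 c0 b1 c1 \<beta> \<kappa> \<gamma> t \<in> \<real>" "serQ \<alpha> b0 c0 b1 c1 \<beta> \<kappa> \<gamma> t \<in> \<real>"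
proof -
  have nat: "of_nat n \<in> (\<real> :: complex set)" for n by simp
  have step: "p \<in> \<real> \<and> q \<in> \<real> \<and> sp \<in> \<real> \<and> sq \<in> \<real>"
    if "frob \<alpha> b0 c0 b1 c1 \<beta> \<kappa> \<gamma> n = (p, q, sp, sq)" for n p q sp sq
    using that
  proof (induction n arbitrary: p q sp sq)
    case 0
    then show ?case using assms(2) by auto
  next
    case (Suc n)
    obtain p1 q1 sp1 sq1 where e: "frob \<alpha> b0 c0 b1 c1 \<beta> \<kappa> \<gamma> n = (p1, q1, sp1, sq1)"
      by (metis prod.collapse)
    note IH = Suc.IH[OF e, THEN conjunct1] Suc.IH[OF e, THEN conjunct2, THEN conjunct1]
      Suc.IH[OF e, THEN conjunct2, THEN conjunct2, THEN conjunct1]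
      Suc.IH[OF e, THEN conjunct2, THEN conjunct2, THEN conjunct2]
    note R = Reals_add Reals_diff Reals_mult Reals_divide Reals_of_real nat Reals_numeral assms(2-8) IH
    show ?case using Suc.prems[symmetric] unfolding frob.simps Let_def e fst_conv snd_conv prod.inject
      by (elim conjE; hypsubst) (intro conjI R)
  qed
  have "frobP \<alpha> b0 c0 b1 c1 \<beta> \<kappa> \<gamma> n \<in> \<real>" "frobQ \<alpha> b0 c0 b1 c1 \<beta> \<kappa> \<gamma> n \<in> \<real>" for n
    using step[of n] by (auto simp: frob_parts split: prod.splits) (metis prod.collapse)+
  then have r: "(\<Sum>n<N. frobP \<alpha> b0 c0 b1 c1 \<beta> \<kappa> \<gamma> n * t ^ n) \<in> \<real>" "(\<Sum>n<N. frobQ \<alpha> b0 c0 b1 c1 \<beta> \<kappa> \<gamma> n * t ^ n) \<in> \<real>" for N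
    using assms(9) by (auto intro!: sum_in_Reals Reals_mult Reals_power)
  show "serP \<alpha> b0 c0 b1 c1 \<beta> \<kappa> \<gamma> t \<in> \<real>" unfolding serP_def
    by (rule closed_sequentially[OF closed_complex_Reals r(1) summable_LIMSEQ[OF frob_summable(1)[OF assms(1,10)]]])
  show "serQ \<alpha> b0 c0 b1 c1 \<beta> \<kappa> \<gamma> t \<in> \<real>" unfolding serQ_def
    by (rule closed_sequentially[OF closed_complex_Reals r(2) summable_LIMSEQ[OF frob_summable(2)[OF assms(1,10)]]])
qed

section \<open>Absolutely continuous functions\<close>

lemma division_of_intervalE:
  fixes D :: "real set set"
  assumes "D division_of A" "K \<in> D"
  obtains u v where "u \<le> v" "K = {u..v}" "Inf K = u" "Sup K = v" "K \<subseteq> A"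
proof -
  from division_ofD(2-4)[OF assms] obtain u v where "K \<subseteq> A" "K \<noteq> {}" "K = cbox u v" by blast
  then show ?thesis using that[of u v] by (auto simp: cbox_interval)
qed

lemma abs_cont_onD:
  assumes "abs_cont_on S f" "\<epsilon> > 0"
  obtains \<delta> where "\<delta> > 0" "\<And>D A. D division_of A \<Longrightarrow> A \<subseteq> S \<Longrightarrow> (\<Sum>K\<in>D. Sup K - Inf K) < \<delta>
      \<Longrightarrow> (\<Sum>K\<in>D. norm (f (Sup K) - f (Inf K))) < \<epsilon>"
proof -
  from assms(1)[unfolded abs_cont_on_def, rule_format, OF assms(2)]
  obtain \<delta> where "\<delta> > 0" and d: "\<forall>D A. D division_of A \<and> A \<subseteq> S \<and> (\<Sum>K\<in>D. Sup K - Inf K) < \<delta>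
        \<longrightarrow> (\<Sum>K\<in>D. norm (f (Sup K) - f (Inf K))) < \<epsilon>" by (elim exE conjE)
  from this(1) show ?thesis by (rule that) (rule d[rule_format], intro conjI)
qed

lemma sum_interval_lengths_less:
  fixes D :: "real set set"
  assumes "D division_of A" "A \<subseteq> T" "T \<in> lmeasurable"
  shows "(\<Sum>K\<in>D. Sup K - Inf K) \<le> measure lebesgue T"
proof (rule has_integral_subset_le[OF assms(2)])
  show "((\<lambda>x. 1::real) has_integral (\<Sum>K\<in>D. Sup K - Inf K)) A"
  proof (rule has_integral_combine_division[OF assms(1)])
    fix K assume "K \<in> D"
    then obtain u v where uv: "u \<le> v" "K = {u..v}" "Inf K = u" "Sup K = v" by (rule division_of_intervalE[OF assms(1)])
    show "((\<lambda>x. 1::real) has_integral Sup K - Inf K) K"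
      using has_integral_const_real[of "1::real" u v] uv by simp
  qed
  show "((\<lambda>x. 1::real) has_integral measure lebesgue T) T"
    unfolding lmeasure_integral[OF assms(3)]
    using assms(3) by (simp only: lmeasurable_iff_integrable_on has_integral_integral[symmetric])
qed auto

text \<open>
  Choose a gauge that is adapted to the derivative at tags outside the null set \<open>N\<close> and that stays
  inside an open set of small measure around \<open>N\<close> at tags in \<open>N\<close>. In a fine division the intervals of
  the first kind contribute at most \<open>e (b - a)\<close> by the vanishing derivative, and those of the second
  kind at most \<open>e\<close> by absolute continuity, because their total length is small.
\<close>

lemma abs_cont_on_derivative_zero_ae:
  fixes f :: "real \<Rightarrow> 'a::real_normed_vector"
  assumes ac: "abs_cont_on {a..b} f" and ab: "a \<le> b" and N: "negligible N"
    and d0: "\<And>x. x \<in> {a..b} - N \<Longrightarrow> (f has_vector_derivative 0) (at x)"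
  shows "f b = f a"
proof -
  have bound: "norm (f b - f a) \<le> e * (b - a + 1)" if e: "e > 0" for e
  proof -
    obtain \<delta> where \<delta>: "\<delta> > 0" "\<And>D A. D division_of A \<Longrightarrow> A \<subseteq> {a..b} \<Longrightarrow> (\<Sum>K\<in>D. Sup K - Inf K) < \<delta>
      \<Longrightarrow> (\<Sum>K\<in>D. norm (f (Sup K) - f (Inf K))) < e"
      by (rule abs_cont_onD[OF ac e]) blast
    have "N \<in> sets lebesgue" using N by (rule negligible_imp_sets)
    then obtain T where T: "open T" "N \<subseteq> T" "T - N \<in> lmeasurable" "emeasure lebesgue (T - N) < ennreal \<delta>"
      by (rule sets_lebesgue_outer_open[OF _ \<delta>(1)])
    have TN: "T = (T - N) \<union> N" using T(2) by blast
    have N': "N \<in> lmeasurable" "measure lebesgue N = 0"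
      using N by (auto intro: negligible_imp_measurable negligible_imp_measure0)
    have Tm: "T \<in> lmeasurable" using T(3) N'(1) TN by (metis fmeasurable.Un)
    have "measure lebesgue T \<le> measure lebesgue (T - N) + measure lebesgue N"
      using TN T(3) N'(1) by (metis measure_Un_le fmeasurableD)
    moreover have "measure lebesgue (T - N) < \<delta>"
      using T(4) emeasure_eq_measure2[OF T(3)] \<delta>(1) by (simp add: ennreal_less_iff)
    ultimately have T\<delta>: "measure lebesgue T < \<delta>" using N' by simp
    have *: "\<exists>r>0. \<forall>y. \<bar>y - x\<bar> < r \<longrightarrow> norm (f y - f x) \<le> e * \<bar>y - x\<bar>" if x: "x \<in> {a..b} - N" for x
    proof -
      have "(f has_derivative (\<lambda>h. h *\<^sub>R 0)) (at x)"
        using d0[OF x] by (simp only: has_vector_derivative_def)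
      then have "\<exists>d>0. \<forall>y. norm (y - x) < d \<longrightarrow> norm (f y - f x - (y - x) *\<^sub>R 0) \<le> e * norm (y - x)"
        using e unfolding has_derivative_at_alt by blast
      then show ?thesis by simp
    qed
    obtain r where r: "\<And>x. x \<in> {a..b} - N \<Longrightarrow> r x > 0"
      "\<And>x y. x \<in> {a..b} - N \<Longrightarrow> \<bar>y - x\<bar> < r x \<Longrightarrow> norm (f y - f x) \<le> e * \<bar>y - x\<bar>"
    proof -
      have "\<forall>x\<in>{a..b} - N. \<exists>r. r > 0 \<and> (\<forall>y. \<bar>y - x\<bar> < r \<longrightarrow> norm (f y - f x) \<le> e * \<bar>y - x\<bar>)"
        using * by simp
      from bchoice[OF this] show ?thesis using that by blast
    qed
    define \<gamma> where "\<gamma> = (\<lambda>x. if x \<in> N then T else ball x (if x \<in> {a..b} then r x else 1))"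
    have "gauge \<gamma>"
      using T r(1) by (auto simp: gauge_def \<gamma>_def)
    then obtain p where p: "p tagged_division_of {a..b}" "\<gamma> fine p"
      using fine_division_exists_real by blast
    have fin: "finite p" using p(1) by blast
    \<comment> \<open>an empty interval may occur in the division lemma below and must not contribute\<close>
    define g where "g = (\<lambda>K. if K = {} then 0 else norm (f (Sup K) - f (Inf K)))"
    define p1 where "p1 = {xK\<in>p. fst xK \<in> N}"
    define p2 where "p2 = {xK\<in>p. fst xK \<notin> N}"
    have pp: "p = p1 \<union> p2" "p1 \<inter> p2 = {}" "p1 \<subseteq> p" "p2 \<subseteq> p" by (auto simp: p1_def p2_def)
    have "norm (f b - f a) = norm (\<Sum>(x,K)\<in>p. f (Sup K) - f (Inf K))"
      using additive_tagged_division_1[OF ab p(1), of f] by simp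
    also have "\<dots> \<le> (\<Sum>xK\<in>p. g (snd xK))"
      by (rule sum_norm_le) (use tagged_division_ofD(2)[OF p(1)] in \<open>fastforce simp: g_def\<close>)
    also have "\<dots> = (\<Sum>xK\<in>p1. g (snd xK)) + (\<Sum>xK\<in>p2. g (snd xK))"
      using pp fin by (metis finite_Un sum.union_disjoint)
    also have "(\<Sum>xK\<in>p1. g (snd xK)) \<le> e"
    proof -
      have p1: "p1 tagged_division_of (\<Union>(snd ` p1))"
        by (rule tagged_partial_division_of_Union_self, rule tagged_partial_division_subset[OF _ pp(3)])
           (use p(1) in \<open>auto simp: tagged_division_of_def\<close>)
      have "(\<Sum>(x,K)\<in>p1. g K) = (\<Sum>K\<in>snd ` p1. g K)"
        by (rule sum.over_tagged_division_lemma[OF p1]) (auto simp: g_def cbox_interval)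
      moreover have "(\<Sum>K\<in>snd ` p1. g K) \<le> (\<Sum>K\<in>snd ` p1. norm (f (Sup K) - f (Inf K)))"
        by (rule sum_mono) (auto simp: g_def)
      moreover have "(\<Sum>K\<in>snd ` p1. norm (f (Sup K) - f (Inf K))) < e"
      proof (rule \<delta>(2)[OF division_of_tagged_division[OF p1]])
        have "K \<subseteq> {a..b}" if "(x, K) \<in> p1" for x K
          by (rule tagged_division_ofD(3)[OF p(1)]) (use that pp(3) in blast)
        then show "\<Union>(snd ` p1) \<subseteq> {a..b}" by fastforce
        have "snd xK \<subseteq> T" if "xK \<in> p1" for xK
        proof -
          have "snd xK \<subseteq> \<gamma> (fst xK)" using p(2) pp(3) that unfolding fine_def by (cases xK) auto
          then show ?thesis using that by (simp add: \<gamma>_def p1_def)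
        qed
        then have "\<Union>(snd ` p1) \<subseteq> T" by blast
        from sum_interval_lengths_less[OF division_of_tagged_division[OF p1] this Tm] T\<delta>
        show "(\<Sum>K\<in>snd ` p1. Sup K - Inf K) < \<delta>" by simp
      qed
      ultimately show ?thesis by (simp add: split_def)
    qed
    also have "(\<Sum>xK\<in>p2. g (snd xK)) \<le> (\<Sum>xK\<in>p2. e * measure lborel (snd xK))"
    proof (rule sum_mono)
      fix xK assume "xK \<in> p2"
      then obtain x K where xK: "xK = (x, K)" "(x, K) \<in> p" "x \<notin> N" by (cases xK) (auto simp: p2_def)
      from tagged_division_ofD(2-4)[OF p(1) xK(2)] obtain u v
        where uv: "x \<in> K" "K \<subseteq> {a..b}" "K = {u..v}" by (auto simp: cbox_interval)
      have x: "x \<in> {a..b} - N" using uv xK by auto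
      have "K \<subseteq> \<gamma> x" using p(2) xK(2) unfolding fine_def by blast
      then have "K \<subseteq> ball x (r x)" using x by (simp add: \<gamma>_def)
      moreover have "u \<in> K" "v \<in> K" using uv by auto
      ultimately have "\<bar>u - x\<bar> < r x" "\<bar>v - x\<bar> < r x" by (auto simp: dist_real_def subset_iff)
      then have "norm (f u - f x) \<le> e * \<bar>u - x\<bar>" "norm (f v - f x) \<le> e * \<bar>v - x\<bar>"
        using r(2)[OF x] by auto
      moreover have "norm (f v - f u) \<le> norm (f v - f x) + norm (f u - f x)"
        using norm_triangle_ineq4[of "f v - f x" "f u - f x"] by simp
      moreover have "e * \<bar>u - x\<bar> + e * \<bar>v - x\<bar> = e * (v - u)"
        using uv by (simp add: algebra_simps)
      ultimately show "g (snd xK) \<le> e * measure lborel (snd xK)"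
        using uv xK by (auto simp: g_def)
    qed
    also have "\<dots> \<le> (\<Sum>xK\<in>p. e * measure lborel (snd xK))"
      by (rule sum_mono2[OF fin pp(4)]) (use e in auto)
    also have "\<dots> = e * (b - a)"
      using additive_content_tagged_division[of p a b] p(1) ab
      by (simp add: sum_distrib_left[symmetric] split_def cbox_interval)
    finally show ?thesis by (simp add: algebra_simps)
  qed
  have "norm (f b - f a) \<le> 0"
  proof (rule field_le_epsilon)
    fix e :: real assume "e > 0"
    then show "norm (f b - f a) \<le> 0 + e"
      using bound[of "e / (b - a + 1)"] ab by simp
  qed
  then show ?thesis by simp
qed

lemma abs_cont_on_lipschitz:
  fixes f :: "real \<Rightarrow> 'a::real_normed_vector"
  assumes "\<And>x y. x \<in> S \<Longrightarrow> y \<in> S \<Longrightarrow> norm (f x - f y) \<le> L * \<bar>x - y\<bar>"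
  shows "abs_cont_on S f"
  unfolding abs_cont_on_def
proof (intro allI impI)
  fix \<epsilon> :: real assume \<epsilon>: "\<epsilon> > 0"
  define B where "B = \<bar>L\<bar> + 1"
  have B: "B > 0" "L \<le> B" by (auto simp: B_def)
  show "\<exists>\<delta>>0. \<forall>D A. D division_of A \<and> A \<subseteq> S \<and> (\<Sum>K\<in>D. Sup K - Inf K) < \<delta>
        \<longrightarrow> (\<Sum>K\<in>D. norm (f (Sup K) - f (Inf K))) < \<epsilon>"
  proof (intro exI[of _ "\<epsilon> / B"] conjI allI impI; (elim conjE)?)
    fix D A assume D: "D division_of A" and A: "A \<subseteq> S" and s: "(\<Sum>K\<in>D. Sup K - Inf K) < \<epsilon> / B"
    have "(\<Sum>K\<in>D. norm (f (Sup K) - f (Inf K))) \<le> (\<Sum>K\<in>D. B * (Sup K - Inf K))"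
    proof (rule sum_mono)
      fix K assume "K \<in> D"
      then obtain u v where uv: "u \<le> v" "K = {u..v}" "Inf K = u" "Sup K = v" "K \<subseteq> A" by (rule division_of_intervalE[OF D])
      then have "norm (f v - f u) \<le> L * \<bar>v - u\<bar>" using A by (intro assms) auto
      also have "\<dots> \<le> B * \<bar>v - u\<bar>" by (intro mult_right_mono B) auto
      finally show "norm (f (Sup K) - f (Inf K)) \<le> B * (Sup K - Inf K)" using uv by simp
    qed
    also have "\<dots> = B * (\<Sum>K\<in>D. Sup K - Inf K)" by (simp add: sum_distrib_left)
    also have "\<dots> < B * (\<epsilon> / B)" using s B by (intro mult_strict_left_mono)
    finally show "(\<Sum>K\<in>D. norm (f (Sup K) - f (Inf K))) < \<epsilon>" using B by simp
  qed (use \<epsilon> B in auto)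
qed

lemma abs_cont_on_bounded:
  fixes f :: "real \<Rightarrow> 'a::real_normed_vector"
  assumes "abs_cont_on {a..b} f"
  obtains M where "\<And>x. x \<in> {a..b} \<Longrightarrow> norm (f x) \<le> M"
proof -
  have "continuous_on {a..b} f"
    unfolding continuous_on_iff
  proof (intro ballI allI impI)
    fix x and e :: real assume x: "x \<in> {a..b}" and e: "e > 0"
    obtain \<delta> where \<delta>: "\<delta> > 0" "\<And>D A. D division_of A \<Longrightarrow> A \<subseteq> {a..b} \<Longrightarrow> (\<Sum>K\<in>D. Sup K - Inf K) < \<delta>
      \<Longrightarrow> (\<Sum>K\<in>D. norm (f (Sup K) - f (Inf K))) < e"
      by (rule abs_cont_onD[OF assms e]) blast
    have "dist (f y) (f x) < e" if y: "y \<in> {a..b}" "dist y x < \<delta>" for y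
    proof -
      have "{{min x y..max x y}} division_of {min x y..max x y}"
        using division_of_self[of "min x y" "max x y"] by (simp add: cbox_interval)
      from \<delta>(2)[OF this] show ?thesis using x y
        by (cases "x \<le> y") (auto simp: dist_real_def dist_norm min_def max_def norm_minus_commute)
    qed
    then show "\<exists>d>0. \<forall>x'\<in>{a..b}. dist x' x < d \<longrightarrow> dist (f x') (f x) < e" using \<delta>(1) by blast
  qed
  then have "bounded (f ` {a..b})" by (intro compact_imp_bounded compact_continuous_image compact_Icc)
  then obtain M where "\<forall>v\<in>f ` {a..b}. norm v \<le> M" unfolding bounded_iff by blast
  then show ?thesis by (intro that[of M]) simp
qed

text \<open>
  The common reason why differences and products inherit absolute continuity.
\<close>

lemma abs_cont_on_add_bound:
  fixes f g h :: "real \<Rightarrow> 'a::real_normed_vector"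
  assumes f: "abs_cont_on S f" and g: "abs_cont_on S g" and M: "M \<ge> 0"
    and b: "\<And>x y. x \<in> S \<Longrightarrow> y \<in> S \<Longrightarrow> norm (h x - h y) \<le> M * norm (f x - f y) + M * norm (g x - g y)"
  shows "abs_cont_on S h"
  unfolding abs_cont_on_def
proof (intro allI impI)
  fix \<epsilon> :: real assume \<epsilon>: "\<epsilon> > 0"
  define e where "e = \<epsilon> / (2 * (M + 1))"
  have e: "e > 0" using \<epsilon> M by (simp add: e_def)
  obtain \<delta>1 where \<delta>1: "\<delta>1 > 0" "\<And>D A. D division_of A \<Longrightarrow> A \<subseteq> S \<Longrightarrow> (\<Sum>K\<in>D. Sup K - Inf K) < \<delta>1
      \<Longrightarrow> (\<Sum>K\<in>D. norm (f (Sup K) - f (Inf K))) < e"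
    by (rule abs_cont_onD[OF f e]) blast
  obtain \<delta>2 where \<delta>2: "\<delta>2 > 0" "\<And>D A. D division_of A \<Longrightarrow> A \<subseteq> S \<Longrightarrow> (\<Sum>K\<in>D. Sup K - Inf K) < \<delta>2
      \<Longrightarrow> (\<Sum>K\<in>D. norm (g (Sup K) - g (Inf K))) < e"
    by (rule abs_cont_onD[OF g e]) blast
  show "\<exists>\<delta>>0. \<forall>D A. D division_of A \<and> A \<subseteq> S \<and> (\<Sum>K\<in>D. Sup K - Inf K) < \<delta>
        \<longrightarrow> (\<Sum>K\<in>D. norm (h (Sup K) - h (Inf K))) < \<epsilon>"
  proof (intro exI[of _ "min \<delta>1 \<delta>2"] conjI allI impI; (elim conjE)?)
    fix D A assume D: "D division_of A" and A: "A \<subseteq> S" and s: "(\<Sum>K\<in>D. Sup K - Inf K) < min \<delta>1 \<delta>2"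
    have "(\<Sum>K\<in>D. norm (h (Sup K) - h (Inf K)))
       \<le> (\<Sum>K\<in>D. M * norm (f (Sup K) - f (Inf K)) + M * norm (g (Sup K) - g (Inf K)))"
    proof (rule sum_mono)
      fix K assume "K \<in> D"
      then obtain u v where uv: "u \<le> v" "K = {u..v}" "Inf K = u" "Sup K = v" "K \<subseteq> A" by (rule division_of_intervalE[OF D])
      then show "norm (h (Sup K) - h (Inf K)) \<le> M * norm (f (Sup K) - f (Inf K)) + M * norm (g (Sup K) - g (Inf K))"
        using A by (intro b) auto
    qed
    also have "\<dots> = M * (\<Sum>K\<in>D. norm (f (Sup K) - f (Inf K))) + M * (\<Sum>K\<in>D. norm (g (Sup K) - g (Inf K)))"
      by (simp add: sum_distrib_left sum.distrib)
    also have "\<dots> \<le> M * e + M * e"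
      using \<delta>1(2)[OF D A] \<delta>2(2)[OF D A] s M by (intro add_mono mult_left_mono) auto
    also have "\<dots> = (2 * M) * e" by simp
    also have "\<dots> < (2 * (M + 1)) * e" using e by (intro mult_strict_right_mono) auto
    also have "\<dots> = \<epsilon>" using M by (simp add: e_def)
    finally show "(\<Sum>K\<in>D. norm (h (Sup K) - h (Inf K))) < \<epsilon>" .
  qed (use \<delta>1 \<delta>2 in auto)
qed

lemma abs_cont_on_diff:
  fixes f g :: "real \<Rightarrow> 'a::real_normed_vector"
  assumes "abs_cont_on S f" "abs_cont_on S g"
  shows "abs_cont_on S (\<lambda>x. f x - g x)"
proof (rule abs_cont_on_add_bound[OF assms, of 1])
  fix x y
  have "norm ((f x - f y) - (g x - g y)) \<le> norm (f x - f y) + norm (g x - g y)" by (rule norm_triangle_ineq4)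
  then show "norm (f x - g x - (f y - g y)) \<le> 1 * norm (f x - f y) + 1 * norm (g x - g y)"
    by (simp add: algebra_simps)
qed auto

lemma abs_cont_on_mult:
  fixes f g :: "real \<Rightarrow> 'a::real_normed_algebra"
  assumes "abs_cont_on {a..b} f" "abs_cont_on {a..b} g"
  shows "abs_cont_on {a..b} (\<lambda>x. f x * g x)"
proof -
  obtain M1 where M1: "\<And>x. x \<in> {a..b} \<Longrightarrow> norm (f x) \<le> M1" using abs_cont_on_bounded[OF assms(1)] by blast
  obtain M2 where M2: "\<And>x. x \<in> {a..b} \<Longrightarrow> norm (g x) \<le> M2" using abs_cont_on_bounded[OF assms(2)] by blast
  define M where "M = max 0 (max M1 M2)"
  show ?thesis
  proof (rule abs_cont_on_add_bound[OF assms, of M])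
    fix x y assume x: "x \<in> {a..b}" and y: "y \<in> {a..b}"
    have "f x * g x - f y * g y = (f x - f y) * g x + f y * (g x - g y)" by (simp add: algebra_simps)
    then have "norm (f x * g x - f y * g y) \<le> norm (f x - f y) * norm (g x) + norm (f y) * norm (g x - g y)"
      by (metis norm_triangle_le norm_mult_ineq add_mono)
    also have "\<dots> \<le> norm (f x - f y) * M + M * norm (g x - g y)"
      using M1[OF y] M2[OF x] by (intro add_mono mult_left_mono mult_right_mono) (auto simp: M_def)
    finally show "norm (f x * g x - f y * g y) \<le> M * norm (f x - f y) + M * norm (g x - g y)"
      by (simp add: mult.commute)
  qed (simp add: M_def)
qed

lemma abs_cont_on_nth:
  fixes y :: "real \<Rightarrow> complex^'n"
  assumes "abs_cont_on S y"
  shows "abs_cont_on S (\<lambda>z. y z $ i)"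
  unfolding abs_cont_on_def
proof (intro allI impI)
  fix \<epsilon> :: real assume \<epsilon>: "\<epsilon> > 0"
  obtain \<delta> where \<delta>: "\<delta> > 0" "\<And>D A. D division_of A \<Longrightarrow> A \<subseteq> S \<Longrightarrow> (\<Sum>K\<in>D. Sup K - Inf K) < \<delta>
      \<Longrightarrow> (\<Sum>K\<in>D. norm (y (Sup K) - y (Inf K))) < \<epsilon>"
    by (rule abs_cont_onD[OF assms \<epsilon>]) blast
  have "(\<Sum>K\<in>D. norm (y (Sup K) $ i - y (Inf K) $ i)) \<le> (\<Sum>K\<in>D. norm (y (Sup K) - y (Inf K)))" for D
    by (intro sum_mono) (metis vector_minus_component component_le_norm_cart Finite_Cartesian_Product.norm_nth_le)
  then show "\<exists>\<delta>>0. \<forall>D A. D division_of A \<and> A \<subseteq> S \<and> (\<Sum>K\<in>D. Sup K - Inf K) < \<delta>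
        \<longrightarrow> (\<Sum>K\<in>D. norm (y (Sup K) $ i - y (Inf K) $ i)) < \<epsilon>"
    using \<delta> by (meson le_less_trans)
qed

lemma abs_cont_on_C1:
  fixes f :: "real \<Rightarrow> 'a::real_normed_vector"
  assumes "\<And>x. x \<in> {a..b} \<Longrightarrow> (f has_vector_derivative f' x) (at x)" "continuous_on {a..b} f'"
  shows "abs_cont_on {a..b} f"
proof -
  have "bounded (f' ` {a..b})" using assms(2) by (intro compact_imp_bounded compact_continuous_image compact_Icc)
  then obtain L where "\<forall>v\<in>f' ` {a..b}. norm v \<le> L" unfolding bounded_iff by blast
  then have L: "\<And>x. x \<in> {a..b} \<Longrightarrow> norm (f' x) \<le> L" by simp
  show ?thesis
  proof (rule abs_cont_on_lipschitz)
    fix x y assume "x \<in> {a..b}" "y \<in> {a..b}"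
    then show "norm (f x - f y) \<le> L * \<bar>x - y\<bar>"
      unfolding real_norm_def[symmetric]
    proof (rule differentiable_bound[rotated -2, where f' = "\<lambda>x h. h *\<^sub>R f' x"])
      fix x assume x: "x \<in> {a..b}"
      show "(f has_derivative (\<lambda>h. h *\<^sub>R f' x)) (at x within {a..b})"
        using assms(1)[OF x] has_derivative_at_withinI unfolding has_vector_derivative_def by blast
      show "onorm (\<lambda>h. h *\<^sub>R f' x) \<le> L"
        using L[OF x] by (intro onorm_le) (simp add: mult.commute[of L] mult_left_mono)
    qed auto
  qed
qed

section \<open>The differential expression and the Hilbert space in components\<close>

lemma of_real_one_minus_neq_0: "x < 1 \<Longrightarrow> 1 - complex_of_real x \<noteq> 0"
  by (metis less_irrefl of_real_1 of_real_diff of_real_eq_0_iff right_minus_eq)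

lemma W_mat_inv:
  assumes "0 < z" "z < 1"
  shows "matrix_inv (W_mat z) = vector [vector [of_real (1 - z), 0], vector [0, of_real z]]" (is "_ = ?V")
proof -
  have n: "(1::complex) \<noteq> of_real z" "complex_of_real z \<noteq> 0" using assms by (metis of_real_1 of_real_eq_iff less_irrefl) (use assms in simp)
  have V: "W_mat z ** ?V = mat 1" "?V ** W_mat z = mat 1"
    using n unfolding W_mat_def
    by (simp_all add: vec_eq_iff forall_2 matrix_matrix_mult_def sum_2 mat_def)
  then have "W_mat z ** matrix_inv (W_mat z) = mat 1 \<and> matrix_inv (W_mat z) ** W_mat z = mat 1"
    unfolding matrix_inv_def by (intro someI[of "\<lambda>A'. W_mat z ** A' = mat 1 \<and> A' ** W_mat z = mat 1" ?V]) simp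
  then have "matrix_inv (W_mat z) = (?V ** W_mat z) ** matrix_inv (W_mat z)" "W_mat z ** matrix_inv (W_mat z) = mat 1"
    using V by (simp_all add: matrix_mul_lid)
  then show ?thesis by (simp add: matrix_mul_assoc[symmetric] matrix_mul_rid)
qed

text \<open>
  Multiplication by the weight turns the eigenvalue equation into a system solved for the derivative.
\<close>

lemma tau_components:
  fixes \<mu> z :: real and u :: "real^3" and v v' :: "complex^2" and l :: complex
  assumes "0 < z" "z < 1"
  defines "h \<equiv> - ((\<mu> + 1) / 2) / z + (\<mu> + 1) / 2 / (1 - z) + 2 * u $ 2"
  shows "(l *s v = tau \<mu> u z v v') \<longleftrightarrow>
    v' $ 1 = of_real h * v $ 1 + ((of_real (u $ 3) + l) / of_real z + of_real (2 * (u $ 1 + (u $ 2)\<^sup>2))) * v $ 2 \<and>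
    v' $ 2 = - (2 + l / of_real (1 - z)) * v $ 1 - of_real h * v $ 2"
proof -
  have n: "1 - complex_of_real z \<noteq> 0" "complex_of_real z \<noteq> 0"
    using assms by (metis of_real_1 of_real_eq_iff less_irrefl right_minus_eq) (use assms in simp)
  have "tau \<mu> u z v v' $ 1 = of_real (1 - z) * (- v' $ 2 - 2 * v $ 1 - of_real h * v $ 2)"
   and "tau \<mu> u z v v' $ 2 = of_real z * (v' $ 1 - of_real h * v $ 1 - of_real (u $ 3 / z + 2 * (u $ 1 + (u $ 2)\<^sup>2)) * v $ 2)"
    unfolding tau_def W_mat_inv[OF assms(1,2)] h_def
    by (simp_all add: matrix_vector_mult_def sum_2 J_mat_def H_mat_def Let_def algebra_simps)
  then have "(l *s v = tau \<mu> u z v v') \<longleftrightarrow>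
     l * v $ 1 = of_real (1 - z) * (- v' $ 2 - 2 * v $ 1 - of_real h * v $ 2) \<and>
     l * v $ 2 = of_real z * (v' $ 1 - of_real h * v $ 1 - of_real (u $ 3 / z + 2 * (u $ 1 + (u $ 2)\<^sup>2)) * v $ 2)"
    by (auto simp: vec_eq_iff forall_2)
  also have "(l * v $ 1 = of_real (1 - z) * (- v' $ 2 - 2 * v $ 1 - of_real h * v $ 2)) \<longleftrightarrow>
      v' $ 2 = - (2 + l / of_real (1 - z)) * v $ 1 - of_real h * v $ 2"
    using n by (auto simp: field_simps)
  also have "(l * v $ 2 = of_real z * (v' $ 1 - of_real h * v $ 1 - of_real (u $ 3 / z + 2 * (u $ 1 + (u $ 2)\<^sup>2)) * v $ 2)) \<longleftrightarrow>
      (l * v $ 2 / of_real z = v' $ 1 - of_real h * v $ 1 - of_real (u $ 3 / z + 2 * (u $ 1 + (u $ 2)\<^sup>2)) * v $ 2)"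
    using n(2) by (simp add: divide_eq_eq mult.commute)
  also have "\<dots> \<longleftrightarrow>
      v' $ 1 = of_real h * v $ 1 + ((of_real (u $ 3) + l) / of_real z + of_real (2 * (u $ 1 + (u $ 2)\<^sup>2))) * v $ 2"
    by (auto simp: algebra_simps add_divide_distrib)
  finally show ?thesis by blast
qed

lemma W_form_diag:
  "W_form z v v = of_real ((norm (v $ 1))\<^sup>2 / (1 - z) + (norm (v $ 2))\<^sup>2 / z)"
proof -
  have "W_form z v v = (cnj (v $ 1) * v $ 1) / of_real (1 - z) + (cnj (v $ 2) * v $ 2) / of_real z"
    by (simp add: W_form_def sum_2 W_mat_def matrix_vector_mult_def)
  then show ?thesis
    by (simp only: of_real_add of_real_divide complex_norm_square mult.commute[of "cnj _"])
qed

lemma L2W_iff: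
  "y \<in> L2W \<longleftrightarrow> y \<in> borel_measurable (lebesgue_on {0<..<1}) \<and>
     integrable (lebesgue_on {0<..<1}) (\<lambda>z. (norm (y z $ 1))\<^sup>2 / (1 - z) + (norm (y z $ 2))\<^sup>2 / z)"
  unfolding L2W_def mem_Collect_eq W_form_diag by (simp only: complex_of_real_integrable_eq)

section \<open>Solutions that are recessive at one endpoint\<close>

text \<open>
  The parameters \<open>a, b, c\<close> stand for \<open>u\<^sub>1, u\<^sub>2, u\<^sub>3\<close>. They are complex here because the analytic
  dependence of eigenvalues is obtained from holomorphic functions of them.
\<close>

definition diag_coeff :: "real \<Rightarrow> complex \<Rightarrow> real \<Rightarrow> complex" where
  "diag_coeff \<alpha> b z = of_real (- \<alpha> / z + \<alpha> / (1 - z)) + 2 * b"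

definition dirac_solution :: "real \<Rightarrow> complex \<Rightarrow> complex \<Rightarrow> complex \<Rightarrow> complex \<Rightarrow>
    (real \<Rightarrow> complex) \<Rightarrow> (real \<Rightarrow> complex) \<Rightarrow> bool" where
  "dirac_solution \<alpha> a b c l y1 y2 \<longleftrightarrow> (\<forall>z\<in>{0<..<1}.
     (y1 has_vector_derivative diag_coeff \<alpha> b z * y1 z + ((c + l) / of_real z + 2 * (a + b\<^sup>2)) * y2 z) (at z) \<and>
     (y2 has_vector_derivative - (2 + l / of_real (1 - z)) * y1 z - diag_coeff \<alpha> b z * y2 z) (at z))"

text \<open>
  Near \<open>0\<close> the system has the form treated above with \<open>b0 = c + l\<close> and \<open>c0 = 0\<close>. Near \<open>1\<close>, in the
  variable \<open>1 - z\<close>, it has that form with \<open>b0 = 0\<close> and \<open>c0 = l\<close>.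
\<close>

definition left1 where "left1 \<alpha> a b c l z =
  of_real (z powr \<alpha>) * serP \<alpha> (c + l) 0 0 (- l) (2 * b) (2 * (a + b\<^sup>2)) (- 2) (of_real z)"

definition left2 where "left2 \<alpha> a b c l z =
  of_real (z powr \<alpha>) * serQ \<alpha> (c + l) 0 0 (- l) (2 * b) (2 * (a + b\<^sup>2)) (- 2) (of_real z)"

definition right1 where "right1 \<alpha> a b c l z =
  of_real ((1 - z) powr \<alpha>) * serP \<alpha> 0 l (- (c + l)) 0 (- (2 * b)) (- (2 * (a + b\<^sup>2))) 2 (of_real (1 - z))"

definition right2 where "right2 \<alpha> a b c l z =
  of_real ((1 - z) powr \<alpha>) * serQ \<alpha> 0 l (- (c + l)) 0 (- (2 * b)) (- (2 * (a + b\<^sup>2))) 2 (of_real (1 - z))"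

lemma left_solution:
  assumes "\<alpha> \<ge> 1 / 2"
  shows "dirac_solution \<alpha> a b c l (left1 \<alpha> a b c l) (left2 \<alpha> a b c l)"
  unfolding dirac_solution_def
proof (intro ballI conjI)
  fix z :: real assume "z \<in> {0<..<1}"
  then have z: "0 < z" "z < 1" by auto
  have bc: "(c + l) * 0 = 0" by simp
  note S = frob_system_solution[OF assms bc z, of 0 "- l" "2 * b" "2 * (a + b\<^sup>2)" "- 2"]
  show "(left1 \<alpha> a b c l has_vector_derivative diag_coeff \<alpha> b z * left1 \<alpha> a b c l z
      + ((c + l) / of_real z + 2 * (a + b\<^sup>2)) * left2 \<alpha> a b c l z) (at z)"
    unfolding left1_def left2_def diag_coeff_def by (rule has_vector_derivative_eq_rhs[OF S(1)]) simp
  show "(left2 \<alpha> a b c l has_vector_derivative - (2 + l / of_real (1 - z)) * left1 \<alpha> a b c l z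
      - diag_coeff \<alpha> b z * left2 \<alpha> a b c l z) (at z)"
    unfolding left1_def left2_def diag_coeff_def by (rule has_vector_derivative_eq_rhs[OF S(2)]) simp
qed

lemma right_solution:
  assumes "\<alpha> \<ge> 1 / 2"
  shows "dirac_solution \<alpha> a b c l (right1 \<alpha> a b c l) (right2 \<alpha> a b c l)"
  unfolding dirac_solution_def
proof (intro ballI conjI)
  fix z :: real assume "z \<in> {0<..<1}"
  then have z: "0 < 1 - z" "1 - z < 1" by auto
  have bc: "0 * l = 0" by simp
  note S = frob_system_solution[OF assms bc z, of "- (c + l)" 0 "- (2 * b)" "- (2 * (a + b\<^sup>2))" 2]
  have d: "((\<lambda>x. 1 - x) has_vector_derivative - 1) (at z)"
    by (auto intro!: derivative_eq_intros)
  note S1 = vector_diff_chain_at[OF d S(1), unfolded o_def]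
  note S2 = vector_diff_chain_at[OF d S(2), unfolded o_def]
  show "(right1 \<alpha> a b c l has_vector_derivative diag_coeff \<alpha> b z * right1 \<alpha> a b c l z
      + ((c + l) / of_real z + 2 * (a + b\<^sup>2)) * right2 \<alpha> a b c l z) (at z)"
    unfolding right1_def right2_def diag_coeff_def
    by (rule has_vector_derivative_eq_rhs[OF S1]) (simp add: algebra_simps divide_inverse)
  show "(right2 \<alpha> a b c l has_vector_derivative - (2 + l / of_real (1 - z)) * right1 \<alpha> a b c l z
      - diag_coeff \<alpha> b z * right2 \<alpha> a b c l z) (at z)"
    unfolding right1_def right2_def diag_coeff_def
    by (rule has_vector_derivative_eq_rhs[OF S2]) (simp add: algebra_simps divide_inverse)
qed

text \<open>
  In the matrix notation \<open>J y' = (H + \<Lambda> W) y\<close> this is the Lagrange identity: since \<open>H\<close> and \<open>W\<close> are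
  symmetric, only the differences of the coefficients survive.
\<close>

lemma wronskian_derivative:
  assumes "dirac_solution \<alpha> a b c l y1 y2" "dirac_solution \<alpha> a' b' c' l' w1 w2" "z \<in> {0<..<1}"
  shows "((\<lambda>z. y1 z * w2 z - y2 z * w1 z) has_vector_derivative
     2 * (b - b') * (y1 z * w2 z + y2 z * w1 z)
     + ((c - c' + (l - l')) / of_real z + 2 * (a - a' + (b\<^sup>2 - b'\<^sup>2))) * (y2 z * w2 z)
     + (l - l') / of_real (1 - z) * (y1 z * w1 z)) (at z)"
proof -
  note Y = assms(1)[unfolded dirac_solution_def, rule_format, OF assms(3)]
  note W = assms(2)[unfolded dirac_solution_def, rule_format, OF assms(3)]
  show ?thesis
    by (rule has_vector_derivative_eq_rhs[OF has_vector_derivative_diff[OF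
      has_vector_derivative_mult[OF Y[THEN conjunct1] W[THEN conjunct2]]
      has_vector_derivative_mult[OF Y[THEN conjunct2] W[THEN conjunct1]]]])
      (simp add: diag_coeff_def algebra_simps divide_inverse)
qed

lemma wronskian_constant:
  assumes "dirac_solution \<alpha> a b c l y1 y2" "dirac_solution \<alpha> a b c l w1 w2" "z \<in> {0<..<1}" "x \<in> {0<..<1}"
  shows "y1 z * w2 z - y2 z * w1 z = y1 x * w2 x - y2 x * w1 x"
proof -
  have "((\<lambda>z. y1 z * w2 z - y2 z * w1 z) has_vector_derivative 0) (at t within {0<..<1})"
    if "t \<in> {0<..<1}" for t
    using wronskian_derivative[OF assms(1,2) that] by (simp add: has_vector_derivative_at_within)
  from has_vector_derivative_zero_constant[OF _ this] assms(3,4) show ?thesis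
    by (metis convex_real_interval(8))
qed

lemma dirac_solution_continuous:
  assumes "dirac_solution \<alpha> a b c l y1 y2"
  shows "continuous_on {0<..<1} y1" "continuous_on {0<..<1} y2"
proof -
  note D = assms[unfolded dirac_solution_def]
  show "continuous_on {0<..<1} y1" "continuous_on {0<..<1} y2"
    by (intro continuous_at_imp_continuous_on ballI; use D has_vector_derivative_continuous in blast)+
qed

lemma dirac_solution_lincomb:
  assumes "dirac_solution \<alpha> a b c l y1 y2" "dirac_solution \<alpha> a b c l w1 w2"
  shows "dirac_solution \<alpha> a b c l (\<lambda>z. y1 z - k * w1 z) (\<lambda>z. y2 z - k * w2 z)"
  unfolding dirac_solution_def
proof (intro ballI conjI)
  fix z :: real assume z: "z \<in> {0<..<1}"
  note Y = assms(1)[unfolded dirac_solution_def, rule_format, OF z]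
  note W = assms(2)[unfolded dirac_solution_def, rule_format, OF z]
  show "((\<lambda>z. y1 z - k * w1 z) has_vector_derivative diag_coeff \<alpha> b z * (y1 z - k * w1 z)
      + ((c + l) / of_real z + 2 * (a + b\<^sup>2)) * (y2 z - k * w2 z)) (at z)"
    by (rule has_vector_derivative_eq_rhs[OF has_vector_derivative_diff[OF Y[THEN conjunct1]
        has_vector_derivative_mult_right[OF W[THEN conjunct1]]]]) (simp add: algebra_simps)
  show "((\<lambda>z. y2 z - k * w2 z) has_vector_derivative - (2 + l / of_real (1 - z)) * (y1 z - k * w1 z)
      - diag_coeff \<alpha> b z * (y2 z - k * w2 z)) (at z)"
    by (rule has_vector_derivative_eq_rhs[OF has_vector_derivative_diff[OF Y[THEN conjunct2]
        has_vector_derivative_mult_right[OF W[THEN conjunct2]]]]) (simp add: algebra_simps)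
qed

text \<open>
  The argument is Gronwall's: \<open>q = |y\<^sub>1|\<^sup>2 + |y\<^sub>2|\<^sup>2\<close> satisfies \<open>|q'| \<le> 4 M q\<close>, so \<open>exp (4 M z) q\<close> increases
  and \<open>exp (-4 M z) q\<close> decreases. A zero of \<open>q\<close> at either end spreads to the other end.
\<close>

lemma linear_ode_zero:
  fixes y1 y2 A B C D :: "real \<Rightarrow> complex"
  assumes d: "\<And>z. z \<in> {s..t} \<Longrightarrow> (y1 has_vector_derivative A z * y1 z + B z * y2 z) (at z)"
    "\<And>z. z \<in> {s..t} \<Longrightarrow> (y2 has_vector_derivative C z * y1 z + D z * y2 z) (at z)"
    and M: "\<And>z. z \<in> {s..t} \<Longrightarrow> norm (A z) \<le> M \<and> norm (B z) \<le> M \<and> norm (C z) \<le> M \<and> norm (D z) \<le> M"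
    and st: "s \<le> t"
    and 0: "y1 s = 0 \<and> y2 s = 0 \<or> y1 t = 0 \<and> y2 t = 0"
  shows "y1 s = 0 \<and> y2 s = 0 \<and> y1 t = 0 \<and> y2 t = 0"
proof -
  define q where "q = (\<lambda>z. y1 z \<bullet> y1 z + y2 z \<bullet> y2 z)"
  define q' where "q' = (\<lambda>z. 2 * (y1 z \<bullet> (A z * y1 z + B z * y2 z)) + 2 * (y2 z \<bullet> (C z * y1 z + D z * y2 z)))"
  have q0: "q z \<ge> 0" for z by (simp add: q_def)
  have qd: "(q has_real_derivative q' z) (at z)" if z: "z \<in> {s..t}" for z
    unfolding q_def q'_def has_real_derivative_iff_has_vector_derivative
    by (rule has_vector_derivative_eq_rhs[OF has_vector_derivative_add[OF
       bounded_bilinear.has_vector_derivative[OF bounded_bilinear_inner d(1)[OF z] d(1)[OF z]]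
       bounded_bilinear.has_vector_derivative[OF bounded_bilinear_inner d(2)[OF z] d(2)[OF z]]]])
      (simp add: inner_commute)
  have q'b: "\<bar>q' z\<bar> \<le> 4 * M * q z" if z: "z \<in> {s..t}" for z
  proof -
    define p r where "p = norm (y1 z)" and "r = norm (y2 z)"
    have pr: "p \<ge> 0" "r \<ge> 0" by (auto simp: p_def r_def)
    have M0: "M \<ge> 0" using M[OF z] norm_ge_zero order_trans by blast
    have "norm (A z * y1 z + B z * y2 z) \<le> M * p + M * r" "norm (C z * y1 z + D z * y2 z) \<le> M * p + M * r"
      unfolding p_def r_def using M[OF z]
      by (intro norm_triangle_le add_mono; simp add: norm_mult mult_right_mono)+
    then have "\<bar>y1 z \<bullet> (A z * y1 z + B z * y2 z)\<bar> \<le> p * (M * p + M * r)"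
      "\<bar>y2 z \<bullet> (C z * y1 z + D z * y2 z)\<bar> \<le> r * (M * p + M * r)"
      unfolding p_def r_def by (meson Cauchy_Schwarz_ineq2 mult_left_mono norm_ge_zero order_trans)+
    then have "\<bar>q' z\<bar> \<le> 2 * (p * (M * p + M * r)) + 2 * (r * (M * p + M * r))"
      unfolding q'_def by linarith
    also have "\<dots> = M * (2 * (p + r)\<^sup>2)" by (simp add: power2_eq_square algebra_simps)
    also have "\<dots> \<le> M * (4 * (p\<^sup>2 + r\<^sup>2))"
    proof (intro mult_left_mono M0)
      have "0 \<le> (p - r)\<^sup>2" by simp
      then show "2 * (p + r)\<^sup>2 \<le> 4 * (p\<^sup>2 + r\<^sup>2)" by (simp add: power2_eq_square algebra_simps)
    qed
    also have "\<dots> = 4 * M * q z" by (simp add: q_def p_def r_def power2_norm_eq_inner)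
    finally show ?thesis .
  qed
  have ed: "((\<lambda>z. exp (k * z) * q z) has_real_derivative exp (k * z) * (k * q z + q' z)) (at z)"
    if "z \<in> {s..t}" for z k
    using qd[OF that] by (auto intro!: derivative_eq_intros simp: algebra_simps)
  have up: "exp (4 * M * s) * q s \<le> exp (4 * M * t) * q t"
  proof (rule DERIV_nonneg_imp_nondecreasing[OF st])
    fix x assume "s \<le> x" "x \<le> t"
    then have x: "x \<in> {s..t}" by simp
    have "0 \<le> 4 * M * q x + q' x" using q'b[OF x] by linarith
    then show "\<exists>y. ((\<lambda>z. exp (4 * M * z) * q z) has_real_derivative y) (at x) \<and> 0 \<le> y"
      using ed[OF x, of "4 * M"] by (meson mult_nonneg_nonneg exp_ge_zero)
  qed
  have down: "exp (- (4 * M) * t) * q t \<le> exp (- (4 * M) * s) * q s"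
  proof (rule DERIV_nonpos_imp_nonincreasing[OF st])
    fix x assume "s \<le> x" "x \<le> t"
    then have x: "x \<in> {s..t}" by simp
    have "- (4 * M) * q x + q' x \<le> 0" using q'b[OF x] by linarith
    then show "\<exists>y. ((\<lambda>z. exp (- (4 * M) * z) * q z) has_real_derivative y) (at x) \<and> y \<le> 0"
      using ed[OF x, of "- (4 * M)"] by (meson mult_nonneg_nonpos exp_ge_zero)
  qed
  have qz: "q z = 0 \<longleftrightarrow> y1 z = 0 \<and> y2 z = 0" for z
    unfolding q_def by (metis add_nonneg_eq_0_iff inner_eq_zero_iff inner_ge_zero)
  have "q s = 0 \<and> q t = 0"
  proof (cases "q s = 0")
    case True
    then have "exp (- (4 * M) * t) * q t \<le> 0" using down by simp
    then have "q t \<le> 0" by (simp add: mult_le_0_iff)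
    then show ?thesis using True q0[of t] by simp
  next
    case False
    then have "q t = 0" using 0 qz by blast
    then have "exp (4 * M * s) * q s \<le> 0" using up by simp
    then have "q s \<le> 0" by (simp add: mult_le_0_iff)
    then show ?thesis using False q0[of s] by simp
  qed
  then show ?thesis using qz by simp
qed

lemma dirac_solution_unique_zero:
  assumes "dirac_solution \<alpha> a b c l y1 y2" "z0 \<in> {0<..<1}" "y1 z0 = 0" "y2 z0 = 0" "z \<in> {0<..<1}"
  shows "y1 z = 0 \<and> y2 z = 0"
proof -
  define s t where "s = min z z0" and "t = max z z0"
  have st: "s \<le> t" "0 < s" "t < 1" using assms by (auto simp: s_def t_def)
  define A B C where "A = diag_coeff \<alpha> b" and "B = (\<lambda>z. (c + l) / of_real z + 2 * (a + b\<^sup>2))"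
    and "C = (\<lambda>z. - (2 + l / of_real (1 - z)))"
  note ne = of_real_one_minus_neq_0
  have co: "continuous_on {s..t} A" "continuous_on {s..t} B" "continuous_on {s..t} C"
    unfolding A_def B_def C_def diag_coeff_def
    by (intro continuous_intros; use st ne in force)+
  have bd: "\<exists>M. \<forall>x\<in>{s..t}. norm (f x) \<le> M" if "continuous_on {s..t} f" for f :: "real \<Rightarrow> complex"
    using compact_imp_bounded[OF compact_continuous_image[OF that compact_Icc]]
    unfolding bounded_iff by blast
  obtain M1 M2 M3 where M123: "\<forall>x\<in>{s..t}. norm (A x) \<le> M1" "\<forall>x\<in>{s..t}. norm (B x) \<le> M2" "\<forall>x\<in>{s..t}. norm (C x) \<le> M3"
    using bd[OF co(1)] bd[OF co(2)] bd[OF co(3)] by blast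
  define M where "M = max M1 (max M2 M3)"
  have MM: "norm (A x) \<le> M \<and> norm (B x) \<le> M \<and> norm (C x) \<le> M \<and> norm (- A x) \<le> M" if "x \<in> {s..t}" for x
    using M123 that by (auto simp: M_def le_max_iff_disj)
  have d: "(y1 has_vector_derivative A x * y1 x + B x * y2 x) (at x)"
    "(y2 has_vector_derivative C x * y1 x + - A x * y2 x) (at x)" if "x \<in> {s..t}" for x
  proof -
    have "x \<in> {0<..<1}" using that st by auto
    note D = assms(1)[unfolded dirac_solution_def, rule_format, OF this]
    show "(y1 has_vector_derivative A x * y1 x + B x * y2 x) (at x)"
      using D unfolding A_def B_def by blast
    show "(y2 has_vector_derivative C x * y1 x + - A x * y2 x) (at x)"
      using D unfolding A_def C_def by simp
  qed
  have 0: "y1 s = 0 \<and> y2 s = 0 \<or> y1 t = 0 \<and> y2 t = 0"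
    using assms by (auto simp: s_def t_def min_def max_def)
  have "y1 s = 0 \<and> y2 s = 0 \<and> y1 t = 0 \<and> y2 t = 0"
    by (rule linear_ode_zero[OF d MM st(1) 0])
  then show ?thesis by (auto simp: s_def t_def min_def max_def split: if_splits)
qed

lemma serQ_nonzero_near_0:
  assumes "\<alpha> \<ge> 1 / 2" "b0 * c0 = 0"
  obtains x :: real where "0 < x" "x < 1" "serQ \<alpha> b0 c0 b1 c1 \<beta> \<kappa> \<gamma> (of_real x) \<noteq> 0"
proof -
  have "norm (0::complex) < 1" by simp
  from ser_ode[OF assms this] have "isCont (serQ \<alpha> b0 c0 b1 c1 \<beta> \<kappa> \<gamma>) 0"
    using DERIV_isCont by blast
  moreover have "serQ \<alpha> b0 c0 b1 c1 \<beta> \<kappa> \<gamma> 0 \<noteq> 0" by (simp add: ser_zero)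
  ultimately obtain e where e: "e > 0" "\<forall>y. dist 0 y < e \<longrightarrow> serQ \<alpha> b0 c0 b1 c1 \<beta> \<kappa> \<gamma> y \<noteq> 0"
    using continuous_at_avoid by blast
  show ?thesis
    by (rule that[of "min (e / 2) (1 / 2)"]) (use e in auto)
qed

text \<open>
  The second component behaves like \<open>z\<^sup>\<alpha>\<close> at \<open>0\<close>, so the solution is not identically zero, and then it
  has no zeros by uniqueness.
\<close>

lemma left_nonzero:
  assumes "\<alpha> \<ge> 1 / 2" "z \<in> {0<..<1}"
  shows "left1 \<alpha> a b c l z \<noteq> 0 \<or> left2 \<alpha> a b c l z \<noteq> 0"
proof (rule ccontr)
  assume "\<not> ?thesis"
  then have 0: "left1 \<alpha> a b c l z = 0" "left2 \<alpha> a b c l z = 0" by auto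
  obtain x where x: "0 < x" "x < 1" "serQ \<alpha> (c + l) 0 0 (- l) (2 * b) (2 * (a + b\<^sup>2)) (- 2) (of_real x) \<noteq> 0"
    using serQ_nonzero_near_0[OF assms(1), of "c + l" 0] by (metis mult_zero_right)
  have "left2 \<alpha> a b c l x = 0"
    using dirac_solution_unique_zero[OF left_solution[OF assms(1)] assms(2) 0, of x] x by simp
  then show False using x by (simp add: left2_def)
qed

lemma right_nonzero:
  assumes "\<alpha> \<ge> 1 / 2" "z \<in> {0<..<1}"
  shows "right1 \<alpha> a b c l z \<noteq> 0 \<or> right2 \<alpha> a b c l z \<noteq> 0"
proof (rule ccontr)
  assume "\<not> ?thesis"
  then have 0: "right1 \<alpha> a b c l z = 0" "right2 \<alpha> a b c l z = 0" by auto
  obtain x where x: "0 < x" "x < 1" "serQ \<alpha> 0 l (- (c + l)) 0 (- (2 * b)) (- (2 * (a + b\<^sup>2))) 2 (of_real x) \<noteq> 0"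
    using serQ_nonzero_near_0[OF assms(1), of 0 l] by (metis mult_zero_left)
  have "right2 \<alpha> a b c l (1 - x) = 0"
    using dirac_solution_unique_zero[OF right_solution[OF assms(1)] assms(2) 0, of "1 - x"] x by simp
  then show False using x by (simp add: right2_def)
qed

definition params_bounded :: "real \<Rightarrow> real \<Rightarrow> complex \<Rightarrow> complex \<Rightarrow> complex \<Rightarrow> complex \<Rightarrow> bool" where
  "params_bounded K \<alpha> a b c l \<longleftrightarrow> \<alpha> \<ge> 1 / 2 \<and> \<alpha> \<le> K \<and> 2 \<le> K \<and> norm (c + l) \<le> K \<and> norm l \<le> K
     \<and> norm (2 * b) \<le> K \<and> norm (2 * (a + b\<^sup>2)) \<le> K"

lemma params_bounded_frob:
  assumes "params_bounded K \<alpha> a b c l"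
  shows "frob_bounded K \<alpha> (c + l) 0 0 (- l) (2 * b) (2 * (a + b\<^sup>2)) (- 2)"
    and "frob_bounded K \<alpha> 0 l (- (c + l)) 0 (- (2 * b)) (- (2 * (a + b\<^sup>2))) 2"
  using assms unfolding params_bounded_def frob_bounded_def norm_minus_cancel by auto

text \<open>
  A bound for the Frobenius series on the half of the interval next to their endpoint. Only
  \<open>z\<^sup>\<alpha> \<le> z\<^sup>1\<^sup>/\<^sup>2\<close> is used of the decay, which is just enough to cancel the singular weight.
\<close>

definition local_bound :: "real \<Rightarrow> real" where
  "local_bound K = (\<Sum>n. frob_majorant K n * (1 / 2) ^ n)"

lemma local_bound_nonneg: "K \<ge> 0 \<Longrightarrow> local_bound K \<ge> 0"
  unfolding local_bound_def
  by (intro suminf_nonneg summable_frob_majorant) (auto simp: frob_majorant_nonneg)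

lemma powr_le_sqrt:
  assumes "0 < z" "z < 1" "\<alpha> \<ge> 1 / 2"
  shows "(z::real) powr \<alpha> \<le> sqrt z"
  using powr_mono'[of "1 / 2" \<alpha> z] assms by (simp add: powr_half_sqrt)

lemma left_bound:
  assumes "params_bounded K \<alpha> a b c l" "0 < z" "z \<le> 1 / 2"
  shows "norm (left1 \<alpha> a b c l z) \<le> local_bound K * sqrt z" "norm (left2 \<alpha> a b c l z) \<le> local_bound K * sqrt z"
proof -
  have \<alpha>: "\<alpha> \<ge> 1 / 2" and K: "K \<ge> 0" using assms(1) by (auto simp: params_bounded_def)
  have z: "norm (complex_of_real z) \<le> 1 / 2" using assms by simp
  have p: "\<bar>z powr \<alpha>\<bar> \<le> sqrt z" using powr_le_sqrt[OF assms(2) _ \<alpha>] assms by simp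
  show "norm (left1 \<alpha> a b c l z) \<le> local_bound K * sqrt z" "norm (left2 \<alpha> a b c l z) \<le> local_bound K * sqrt z"
    unfolding left1_def left2_def norm_mult norm_of_real mult.commute[of "local_bound K"] unfolding local_bound_def
    by (intro mult_mono p ser_bound[OF params_bounded_frob(1)[OF assms(1)] z]; use assms(2) in simp)+
qed

lemma right_bound:
  assumes "params_bounded K \<alpha> a b c l" "1 / 2 \<le> z" "z < 1"
  shows "norm (right1 \<alpha> a b c l z) \<le> local_bound K * sqrt (1 - z)" "norm (right2 \<alpha> a b c l z) \<le> local_bound K * sqrt (1 - z)"
proof -
  have \<alpha>: "\<alpha> \<ge> 1 / 2" and K: "K \<ge> 0" using assms(1) by (auto simp: params_bounded_def)
  have z: "norm (complex_of_real (1 - z)) \<le> 1 / 2" unfolding norm_of_real using assms by simp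
  have p: "\<bar>(1 - z) powr \<alpha>\<bar> \<le> sqrt (1 - z)" using powr_le_sqrt[of "1 - z", OF _ _ \<alpha>] assms by simp
  show "norm (right1 \<alpha> a b c l z) \<le> local_bound K * sqrt (1 - z)" "norm (right2 \<alpha> a b c l z) \<le> local_bound K * sqrt (1 - z)"
    unfolding right1_def right2_def norm_mult norm_of_real mult.commute[of "local_bound K"] unfolding local_bound_def
    by (intro mult_mono p ser_bound[OF params_bounded_frob(2)[OF assms(1)] z]; use assms(3) in simp)+
qed

lemma params_bounded_exists:
  assumes "\<alpha> \<ge> 1 / 2"
  shows "\<exists>K. params_bounded K \<alpha> a b c l"
proof
  show "params_bounded (2 + \<alpha> + norm (c + l) + norm l + norm (2 * b) + norm (2 * (a + b\<^sup>2))) \<alpha> a b c l"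
    unfolding params_bounded_def using assms
      norm_ge_zero[of "c + l"] norm_ge_zero[of l] norm_ge_zero[of "2 * b"] norm_ge_zero[of "2 * (a + b\<^sup>2)"]
    by (intro conjI; linarith)
qed

text \<open>
  The Wronskian of the two recessive solutions; the midpoint is an arbitrary choice.
\<close>

definition connection :: "real \<Rightarrow> complex \<Rightarrow> complex \<Rightarrow> complex \<Rightarrow> complex \<Rightarrow> complex" where
  "connection \<alpha> a b c l = left1 \<alpha> a b c l (1 / 2) * right2 \<alpha> a b c l (1 / 2)
     - left2 \<alpha> a b c l (1 / 2) * right1 \<alpha> a b c l (1 / 2)"

lemma connection_eq_wronskian:
  assumes "\<alpha> \<ge> 1 / 2" "z \<in> {0<..<1}"
  shows "connection \<alpha> a b c l = left1 \<alpha> a b c l z * right2 \<alpha> a b c l z - left2 \<alpha> a b c l z * right1 \<alpha> a b c l z"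
  unfolding connection_def
  by (rule wronskian_constant[OF left_solution[OF assms(1)] right_solution[OF assms(1)] _ assms(2)]) simp

lemma connection_zero_imp_proportional:
  assumes "\<alpha> \<ge> 1 / 2" "connection \<alpha> a b c l = 0"
  obtains k where "k \<noteq> 0" "\<And>z. z \<in> {0<..<1} \<Longrightarrow> right1 \<alpha> a b c l z = k * left1 \<alpha> a b c l z"
    "\<And>z. z \<in> {0<..<1} \<Longrightarrow> right2 \<alpha> a b c l z = k * left2 \<alpha> a b c l z"
proof -
  let ?l1 = "left1 \<alpha> a b c l" and ?l2 = "left2 \<alpha> a b c l" and ?r1 = "right1 \<alpha> a b c l" and ?r2 = "right2 \<alpha> a b c l"
  have h: "(1 / 2 :: real) \<in> {0<..<1}" by simp
  have "\<exists>k. ?r1 (1 / 2) = k * ?l1 (1 / 2) \<and> ?r2 (1 / 2) = k * ?l2 (1 / 2)"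
  proof (cases "?l1 (1 / 2) = 0")
    case True
    then have l2: "?l2 (1 / 2) \<noteq> 0" using left_nonzero[OF assms(1) h] by blast
    then have "?r1 (1 / 2) = 0" using assms(2) True by (simp add: connection_def)
    then show ?thesis using True l2 by (intro exI[of _ "?r2 (1 / 2) / ?l2 (1 / 2)"]) simp
  next
    case False
    then show ?thesis using assms(2)
      by (intro exI[of _ "?r1 (1 / 2) / ?l1 (1 / 2)"]) (simp add: connection_def field_simps)
  qed
  then obtain k where k: "?r1 (1 / 2) = k * ?l1 (1 / 2)" "?r2 (1 / 2) = k * ?l2 (1 / 2)" by blast
  have "k \<noteq> 0" using k right_nonzero[OF assms(1) h] by auto
  moreover have "?r1 z = k * ?l1 z \<and> ?r2 z = k * ?l2 z" if z: "z \<in> {0<..<1}" for z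
    using dirac_solution_unique_zero[OF dirac_solution_lincomb[OF right_solution[OF assms(1)] left_solution[OF assms(1)], of a b c l k] h _ _ z] k
    by simp
  ultimately show ?thesis using that by blast
qed

section \<open>Eigenvalues as zeros of the connection coefficient\<close>

text \<open>
  This decay makes the weighted square of the solution bounded and sends Wronskians to zero at both
  endpoints. An explicit constant allows the same bound for a whole family of solutions.
\<close>

definition endpoint_decay :: "real \<Rightarrow> (real \<Rightarrow> complex) \<Rightarrow> (real \<Rightarrow> complex) \<Rightarrow> bool" where
  "endpoint_decay C y1 y2 \<longleftrightarrow> (\<forall>z\<in>{0<..<1}. (norm (y1 z))\<^sup>2 \<le> C * (z * (1 - z)) \<and> (norm (y2 z))\<^sup>2 \<le> C * (z * (1 - z)))"

lemma square_bound:
  assumes "norm (x::complex) \<le> B * sqrt w" "w \<ge> 0"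
  shows "(norm x)\<^sup>2 \<le> B\<^sup>2 * w"
  using power_mono[OF assms(1) norm_ge_zero, of 2] assms(2) by (simp add: power_mult_distrib)

text \<open>
  On the right half of the interval the bound comes from the solution that is recessive at \<open>1\<close>.
\<close>

lemma left_endpoint_decay:
  assumes K: "params_bounded K \<alpha> a b c l" and k: "k \<noteq> 0"
    "\<And>z. z \<in> {0<..<1} \<Longrightarrow> right1 \<alpha> a b c l z = k * left1 \<alpha> a b c l z"
    "\<And>z. z \<in> {0<..<1} \<Longrightarrow> right2 \<alpha> a b c l z = k * left2 \<alpha> a b c l z"
  shows "endpoint_decay (2 * (local_bound K)\<^sup>2 * (1 + 1 / (norm k)\<^sup>2)) (left1 \<alpha> a b c l) (left2 \<alpha> a b c l)"
  unfolding endpoint_decay_def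
proof
  fix z :: real assume z: "z \<in> {0<..<1}"
  define B where "B = local_bound K"
  have kk: "(norm k)\<^sup>2 > 0" using k(1) by simp
  have C: "2 * B\<^sup>2 * (1 + 1 / (norm k)\<^sup>2) \<ge> 2 * B\<^sup>2" "2 * B\<^sup>2 * (1 + 1 / (norm k)\<^sup>2) \<ge> 2 * (B\<^sup>2 / (norm k)\<^sup>2)"
    using kk by (auto simp: algebra_simps)
  have zz: "z * (1 - z) \<ge> 0" using z by simp
  show "(norm (left1 \<alpha> a b c l z))\<^sup>2 \<le> 2 * (local_bound K)\<^sup>2 * (1 + 1 / (norm k)\<^sup>2) * (z * (1 - z)) \<and>
    (norm (left2 \<alpha> a b c l z))\<^sup>2 \<le> 2 * (local_bound K)\<^sup>2 * (1 + 1 / (norm k)\<^sup>2) * (z * (1 - z))"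
    unfolding B_def[symmetric]
  \<comment> \<open>on the left half \<open>z \<le> 2 z (1 - z)\<close>, on the right half \<open>1 - z \<le> 2 z (1 - z)\<close>\<close>
  proof (cases "z \<le> 1 / 2")
    case True
    have "(norm x)\<^sup>2 \<le> 2 * B\<^sup>2 * (1 + 1 / (norm k)\<^sup>2) * (z * (1 - z))"
      if "norm (x::complex) \<le> B * sqrt z" for x
    proof -
      have "(norm x)\<^sup>2 \<le> B\<^sup>2 * z" using square_bound[OF that] z by simp
      also have "\<dots> \<le> B\<^sup>2 * (2 * (z * (1 - z)))"
      proof (rule mult_left_mono)
        have "z * (1 / 2) \<le> z * (1 - z)" using True z by (intro mult_left_mono) auto
        then show "z \<le> 2 * (z * (1 - z))" by simp
      qed auto
      also have "\<dots> = 2 * B\<^sup>2 * (z * (1 - z))" by simp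
      also have "\<dots> \<le> 2 * B\<^sup>2 * (1 + 1 / (norm k)\<^sup>2) * (z * (1 - z))"
        by (intro mult_right_mono C zz)
      finally show ?thesis .
    qed
    then show "(norm (left1 \<alpha> a b c l z))\<^sup>2 \<le> 2 * B\<^sup>2 * (1 + 1 / (norm k)\<^sup>2) * (z * (1 - z)) \<and>
      (norm (left2 \<alpha> a b c l z))\<^sup>2 \<le> 2 * B\<^sup>2 * (1 + 1 / (norm k)\<^sup>2) * (z * (1 - z))"
      using left_bound[OF K _ True] z unfolding B_def by simp
  next
    case False
    have "(norm x)\<^sup>2 \<le> 2 * B\<^sup>2 * (1 + 1 / (norm k)\<^sup>2) * (z * (1 - z))"
      if "norm (k * x) \<le> B * sqrt (1 - z)" for x :: complex
    proof -
      have "(norm (k * x))\<^sup>2 \<le> B\<^sup>2 * (1 - z)" using square_bound[OF that] z by simp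
      then have "(norm x)\<^sup>2 \<le> B\<^sup>2 / (norm k)\<^sup>2 * (1 - z)"
        using kk by (simp add: norm_mult power_mult_distrib field_simps)
      also have "\<dots> \<le> B\<^sup>2 / (norm k)\<^sup>2 * (2 * (z * (1 - z)))"
      proof (rule mult_left_mono)
        have "(1 / 2) * (1 - z) \<le> z * (1 - z)" using False z by (intro mult_right_mono) auto
        then show "1 - z \<le> 2 * (z * (1 - z))" by simp
      qed (use kk in auto)
      also have "\<dots> = 2 * (B\<^sup>2 / (norm k)\<^sup>2) * (z * (1 - z))" by simp
      also have "\<dots> \<le> 2 * B\<^sup>2 * (1 + 1 / (norm k)\<^sup>2) * (z * (1 - z))"
        by (intro mult_right_mono C zz)
      finally show ?thesis .
    qed
    then show "(norm (left1 \<alpha> a b c l z))\<^sup>2 \<le> 2 * B\<^sup>2 * (1 + 1 / (norm k)\<^sup>2) * (z * (1 - z)) \<and>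
      (norm (left2 \<alpha> a b c l z))\<^sup>2 \<le> 2 * B\<^sup>2 * (1 + 1 / (norm k)\<^sup>2) * (z * (1 - z))"
      using right_bound[OF K, of z] z False k(2,3)[OF z] unfolding B_def by simp
  qed
qed

lemma bounded_continuous_integrable_lebesgue_on:
  fixes g :: "real \<Rightarrow> 'a::euclidean_space"
  assumes "continuous_on {s<..<t} g" "\<And>z. z \<in> {s<..<t} \<Longrightarrow> norm (g z) \<le> C"
  shows "integrable (lebesgue_on {s<..<t}) g"
proof (rule finite_measure.integrable_const_bound)
  show "finite_measure (lebesgue_on {s<..<t})" by (rule finite_measure_lebesgue_on) simp
  show "g \<in> borel_measurable (lebesgue_on {s<..<t})"
    by (rule continuous_imp_measurable_on_sets_lebesgue[OF assms(1)]) simp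
  show "AE x in lebesgue_on {s<..<t}. norm (g x) \<le> C"
    by (rule AE_I2) (use assms(2) in auto)
qed

lemma AE_unit_interval_iff:
  "(AE z in lebesgue_on {0<..<1::real}. P z) \<longleftrightarrow> (\<exists>N. negligible N \<and> (\<forall>z\<in>{0<..<1} - N. P z))"
proof -
  have "(AE z in lebesgue_on {0<..<1::real}. P z) \<longleftrightarrow> (AE z in lebesgue. z \<in> {0<..<1} \<longrightarrow> P z)"
    by (rule AE_restrict_space_iff) simp
  also have "\<dots> \<longleftrightarrow> (\<exists>N. negligible N \<and> {z. \<not> (z \<in> {0<..<1} \<longrightarrow> P z)} \<subseteq> N)"
    by (rule eventually_ae_filter_negligible)
  also have "\<dots> \<longleftrightarrow> (\<exists>N. negligible N \<and> (\<forall>z\<in>{0<..<1} - N. P z))"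
    by (intro ex_cong1 conj_cong refl) blast
  finally show ?thesis .
qed

lemma bounded_linear_axis: "bounded_linear (axis i :: complex \<Rightarrow> complex^'n)"
proof (rule bounded_linear_intro[where K = 1])
  show "norm (axis i x :: complex^'n) \<le> norm x * 1" for x 
    by (simp add: norm_vec_def L2_set_def axis_def if_distrib[of norm] if_distrib[of "\<lambda>t. t\<^sup>2"] sum.delta cong: if_cong)
qed (auto simp: axis_def vec_eq_iff)

lemma vector_2_eq_axis: "vector [x, y] = axis 1 x + axis (2::2) (y::complex)"
  by (simp add: vec_eq_iff forall_2 axis_def)

lemma decaying_solution_in_L2W:
  assumes c: "continuous_on {0<..<1} y1" "continuous_on {0<..<1} y2" and d: "endpoint_decay C y1 y2"
  shows "(\<lambda>z. vector [y1 z, y2 z]) \<in> L2W"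
  unfolding L2W_iff
proof
  show "(\<lambda>z. vector [y1 z, y2 z] :: complex^2) \<in> borel_measurable (lebesgue_on {0<..<1})"
    unfolding vector_2_eq_axis
    by (intro continuous_imp_measurable_on_sets_lebesgue continuous_intros c
        bounded_linear.continuous_on[OF bounded_linear_axis]) simp
  show "integrable (lebesgue_on {0<..<1}) (\<lambda>z. (norm (vector [y1 z, y2 z] $ 1 :: complex))\<^sup>2 / (1 - z)
      + (norm (vector [y1 z, y2 z] $ (2::2) :: complex))\<^sup>2 / z)"
    unfolding vector_2
  proof (rule bounded_continuous_integrable_lebesgue_on[where C = "C + C"])
    show "continuous_on {0<..<1} (\<lambda>z. (norm (y1 z))\<^sup>2 / (1 - z) + (norm (y2 z))\<^sup>2 / z)"
      by (intro continuous_intros c) auto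
    fix z :: real assume z: "z \<in> {0<..<1}"
    then have zz: "0 < z" "0 < 1 - z" by auto
    have b: "(norm (y1 z))\<^sup>2 \<le> C * z * (1 - z)" "(norm (y2 z))\<^sup>2 \<le> C * (1 - z) * z"
      using d z unfolding endpoint_decay_def by (auto simp: mult_ac)
    have "0 \<le> C * (z * (1 - z))"
      using d z unfolding endpoint_decay_def by (meson order_trans zero_le_power2)
    then have C: "C \<ge> 0" using mult_pos_pos[OF zz] by (metis not_le zero_le_mult_iff)
    have "(norm (y1 z))\<^sup>2 / (1 - z) \<le> C * z" "(norm (y2 z))\<^sup>2 / z \<le> C * (1 - z)"
      using b zz by (simp_all only: pos_divide_le_eq)
    moreover have "C * z \<le> C * 1" "C * (1 - z) \<le> C * 1" using C zz by (intro mult_left_mono; simp)+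
    moreover have "(norm (y1 z))\<^sup>2 / (1 - z) \<ge> 0" "(norm (y2 z))\<^sup>2 / z \<ge> 0" using zz by auto
    ultimately show "norm ((norm (y1 z))\<^sup>2 / (1 - z) + (norm (y2 z))\<^sup>2 / z) \<le> C + C"
      unfolding real_norm_def by linarith
  qed
qed

text \<open>
  The solution is continuously differentiable, hence locally absolutely continuous, and nonzero on an
  open set, which is not negligible.
\<close>

lemma decaying_solution_imp_eigenvalue:
  assumes s: "dirac_solution ((\<mu> + 1) / 2) (of_real (u $ 1)) (of_real (u $ 2)) (of_real (u $ 3)) l y1 y2"
    and d: "endpoint_decay C y1 y2" and z0: "z0 \<in> {0<..<1}" "y1 z0 \<noteq> 0 \<or> y2 z0 \<noteq> 0"
  shows "eigenvalue_T \<mu> u l"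
proof -
  let ?\<alpha> = "(\<mu> + 1) / 2"
  define y :: "real \<Rightarrow> complex^2" where "y = (\<lambda>z. vector [y1 z, y2 z])"
  define d1 where "d1 = (\<lambda>z. diag_coeff ?\<alpha> (of_real (u $ 2)) z * y1 z + ((of_real (u $ 3) + l) / of_real z + 2 * (of_real (u $ 1) + (of_real (u $ 2))\<^sup>2)) * y2 z)"
  define d2 where "d2 = (\<lambda>z. - (2 + l / of_real (1 - z)) * y1 z - diag_coeff ?\<alpha> (of_real (u $ 2)) z * y2 z)"
  have yd: "(y has_vector_derivative vector [d1 z, d2 z]) (at z)" if "z \<in> {0<..<1}" for z
    unfolding y_def vector_2_eq_axis
    by (intro has_vector_derivative_add bounded_linear.has_vector_derivative[OF bounded_linear_axis])
       (use s[unfolded dirac_solution_def, rule_format, OF that] in \<open>auto simp: d1_def d2_def\<close>)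
  note c = dirac_solution_continuous[OF s]
  note ne = of_real_one_minus_neq_0
  have ac: "loc_abs_cont y" unfolding loc_abs_cont_def
  proof (intro allI impI, elim conjE)
    fix s t :: real assume st: "0 < s" "s < t" "t < 1"
    have sub: "{s..t} \<subseteq> {0<..<1}" using st by auto
    have "continuous_on {s..t} d1" "continuous_on {s..t} d2"
      unfolding d1_def d2_def diag_coeff_def
      by (intro continuous_intros continuous_on_subset[OF c(1) sub] continuous_on_subset[OF c(2) sub]; use st ne in force)+
    then have "continuous_on {s..t} (\<lambda>z. vector [d1 z, d2 z] :: complex^2)"
      unfolding vector_2_eq_axis
      by (intro continuous_intros bounded_linear.continuous_on[OF bounded_linear_axis])
    then show "abs_cont_on {s..t} y"
      by (rule abs_cont_on_C1[rotated]) (use yd sub in auto)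
  qed
  have L: "y \<in> L2W" unfolding y_def by (rule decaying_solution_in_L2W[OF c d])
  have "(\<lambda>z. vector [l * y1 z, l * y2 z]) \<in> L2W"
  proof (rule decaying_solution_in_L2W)
    show "endpoint_decay ((norm l)\<^sup>2 * C) (\<lambda>z. l * y1 z) (\<lambda>z. l * y2 z)"
      using d unfolding endpoint_decay_def norm_mult power_mult_distrib mult.assoc
      by (auto intro!: mult_left_mono)
  qed (intro continuous_intros c)+
  moreover have "(\<lambda>z. vector [l * y1 z, l * y2 z]) = (\<lambda>z. l *s y z)"
    by (simp add: fun_eq_iff vec_eq_iff forall_2 y_def)
  ultimately have L': "(\<lambda>z. l *s y z) \<in> L2W" by simp
  have tau: "l *s y z = tau \<mu> u z (y z) (vector [d1 z, d2 z])" if "z \<in> {0<..<1}" for z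
    using that by (subst tau_components) (simp_all add: d1_def d2_def y_def diag_coeff_def)
  have "(y, \<lambda>z. l *s y z) \<in> op_T \<mu> u"
    unfolding op_T_def mem_Collect_eq prod.case
    using L L' ac unfolding AE_unit_interval_iff
    by (intro conjI exI[of _ "{}"] ballI exI[of _ "vector [d1 z, d2 z]" for z]) (use yd tau in auto)
  moreover have "\<not> (AE z in lebesgue_on {0<..<1}. y z = 0)"
  proof
    assume "AE z in lebesgue_on {0<..<1}. y z = 0"
    then obtain N where N: "negligible N" "\<forall>z\<in>{0<..<1} - N. y z = 0"
      unfolding AE_unit_interval_iff by blast
    define g where "g = (\<lambda>z. norm (y1 z) + norm (y2 z))"
    have gc: "continuous_on {0<..<1} g" unfolding g_def by (intro continuous_intros c)
    have "open ({0<..<1} \<inter> g -` {0<..})" by (rule continuous_open_preimage[OF gc]) auto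
    moreover have "z0 \<in> {0<..<1} \<inter> g -` {0<..}"
      using z0 by (auto simp: g_def add_pos_nonneg add_nonneg_pos)
    moreover have "{0<..<1} \<inter> g -` {0<..} \<subseteq> N"
    proof
      fix x assume x: "x \<in> {0<..<1} \<inter> g -` {0<..}"
      show "x \<in> N"
      proof (rule ccontr)
        assume "x \<notin> N"
        then have "y x = 0" using N(2) x by blast
        then have "y x $ 1 = 0" "y x $ 2 = 0" by simp_all
        then show False using x by (simp add: y_def g_def)
      qed
    qed
    then have "negligible ({0<..<1} \<inter> g -` {0<..})" using N(1) negligible_subset by blast
    ultimately show False using open_not_negligible by blast
  qed
  ultimately show ?thesis unfolding eigenvalue_T_def by blast
qed

lemma connection_zero_imp_eigenvalue:
  assumes "(\<mu>::real) \<ge> 0" "connection ((\<mu> + 1) / 2) (of_real (u $ 1)) (of_real (u $ 2)) (of_real (u $ 3)) l = 0"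
  shows "eigenvalue_T \<mu> u l"
proof -
  have \<alpha>: "(\<mu> + 1) / 2 \<ge> 1 / 2" using assms by simp
  obtain K where K: "params_bounded K ((\<mu> + 1) / 2) (of_real (u $ 1)) (of_real (u $ 2)) (of_real (u $ 3)) l"
    using params_bounded_exists[OF \<alpha>] by blast
  obtain k where k: "k \<noteq> 0" "\<And>z. z \<in> {0<..<1} \<Longrightarrow> right1 ((\<mu> + 1) / 2) (of_real (u $ 1)) (of_real (u $ 2)) (of_real (u $ 3)) l z
      = k * left1 ((\<mu> + 1) / 2) (of_real (u $ 1)) (of_real (u $ 2)) (of_real (u $ 3)) l z"
    "\<And>z. z \<in> {0<..<1} \<Longrightarrow> right2 ((\<mu> + 1) / 2) (of_real (u $ 1)) (of_real (u $ 2)) (of_real (u $ 3)) l z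
      = k * left2 ((\<mu> + 1) / 2) (of_real (u $ 1)) (of_real (u $ 2)) (of_real (u $ 3)) l z"
    using connection_zero_imp_proportional[OF \<alpha> assms(2)] by blast
  have h: "1 / 2 \<in> {0<..<1::real}" by simp
  show ?thesis
    by (rule decaying_solution_imp_eigenvalue[OF left_solution[OF \<alpha>] left_endpoint_decay[OF K k] h left_nonzero[OF \<alpha> h]])
qed

text \<open>
  Used with a logarithm for \<open>F\<close>: an integrable function cannot dominate a multiple of \<open>1 / z\<close> near
  \<open>0\<close>, or of \<open>1 / (1 - z)\<close> near \<open>1\<close>.
\<close>

lemma integral_bounds_increment:
  fixes G F f :: "real \<Rightarrow> real"
  assumes G: "integrable (lebesgue_on {0<..<1}) G" "\<And>z. z \<in> {0<..<1} \<Longrightarrow> G z \<ge> 0"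
    and st: "0 < s" "s \<le> t" "t < 1"
    and F: "\<And>z. z \<in> {s..t} \<Longrightarrow> (F has_real_derivative f z) (at z)"
    and le: "\<And>z. z \<in> {s..t} \<Longrightarrow> f z \<le> G z"
  shows "F t - F s \<le> integral {0<..<1} G"
proof -
  have sub: "{s..t} \<subseteq> {0<..<1}" using st by auto
  have Gi: "G integrable_on {0<..<1}" by (rule integrable_on_lebesgue_on[OF G(1)]) simp
  have "set_integrable lebesgue {0<..<1} G"
    using G(1) by (simp add: set_integrable_def integrable_restrict_space)
  then have "set_integrable lebesgue {s..t} G"
    by (rule set_integrable_subset) (use sub in auto)
  then have Gs: "G integrable_on {s..t}"
    using absolutely_integrable_on_def by blast
  have "(f has_integral F t - F s) {s..t}"
    by (rule fundamental_theorem_of_calculus[OF st(2)])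
       (use F in \<open>auto simp: has_real_derivative_iff_has_vector_derivative intro: has_vector_derivative_at_within\<close>)
  then have "F t - F s \<le> integral {s..t} G"
    by (rule has_integral_le[OF _ integrable_integral[OF Gs]]) (use le in auto)
  also have "\<dots> \<le> integral {0<..<1} G"
    by (rule integral_subset_le[OF sub Gs Gi]) (use G(2) in auto)
  finally show ?thesis .
qed

text \<open>
  If one solution is small of order \<open>w\<^sup>1\<^sup>/\<^sup>2\<close> and the Wronskian \<open>d\<close> is a nonzero constant, then the square
  of the other solution is at least of order \<open>1 / w\<close>.
\<close>

lemma wronskian_square_bound:
  fixes k B w :: real and x1 x2 y1 y2 d :: complex
  assumes "d = x1 * y2 - x2 * y1" "norm x1 \<le> B * sqrt w" "norm x2 \<le> B * sqrt w" "w > 0" "B \<ge> 0"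
  shows "(norm d)\<^sup>2 \<le> 2 * B\<^sup>2 * w * ((norm y1)\<^sup>2 + (norm y2)\<^sup>2)"
proof -
  have "norm d \<le> norm x1 * norm y2 + norm x2 * norm y1"
    unfolding assms(1) by (metis norm_mult norm_triangle_ineq4)
  also have "\<dots> \<le> B * sqrt w * norm y2 + B * sqrt w * norm y1"
    using assms by (intro add_mono mult_right_mono) auto
  also have "\<dots> = B * sqrt w * (norm y1 + norm y2)" by (simp add: algebra_simps)
  finally have "(norm d)\<^sup>2 \<le> (B * sqrt w * (norm y1 + norm y2))\<^sup>2" by (rule power_mono) simp
  also have "\<dots> = B\<^sup>2 * w * (norm y1 + norm y2)\<^sup>2" using assms by (simp add: power_mult_distrib)
  also have "\<dots> \<le> B\<^sup>2 * w * (2 * ((norm y1)\<^sup>2 + (norm y2)\<^sup>2))"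
  proof (rule mult_left_mono)
    have "0 \<le> (norm y1 - norm y2)\<^sup>2" by simp
    then show "(norm y1 + norm y2)\<^sup>2 \<le> 2 * ((norm y1)\<^sup>2 + (norm y2)\<^sup>2)" by (simp add: power2_eq_square algebra_simps)
  qed (use assms in auto)
  finally show ?thesis by (simp add: algebra_simps)
qed

text \<open>
  The Wronskians of an eigenfunction \<open>y\<close> with the two recessive solutions are absolutely continuous
  with almost everywhere vanishing derivative, hence constant, and square integrability of \<open>y\<close> forces
  both constants to be zero. At a point where \<open>y \<noteq> 0\<close> both recessive solutions are then multiples of
  \<open>y\<close>, so their own Wronskian vanishes there.
\<close>

lemma eigenvalue_imp_connection_zero:
  assumes \<mu>: "\<mu> \<ge> 0" and e: "eigenvalue_T \<mu> u l"
  shows "connection ((\<mu> + 1) / 2) (of_real (u $ 1)) (of_real (u $ 2)) (of_real (u $ 3)) l = 0"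
proof -
  define \<alpha> where "\<alpha> = (\<mu> + 1) / 2"
  define a b c :: complex where "a = of_real (u $ 1)" and "b = of_real (u $ 2)" and "c = of_real (u $ 3)"
  have \<alpha>: "\<alpha> \<ge> 1 / 2" using \<mu> by (simp add: \<alpha>_def)
  obtain y where y: "(y, \<lambda>z. l *s y z) \<in> op_T \<mu> u" and nz: "\<not> (AE z in lebesgue_on {0<..<1}. y z = 0)"
    using e unfolding eigenvalue_T_def by blast
  have yL: "y \<in> L2W" and yac: "loc_abs_cont y"
    and ae: "AE z in lebesgue_on {0<..<1}. \<exists>y'. (y has_vector_derivative y') (at z) \<and> l *s y z = tau \<mu> u z (y z) y'"
    using y unfolding op_T_def by auto
  then obtain N where N: "negligible N" and N': "\<forall>z\<in>{0<..<1} - N. \<exists>y'. (y has_vector_derivative y') (at z) \<and> l *s y z = tau \<mu> u z (y z) y'"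
    unfolding AE_unit_interval_iff by blast
  define G where "G = (\<lambda>z. (norm (y z $ 1))\<^sup>2 / (1 - z) + (norm (y z $ 2))\<^sup>2 / z)"
  have G: "integrable (lebesgue_on {0<..<1}) G" using yL unfolding L2W_iff G_def by blast
  have G0: "G z \<ge> 0" and Gge: "(norm (y z $ 1))\<^sup>2 + (norm (y z $ 2))\<^sup>2 \<le> G z" if z: "z \<in> {0<..<1}" for z
  proof -
    show "G z \<ge> 0" using z by (simp add: G_def)
    have "(norm (y z $ 1))\<^sup>2 / 1 \<le> (norm (y z $ 1))\<^sup>2 / (1 - z)" "(norm (y z $ 2))\<^sup>2 / 1 \<le> (norm (y z $ 2))\<^sup>2 / z"
      using z by (intro divide_left_mono; simp)+
    then show "(norm (y z $ 1))\<^sup>2 + (norm (y z $ 2))\<^sup>2 \<le> G z" by (simp add: G_def)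
  qed
  have const: "x1 t * y t $ 2 - x2 t * y t $ 1 = x1 s * y s $ 2 - x2 s * y s $ 1"
    if x: "dirac_solution \<alpha> a b c l x1 x2" and st: "0 < s" "s < t" "t < 1" for x1 x2 s t
  proof (rule abs_cont_on_derivative_zero_ae[OF _ less_imp_le[OF st(2)] N])
    have sub: "{s..t} \<subseteq> {0<..<1}" using st by auto
    note ne = of_real_one_minus_neq_0
    have acy: "abs_cont_on {s..t} (\<lambda>z. y z $ i)" for i
      using yac st unfolding loc_abs_cont_def by (intro abs_cont_on_nth) blast
    note xc = dirac_solution_continuous[OF x]
    have acx1: "abs_cont_on {s..t} x1"
    proof (rule abs_cont_on_C1)
      show "(x1 has_vector_derivative diag_coeff \<alpha> b z * x1 z + ((c + l) / of_real z + 2 * (a + b\<^sup>2)) * x2 z) (at z)"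
        if "z \<in> {s..t}" for z using x sub that unfolding dirac_solution_def by blast
      show "continuous_on {s..t} (\<lambda>z. diag_coeff \<alpha> b z * x1 z + ((c + l) / of_real z + 2 * (a + b\<^sup>2)) * x2 z)"
        unfolding diag_coeff_def
        by (intro continuous_intros continuous_on_subset[OF xc(1) sub] continuous_on_subset[OF xc(2) sub]; use st ne in force)
    qed
    have acx2: "abs_cont_on {s..t} x2"
    proof (rule abs_cont_on_C1)
      show "(x2 has_vector_derivative - (2 + l / of_real (1 - z)) * x1 z - diag_coeff \<alpha> b z * x2 z) (at z)"
        if "z \<in> {s..t}" for z using x sub that unfolding dirac_solution_def by blast
      show "continuous_on {s..t} (\<lambda>z. - (2 + l / of_real (1 - z)) * x1 z - diag_coeff \<alpha> b z * x2 z)"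
        unfolding diag_coeff_def
        by (intro continuous_intros continuous_on_subset[OF xc(1) sub] continuous_on_subset[OF xc(2) sub]; use st ne in force)
    qed
    show "abs_cont_on {s..t} (\<lambda>z. x1 z * y z $ 2 - x2 z * y z $ 1)"
      by (intro abs_cont_on_diff abs_cont_on_mult acx1 acx2 acy)
    fix z assume "z \<in> {s..t} - N"
    then have z: "z \<in> {0<..<1}" "z \<notin> N" using sub by auto
    then obtain y' where y': "(y has_vector_derivative y') (at z)" "l *s y z = tau \<mu> u z (y z) y'"
      using N' by blast
    have yi: "((\<lambda>z. y z $ i) has_vector_derivative y' $ i) (at z)" for i
      by (rule bounded_linear.has_vector_derivative[OF bounded_linear_vec_nth y'(1)])
    have comp: "y' $ 1 = diag_coeff \<alpha> b z * y z $ 1 + ((c + l) / of_real z + 2 * (a + b\<^sup>2)) * y z $ 2"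
      "y' $ 2 = - (2 + l / of_real (1 - z)) * y z $ 1 - diag_coeff \<alpha> b z * y z $ 2"
      using y'(2)[unfolded tau_components[OF z(1)[unfolded greaterThanLessThan_iff, THEN conjunct1] z(1)[unfolded greaterThanLessThan_iff, THEN conjunct2]]]
      by (simp_all add: diag_coeff_def \<alpha>_def a_def b_def c_def)
    note X = x[unfolded dirac_solution_def, rule_format, OF z(1)]
    show "((\<lambda>z. x1 z * y z $ 2 - x2 z * y z $ 1) has_vector_derivative 0) (at z)"
      by (rule has_vector_derivative_eq_rhs[OF has_vector_derivative_diff[OF
         has_vector_derivative_mult[OF X[THEN conjunct1] yi[of 2]] has_vector_derivative_mult[OF X[THEN conjunct2] yi[of 1]]]])
         (simp add: comp algebra_simps)
  qed
  have const': "x1 t * y t $ 2 - x2 t * y t $ 1 = x1 (1 / 2) * y (1 / 2) $ 2 - x2 (1 / 2) * y (1 / 2) $ 1"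
    if x: "dirac_solution \<alpha> a b c l x1 x2" and t: "t \<in> {0<..<1}" for x1 x2 t
  proof (cases t "1 / 2 :: real" rule: linorder_cases)
    case less
    then show ?thesis using const[OF x, of t "1 / 2"] t by simp
  next
    case equal
    show ?thesis unfolding equal by (rule refl)
  next
    case greater
    then show ?thesis using const[OF x, of "1 / 2" t] t by simp
  qed
  obtain K where K: "params_bounded K \<alpha> a b c l"
    using params_bounded_exists[OF \<alpha>] by blast
  define B where "B = local_bound K + 1"
  have "local_bound K \<ge> 0" using K by (intro local_bound_nonneg) (auto simp: params_bounded_def)
  then have B: "B > 0" "local_bound K \<le> B" by (auto simp: B_def)
  define I where "I = integral {0<..<1} G"
  have "I \<ge> 0" unfolding I_def
    by (rule integral_nonneg[OF integrable_on_lebesgue_on[OF G]]) (use G0 in auto)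
  have L0: "left1 \<alpha> a b c l t * y t $ 2 - left2 \<alpha> a b c l t * y t $ 1 = 0" if t: "t \<in> {0<..<1}" for t
  proof (rule ccontr)
    define d where "d = left1 \<alpha> a b c l (1 / 2) * y (1 / 2) $ 2 - left2 \<alpha> a b c l (1 / 2) * y (1 / 2) $ 1"
    assume "\<not> ?thesis"
    then have d0: "d \<noteq> 0" using const'[OF left_solution[OF \<alpha>] t] by (simp add: d_def)
    define m where "m = (norm d)\<^sup>2 / (2 * B\<^sup>2)"
    have m: "m > 0" using d0 B by (simp add: m_def)
    have low: "m / z \<le> G z" if z: "0 < z" "z \<le> 1 / 2" for z
    proof -
      have z': "z \<in> {0<..<1}" using z by simp
      have "local_bound K * sqrt z \<le> B * sqrt z" using B z by (intro mult_right_mono) auto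
      note le = left_bound[OF K z, THEN order_trans, OF this]
      then have "(norm d)\<^sup>2 \<le> 2 * B\<^sup>2 * z * ((norm (y z $ 1))\<^sup>2 + (norm (y z $ 2))\<^sup>2)"
        using const'[OF left_solution[OF \<alpha>] z'] B z
        by (intro wronskian_square_bound[of d "left1 \<alpha> a b c l z" _ "left2 \<alpha> a b c l z"] le) (auto simp: d_def)
      also have "\<dots> \<le> 2 * B\<^sup>2 * z * G z" by (intro mult_left_mono Gge z') (use z in auto)
      finally show ?thesis using B z by (simp add: m_def field_simps)
    qed
    \<comment> \<open>chosen so that \<open>m ln z\<close> grows by \<open>I + 1\<close> between \<open>s\<close> and \<open>1 / 2\<close>, more than the integral allows\<close>
    define s where "s = exp (- (I + 1) / m) / 2"
    have "(I + 1) / m > 0" using m \<open>I \<ge> 0\<close> by simp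
    then have s: "0 < s" "s \<le> 1 / 2" unfolding s_def minus_divide_left[symmetric] by auto
    have "m * ln (1 / 2) - m * ln s \<le> I" unfolding I_def
    proof (rule integral_bounds_increment[OF G G0 s(1,2)])
      show "((\<lambda>z. m * ln z) has_real_derivative m / z) (at z)" if "z \<in> {s..1 / 2}" for z
        using that s by (auto intro!: derivative_eq_intros)
      show "m / z \<le> G z" if "z \<in> {s..1 / 2}" for z using low that s by auto
    qed auto
    moreover have "ln s = - (I + 1) / m - ln 2" by (simp add: s_def ln_div)
    ultimately show False using m by (simp add: ln_div field_simps)
  qed
  have R0: "right1 \<alpha> a b c l t * y t $ 2 - right2 \<alpha> a b c l t * y t $ 1 = 0" if t: "t \<in> {0<..<1}" for t
  proof (rule ccontr)
    define d where "d = right1 \<alpha> a b c l (1 / 2) * y (1 / 2) $ 2 - right2 \<alpha> a b c l (1 / 2) * y (1 / 2) $ 1"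
    assume "\<not> ?thesis"
    then have d0: "d \<noteq> 0" using const'[OF right_solution[OF \<alpha>] t] by (simp add: d_def)
    define m where "m = (norm d)\<^sup>2 / (2 * B\<^sup>2)"
    have m: "m > 0" using d0 B by (simp add: m_def)
    have low: "m / (1 - z) \<le> G z" if z: "1 / 2 \<le> z" "z < 1" for z
    proof -
      have z': "z \<in> {0<..<1}" using z by simp
      have "local_bound K * sqrt (1 - z) \<le> B * sqrt (1 - z)" using B z by (intro mult_right_mono) auto
      note le = right_bound[OF K z, THEN order_trans, OF this]
      then have "(norm d)\<^sup>2 \<le> 2 * B\<^sup>2 * (1 - z) * ((norm (y z $ 1))\<^sup>2 + (norm (y z $ 2))\<^sup>2)"
        using const'[OF right_solution[OF \<alpha>] z'] B z
        by (intro wronskian_square_bound[of d "right1 \<alpha> a b c l z" _ "right2 \<alpha> a b c l z"] le) (auto simp: d_def)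
      also have "\<dots> \<le> 2 * B\<^sup>2 * (1 - z) * G z" by (intro mult_left_mono Gge z') (use z in auto)
      finally show ?thesis using B z by (simp add: m_def field_simps)
    qed
    \<comment> \<open>the mirror image of the choice of \<open>s\<close> above\<close>
    define r where "r = exp (- (I + 1) / m) / 2"
    have "(I + 1) / m > 0" using m \<open>I \<ge> 0\<close> by simp
    then have r: "0 < r" "r \<le> 1 / 2" unfolding r_def minus_divide_left[symmetric] by auto
    have "- m * ln (1 - (1 - r)) - - m * ln (1 - 1 / 2) \<le> I" unfolding I_def
    proof (rule integral_bounds_increment[OF G G0, where F = "\<lambda>z. - m * ln (1 - z)" and s = "1 / 2" and t = "1 - r"])
      show "((\<lambda>z. - m * ln (1 - z)) has_real_derivative m / (1 - z)) (at z)" if "z \<in> {1 / 2..1 - r}" for z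
        using that r by (auto intro!: derivative_eq_intros)
      show "m / (1 - z) \<le> G z" if "z \<in> {1 / 2..1 - r}" for z using low that r by auto
    qed (use r in auto)
    moreover have "ln r = - (I + 1) / m - ln 2" by (simp add: r_def ln_div)
    ultimately show False using m by (simp add: ln_div field_simps)
  qed
  have "\<exists>t\<in>{0<..<1}. y t \<noteq> 0"
  proof (rule ccontr)
    assume "\<not> ?thesis"
    then have "AE z in lebesgue_on {0<..<1}. y z = 0" by (intro AE_I2) auto
    then show False using nz by blast
  qed
  then obtain t where t: "t \<in> {0<..<1}" "y t $ 1 \<noteq> 0 \<or> y t $ 2 \<noteq> 0" by (auto simp: vec_eq_iff forall_2)
  let ?L1 = "left1 \<alpha> a b c l t" and ?L2 = "left2 \<alpha> a b c l t" and ?R1 = "right1 \<alpha> a b c l t" and ?R2 = "right2 \<alpha> a b c l t"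
  have "(?L1 * ?R2 - ?L2 * ?R1) * y t $ 1 = 0" "(?L1 * ?R2 - ?L2 * ?R1) * y t $ 2 = 0"
    using L0[OF t(1)] R0[OF t(1)] by algebra+
  then have "?L1 * ?R2 - ?L2 * ?R1 = 0" using t(2) by auto
  then show ?thesis using connection_eq_wronskian[OF \<alpha> t(1)] unfolding \<alpha>_def a_def b_def c_def by simp
qed

section \<open>Integrated Wronskian identity and reality of the eigenvalues\<close>

lemma bounded_continuous_integrable_on:
  fixes g :: "real \<Rightarrow> 'a::euclidean_space"
  assumes "continuous_on {s<..<t} g" "\<And>z. z \<in> {s<..<t} \<Longrightarrow> norm (g z) \<le> C"
  shows "g integrable_on {s<..<t}"
  by (rule integrable_on_lebesgue_on[OF bounded_continuous_integrable_lebesgue_on[OF assms]]) auto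

lemma FTC_open_interval:
  fixes f F :: "real \<Rightarrow> complex"
  assumes st: "s < t" and F: "\<And>z. z \<in> {s<..<t} \<Longrightarrow> (F has_vector_derivative f z) (at z)"
    and A: "(F \<longlongrightarrow> A) (at_right s)" and B: "(F \<longlongrightarrow> B) (at_left t)"
  shows "(f has_integral B - A) {s<..<t}"
proof -
  \<comment> \<open>extended by its limits, \<open>F\<close> is continuous on the closed interval\<close>
  define G where "G = (\<lambda>z. if z \<le> s then A else if z \<ge> t then B else F z)"
  have GF: "G z = F z" if "s < z" "z < t" for z using that by (simp add: G_def)
  have ev: "\<forall>\<^sub>F x in at z. F x = G x" if "s < z" "z < t" for z
  proof -
    have "\<forall>\<^sub>F x in at z. x \<in> {s<..<t}" using that by (intro eventually_at_in_open') auto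
    then show ?thesis by eventually_elim (simp add: GF)
  qed
  have "continuous_on {s..t} G"
  proof (rule continuous_on_IccI[OF _ _ _ st])
    have "\<forall>\<^sub>F x in at_right s. F x = G x"
      using eventually_at_right_real[OF st] by eventually_elim (simp add: GF)
    then show "(G \<longlongrightarrow> G s) (at_right s)"
      using A tendsto_cong by (fastforce simp: G_def)
    have "\<forall>\<^sub>F x in at_left t. F x = G x"
      using eventually_at_left_real[OF st] by eventually_elim (simp add: GF)
    then show "(G \<longlongrightarrow> G t) (at_left t)"
      using B st tendsto_cong by (fastforce simp: G_def)
    fix z assume z: "s < z" "z < t"
    have "isCont F z" using F[of z] z has_vector_derivative_continuous by auto
    then have "(F \<longlongrightarrow> G z) (at z)" using GF[OF z] by (simp add: isCont_def)
    then show "(G \<longlongrightarrow> G z) (at z)" using tendsto_cong[OF ev[OF z]] by blast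
  qed
  moreover have "(G has_vector_derivative f z) (at z)" if "z \<in> {s<..<t}" for z
    by (rule has_vector_derivative_transform_within_open[OF F[OF that], of "{s<..<t}"])
       (use that in \<open>auto simp: GF\<close>)
  ultimately have "(f has_integral G t - G s) {s..t}"
    by (intro fundamental_theorem_of_calculus_interior) (use st in auto)
  then show ?thesis using st by (simp add: has_integral_Icc_iff_Ioo G_def)
qed

text \<open>
  The bilinear form \<open>y\<^sup>T W w\<close>. It has no complex conjugation, so it is analytic in the solutions; for
  real \<open>y = w\<close> it is the density of the squared norm.
\<close>

definition weight_pairing :: "(real \<Rightarrow> complex) \<Rightarrow> (real \<Rightarrow> complex) \<Rightarrow> (real \<Rightarrow> complex) \<Rightarrow> (real \<Rightarrow> complex) \<Rightarrow> real \<Rightarrow> complex" where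
  "weight_pairing y1 y2 w1 w2 z = y1 z * w1 z / of_real (1 - z) + y2 z * w2 z / of_real z"

lemma weight_pairing_continuous:
  assumes "continuous_on S y1" "continuous_on S y2" "continuous_on S w1" "continuous_on S w2" "S \<subseteq> {0<..<1}"
  shows "continuous_on S (weight_pairing y1 y2 w1 w2)"
proof -
  note ne = of_real_one_minus_neq_0
  show ?thesis unfolding weight_pairing_def
    by (intro continuous_intros assms) (use assms(5) ne in force)+
qed

lemma integral_positive:
  fixes N :: "real \<Rightarrow> real"
  assumes c: "continuous_on {s<..<t} N" and b: "\<And>z. z \<in> {s<..<t} \<Longrightarrow> N z \<le> C"
    and n: "\<And>z. z \<in> {s<..<t} \<Longrightarrow> N z \<ge> 0" and z0: "z0 \<in> {s<..<t}" "N z0 > 0"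
  shows "integral {s<..<t} N > 0"
proof -
  have i: "N integrable_on {s<..<t}"
    by (rule bounded_continuous_integrable_on[OF c, of C]) (use b n in auto)
  have "open ({s<..<t} \<inter> N -` {N z0 / 2<..})" by (rule continuous_open_preimage[OF c]) auto
  moreover have "z0 \<in> {s<..<t} \<inter> N -` {N z0 / 2<..}" using z0 by auto
  ultimately obtain e where e: "e > 0" "cball z0 e \<subseteq> {s<..<t} \<inter> N -` {N z0 / 2<..}"
    using open_contains_cball by blast
  have sub: "{z0 - e..z0 + e} \<subseteq> {s<..<t} \<inter> N -` {N z0 / 2<..}"
    using e(2) by (simp add: cball_eq_atLeastAtMost)
  have i2: "N integrable_on {z0 - e..z0 + e}"
    by (rule integrable_continuous_real, rule continuous_on_subset[OF c]) (use sub in auto)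
  have "0 < N z0 / 2 * (z0 + e - (z0 - e))" using z0 e by simp
  also have "\<dots> = integral {z0 - e..z0 + e} (\<lambda>_. N z0 / 2)" using e by simp
  also have "\<dots> \<le> integral {z0 - e..z0 + e} N"
    by (rule integral_le[OF _ i2]) (use sub in \<open>auto intro: less_imp_le\<close>)
  also have "\<dots> \<le> integral {s<..<t} N"
    by (rule integral_subset_le[OF _ i2 i]) (use sub n in auto)
  finally show ?thesis .
qed

text \<open>
  For real \<open>u\<close> conjugation maps solutions for \<open>l\<close> to solutions for the conjugate of \<open>l\<close>.
\<close>

lemma dirac_solution_cnj:
  assumes s: "dirac_solution \<alpha> a b c l y1 y2" and r: "a \<in> \<real>" "b \<in> \<real>" "c \<in> \<real>"
  shows "dirac_solution \<alpha> a b c (cnj l) (\<lambda>z. cnj (y1 z)) (\<lambda>z. cnj (y2 z))"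
  unfolding dirac_solution_def
proof (intro ballI conjI)
  fix z :: real assume z: "z \<in> {0<..<1}"
  have rr: "cnj a = a" "cnj b = b" "cnj c = c" using r by (auto simp: Reals_cnj_iff)
  note S = s[unfolded dirac_solution_def, rule_format, OF z]
  show "((\<lambda>z. cnj (y1 z)) has_vector_derivative diag_coeff \<alpha> b z * cnj (y1 z) + ((c + cnj l) / of_real z + 2 * (a + b\<^sup>2)) * cnj (y2 z)) (at z)"
    by (rule has_vector_derivative_eq_rhs[OF bounded_linear.has_vector_derivative[OF bounded_linear_cnj S[THEN conjunct1]]])
       (simp add: diag_coeff_def rr)
  show "((\<lambda>z. cnj (y2 z)) has_vector_derivative - (2 + cnj l / of_real (1 - z)) * cnj (y1 z) - diag_coeff \<alpha> b z * cnj (y2 z)) (at z)"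
    by (rule has_vector_derivative_eq_rhs[OF bounded_linear.has_vector_derivative[OF bounded_linear_cnj S[THEN conjunct2]]])
       (simp add: diag_coeff_def rr)
qed

lemma product_bound_of_squares:
  fixes x y :: complex
  assumes "(norm x)\<^sup>2 \<le> B" "(norm y)\<^sup>2 \<le> B"
  shows "norm (x * y) \<le> B"
proof -
  have "0 \<le> (norm x - norm y)\<^sup>2" by simp
  then have "2 * (norm x * norm y) \<le> (norm x)\<^sup>2 + (norm y)\<^sup>2" by (simp add: power2_eq_square algebra_simps)
  then show ?thesis using assms by (simp add: norm_mult)
qed

lemma decay_products:
  assumes "endpoint_decay C y1 y2" "endpoint_decay C w1 w2" "z \<in> {0<..<1}"
  shows "norm (y1 z * w1 z) \<le> C * (z * (1 - z))" "norm (y1 z * w2 z) \<le> C * (z * (1 - z))"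
    "norm (y2 z * w1 z) \<le> C * (z * (1 - z))" "norm (y2 z * w2 z) \<le> C * (z * (1 - z))"
  using assms unfolding endpoint_decay_def by (intro product_bound_of_squares; blast)+

lemma endpoint_decay_const_nonneg:
  assumes "endpoint_decay C y1 y2"
  shows "C \<ge> 0"
proof -
  have "0 \<le> C * (1 / 2 * (1 - 1 / 2))"
    using assms unfolding endpoint_decay_def by (intro order_trans[OF zero_le_power2[of "norm (y1 (1 / 2))"]]) (auto dest!: bspec[of _ _ "1 / 2"])
  then show ?thesis by simp
qed

lemma weight_pairing_bound:
  assumes "endpoint_decay C y1 y2" "endpoint_decay C w1 w2" "z \<in> {0<..<1}"
  shows "norm (weight_pairing y1 y2 w1 w2 z) \<le> C"
proof -
  have z: "0 < z" "0 < 1 - z" using assms(3) by auto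
  have n: "norm (complex_of_real (1 - z)) = 1 - z" "norm (complex_of_real z) = z"
    unfolding norm_of_real using z by auto
  have "norm (y1 z * w1 z / of_real (1 - z)) \<le> C * z"
    using decay_products(1)[OF assms] z unfolding norm_divide n by (simp add: pos_divide_le_eq mult_ac)
  moreover have "norm (y2 z * w2 z / of_real z) \<le> C * (1 - z)"
    using decay_products(4)[OF assms] z unfolding norm_divide n by (simp add: pos_divide_le_eq mult_ac)
  ultimately have "norm (weight_pairing y1 y2 w1 w2 z) \<le> C * z + C * (1 - z)"
    unfolding weight_pairing_def by (rule norm_triangle_le[OF add_mono])
  also have "\<dots> = C" by (simp add: algebra_simps)
  finally show ?thesis .
qed

lemma wronskian_vanishes_at_endpoints:
  assumes "endpoint_decay C y1 y2" "endpoint_decay C w1 w2"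
  shows "((\<lambda>z. y1 z * w2 z - y2 z * w1 z) \<longlongrightarrow> 0) (at_right 0)"
    and "((\<lambda>z. y1 z * w2 z - y2 z * w1 z) \<longlongrightarrow> 0) (at_left 1)"
proof -
  have b: "norm (y1 z * w2 z - y2 z * w1 z) \<le> 2 * C * (z * (1 - z))" if "z \<in> {0<..<1}" for z
    using decay_products(2,3)[OF assms that] norm_triangle_ineq4[of "y1 z * w2 z" "y2 z * w1 z"] by linarith
  have l: "((\<lambda>z. 2 * C * (z * (1 - z))) \<longlongrightarrow> 0) (at_right 0)" "((\<lambda>z. 2 * C * (z * (1 - z))) \<longlongrightarrow> 0) (at_left 1)"
    by (auto intro!: tendsto_eq_intros)
  show "((\<lambda>z. y1 z * w2 z - y2 z * w1 z) \<longlongrightarrow> 0) (at_right 0)"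
    by (rule Lim_null_comparison[OF eventually_mono[OF eventually_at_right_real[of 0 1]] l(1)]) (use b in auto)
  show "((\<lambda>z. y1 z * w2 z - y2 z * w1 z) \<longlongrightarrow> 0) (at_left 1)"
    by (rule Lim_null_comparison[OF eventually_mono[OF eventually_at_left_real[of 0 1]] l(2)]) (use b in auto)
qed

lemma wronskian_integral:
  assumes y: "dirac_solution \<alpha> a b c l y1 y2" "endpoint_decay C y1 y2"
    and w: "dirac_solution \<alpha> a' b' c' l' w1 w2" "endpoint_decay C w1 w2"
  shows "((\<lambda>z. 2 * (b - b') * (y1 z * w2 z + y2 z * w1 z)
     + ((c - c' + (l - l')) / of_real z + 2 * (a - a' + (b\<^sup>2 - b'\<^sup>2))) * (y2 z * w2 z)
     + (l - l') / of_real (1 - z) * (y1 z * w1 z)) has_integral 0) {0<..<1}"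
  using FTC_open_interval[OF _ wronskian_derivative[OF y(1) w(1)] wronskian_vanishes_at_endpoints[OF y(2) w(2)]]
  by simp

text \<open>
  The operator is symmetric: the Wronskian of \<open>y\<close> and its conjugate vanishes at both endpoints, so
  the integral of its derivative, which is \<open>l - cnj l\<close> times the squared norm of \<open>y\<close>, is zero.
\<close>

lemma connection_zero_real:
  assumes \<alpha>: "\<alpha> \<ge> 1 / 2" and r: "a \<in> \<real>" "b \<in> \<real>" "c \<in> \<real>" and 0: "connection \<alpha> a b c l = 0"
  shows "l \<in> \<real>"
proof -
  define y1 y2 where "y1 = left1 \<alpha> a b c l" and "y2 = left2 \<alpha> a b c l"
  obtain K where K: "params_bounded K \<alpha> a b c l" using params_bounded_exists[OF \<alpha>] by blast
  obtain k where k: "k \<noteq> 0" "\<And>z. z \<in> {0<..<1} \<Longrightarrow> right1 \<alpha> a b c l z = k * left1 \<alpha> a b c l z"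
    "\<And>z. z \<in> {0<..<1} \<Longrightarrow> right2 \<alpha> a b c l z = k * left2 \<alpha> a b c l z"
    using connection_zero_imp_proportional[OF \<alpha> 0] by blast
  define C where "C = 2 * (local_bound K)\<^sup>2 * (1 + 1 / (norm k)\<^sup>2)"
  have d: "endpoint_decay C y1 y2" unfolding C_def y1_def y2_def by (rule left_endpoint_decay[OF K k])
  have d': "endpoint_decay C (\<lambda>z. cnj (y1 z)) (\<lambda>z. cnj (y2 z))" using d by (simp add: endpoint_decay_def)
  have s: "dirac_solution \<alpha> a b c l y1 y2" unfolding y1_def y2_def by (rule left_solution[OF \<alpha>])
  define N where "N = (\<lambda>z. (norm (y1 z))\<^sup>2 / (1 - z) + (norm (y2 z))\<^sup>2 / z)"
  have WN: "weight_pairing y1 y2 (\<lambda>z. cnj (y1 z)) (\<lambda>z. cnj (y2 z)) = (\<lambda>z. of_real (N z))"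
    unfolding weight_pairing_def N_def of_real_add of_real_divide complex_norm_square ..
  have cN: "continuous_on {0<..<1} N" unfolding N_def
    by (intro continuous_intros dirac_solution_continuous[OF s]) auto
  have bN: "N z \<le> C" "N z \<ge> 0" if "z \<in> {0<..<1}" for z
  proof -
    show "N z \<ge> 0" using that by (simp add: N_def)
    then show "N z \<le> C" using weight_pairing_bound[OF d d' that] unfolding WN by simp
  qed
  have h: "1 / 2 \<in> {0<..<1::real}" by simp
  have "N (1 / 2) > 0"
    using left_nonzero[OF \<alpha> h, of a b c l] by (auto simp: N_def y1_def y2_def add_pos_nonneg add_nonneg_pos)
  from integral_positive[OF cN bN h this] have I: "integral {0<..<1} N > 0" .
  have "N integrable_on {0<..<1}"
    by (rule bounded_continuous_integrable_on[OF cN, of C]) (use bN in auto)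
  then have "(N has_integral integral {0<..<1} N) {0<..<1}" by blast
  then have "((\<lambda>z. (l - cnj l) * of_real (N z)) has_integral (l - cnj l) * of_real (integral {0<..<1} N)) {0<..<1}"
    by (intro has_integral_mult_right has_integral_linear[OF _ bounded_linear_of_real, unfolded o_def])
  moreover have "((\<lambda>z. (l - cnj l) * of_real (N z)) has_integral 0) {0<..<1}"
    unfolding WN[symmetric, THEN fun_cong] weight_pairing_def
    by (rule has_integral_eq[OF _ wronskian_integral[OF s d dirac_solution_cnj[OF s r] d']])
       (simp add: divide_inverse algebra_simps)
  ultimately have "(l - cnj l) * of_real (integral {0<..<1} N) = 0" by (rule has_integral_unique)
  then have "cnj l = l" using I by simp
  then show ?thesis by (simp add: Reals_cnj_iff)
qed

section \<open>Dependence of the recessive solutions on the parameters\<close>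

lemma left_right_real:
  assumes "\<alpha> \<ge> 1 / 2" "a \<in> \<real>" "b \<in> \<real>" "c \<in> \<real>" "l \<in> \<real>" "z \<in> {0<..<1}"
  shows "left1 \<alpha> a b c l z \<in> \<real>" "left2 \<alpha> a b c l z \<in> \<real>" "right1 \<alpha> a b c l z \<in> \<real>" "right2 \<alpha> a b c l z \<in> \<real>"
proof -
  have n: "norm (complex_of_real z) < 1" "norm (complex_of_real (1 - z)) < 1"
    unfolding norm_of_real using assms(6) by auto
  show "left1 \<alpha> a b c l z \<in> \<real>" "left2 \<alpha> a b c l z \<in> \<real>" "right1 \<alpha> a b c l z \<in> \<real>" "right2 \<alpha> a b c l z \<in> \<real>"
    unfolding left1_def left2_def right1_def right2_def
    by (intro Reals_mult Reals_of_real ser_real Reals_add Reals_minus Reals_power Reals_numeral Reals_0 assms(1-5) n)+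
qed

text \<open>
  The parameters may follow any entire curve, so this covers holomorphy in each single parameter as
  well as along lines in parameter space.
\<close>

lemma solutions_entire:
  assumes \<alpha>: "\<alpha> \<ge> 1 / 2" and h: "a holomorphic_on UNIV" "b holomorphic_on UNIV" "c holomorphic_on UNIV" "l holomorphic_on UNIV"
    and z: "z \<in> {0<..<1}"
  shows "(\<lambda>x. left1 \<alpha> (a x) (b x) (c x) (l x) z) holomorphic_on UNIV"
    "(\<lambda>x. left2 \<alpha> (a x) (b x) (c x) (l x) z) holomorphic_on UNIV"
    "(\<lambda>x. right1 \<alpha> (a x) (b x) (c x) (l x) z) holomorphic_on UNIV"
    "(\<lambda>x. right2 \<alpha> (a x) (b x) (c x) (l x) z) holomorphic_on UNIV"
proof -
  have n: "norm (complex_of_real z) < 1" "norm (complex_of_real (1 - z)) < 1"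
    unfolding norm_of_real using z by auto
  have cont: "continuous_on UNIV a" "continuous_on UNIV b" "continuous_on UNIV c" "continuous_on UNIV l"
    using h holomorphic_on_imp_continuous_on by blast+
  have "\<exists>U. open U \<and> x \<in> U \<and> (\<lambda>x. left1 \<alpha> (a x) (b x) (c x) (l x) z) holomorphic_on U
    \<and> (\<lambda>x. left2 \<alpha> (a x) (b x) (c x) (l x) z) holomorphic_on U
    \<and> (\<lambda>x. right1 \<alpha> (a x) (b x) (c x) (l x) z) holomorphic_on U
    \<and> (\<lambda>x. right2 \<alpha> (a x) (b x) (c x) (l x) z) holomorphic_on U" for x
  proof -
    obtain K where K: "params_bounded K \<alpha> (a x) (b x) (c x) (l x)" using params_bounded_exists[OF \<alpha>] by blast
    define U where "U = {x. norm (c x + l x) < K + 1 \<and> norm (l x) < K + 1 \<and> norm (2 * b x) < K + 1 \<and> norm (2 * (a x + (b x)\<^sup>2)) < K + 1}"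
    have oU: "open U" unfolding U_def
      by (intro open_Collect_conj open_Collect_less continuous_intros cont)
    have xU: "x \<in> U" using K by (auto simp: U_def params_bounded_def)
    have pb: "params_bounded (K + 1) \<alpha> (a x) (b x) (c x) (l x)" if "x \<in> U" for x
      using that K by (auto simp: U_def params_bounded_def)
    have hU: "a holomorphic_on U" "b holomorphic_on U" "c holomorphic_on U" "l holomorphic_on U"
      using h holomorphic_on_subset by blast+
    have "(\<lambda>x. left1 \<alpha> (a x) (b x) (c x) (l x) z) holomorphic_on U
      \<and> (\<lambda>x. left2 \<alpha> (a x) (b x) (c x) (l x) z) holomorphic_on U
      \<and> (\<lambda>x. right1 \<alpha> (a x) (b x) (c x) (l x) z) holomorphic_on U
      \<and> (\<lambda>x. right2 \<alpha> (a x) (b x) (c x) (l x) z) holomorphic_on U"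
      unfolding left1_def left2_def right1_def right2_def
      by (intro conjI; intro holomorphic_on_mult holomorphic_on_const
          ser_holomorphic[OF params_bounded_frob(1)[OF pb] n(1) oU \<alpha>]
          ser_holomorphic[OF params_bounded_frob(2)[OF pb] n(2) oU \<alpha>] holomorphic_intros hU)
    then show ?thesis using oU xU by blast
  qed
  then show "(\<lambda>x. left1 \<alpha> (a x) (b x) (c x) (l x) z) holomorphic_on UNIV"
    "(\<lambda>x. left2 \<alpha> (a x) (b x) (c x) (l x) z) holomorphic_on UNIV"
    "(\<lambda>x. right1 \<alpha> (a x) (b x) (c x) (l x) z) holomorphic_on UNIV"
    "(\<lambda>x. right2 \<alpha> (a x) (b x) (c x) (l x) z) holomorphic_on UNIV"
    unfolding holomorphic_on_def[of _ UNIV] by (metis UNIV_I holomorphic_on_imp_differentiable_at)+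
qed

text \<open>
  Every parameter point has an open neighbourhood on which the parameters are bounded, and there the
  Frobenius series converge uniformly.
\<close>

lemma solutions_continuous:
  assumes \<alpha>: "\<alpha> \<ge> 1 / 2" and cont: "continuous_on S a" "continuous_on S b" "continuous_on S c" "continuous_on S l"
    and z: "z \<in> {0<..<1}"
  shows "continuous_on S (\<lambda>x. left1 \<alpha> (a x) (b x) (c x) (l x) z)"
    "continuous_on S (\<lambda>x. left2 \<alpha> (a x) (b x) (c x) (l x) z)"
    "continuous_on S (\<lambda>x. right1 \<alpha> (a x) (b x) (c x) (l x) z)"
    "continuous_on S (\<lambda>x. right2 \<alpha> (a x) (b x) (c x) (l x) z)"
proof -
  define r where "r = max z (1 - z)"
  have n: "norm (complex_of_real z) \<le> r" "norm (complex_of_real (1 - z)) \<le> r"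
    unfolding norm_of_real r_def using z by auto
  have r: "0 \<le> r" "r < 1" using z by (auto simp: r_def)
  define V where "V = (\<lambda>K. {x. norm (fst (snd (snd x)) + snd (snd (snd x)) :: complex) < K \<and> norm (snd (snd (snd x))) < K
     \<and> norm (2 * fst (snd x) :: complex) < K \<and> norm (2 * (fst x + (fst (snd x))\<^sup>2) :: complex) < K})"
  define f1 where "f1 = (\<lambda>x. left1 \<alpha> (fst x) (fst (snd x)) (fst (snd (snd x))) (snd (snd (snd x))) z)"
  define f2 where "f2 = (\<lambda>x. left2 \<alpha> (fst x) (fst (snd x)) (fst (snd (snd x))) (snd (snd (snd x))) z)"
  define g1 where "g1 = (\<lambda>x. right1 \<alpha> (fst x) (fst (snd x)) (fst (snd (snd x))) (snd (snd (snd x))) z)"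
  define g2 where "g2 = (\<lambda>x. right2 \<alpha> (fst x) (fst (snd x)) (fst (snd (snd x))) (snd (snd (snd x))) z)"
  have C: "isCont f1 x \<and> isCont f2 x \<and> isCont g1 x \<and> isCont g2 x" for x
  proof -
    obtain K where K: "params_bounded K \<alpha> (fst x) (fst (snd x)) (fst (snd (snd x))) (snd (snd (snd x)))"
      using params_bounded_exists[OF \<alpha>] by blast
    have oV: "open (V (K + 1))" unfolding V_def
      by (intro open_Collect_conj open_Collect_less continuous_intros)
    have xV: "x \<in> V (K + 1)" using K by (auto simp: V_def params_bounded_def)
    have pb: "params_bounded (K + 1) \<alpha> (fst x) (fst (snd x)) (fst (snd (snd x))) (snd (snd (snd x)))" if "x \<in> V (K + 1)" for x
      using that K by (auto simp: V_def params_bounded_def)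
    have "continuous_on (V (K + 1)) f1 \<and> continuous_on (V (K + 1)) f2 \<and> continuous_on (V (K + 1)) g1 \<and> continuous_on (V (K + 1)) g2"
      unfolding f1_def f2_def g1_def g2_def left1_def left2_def right1_def right2_def
      by (intro conjI; intro continuous_on_mult continuous_on_const
          ser_continuous[OF params_bounded_frob(1)[OF pb] n(1) r \<alpha>]
          ser_continuous[OF params_bounded_frob(2)[OF pb] n(2) r \<alpha>] continuous_intros)
    then show ?thesis using continuous_on_eq_continuous_at[OF oV] xV by blast
  qed
  have p: "continuous_on S (\<lambda>x. (a x, b x, c x, l x))" by (intro continuous_intros cont)
  have comp: "continuous_on S (\<lambda>x. f (a x, b x, c x, l x))" if "\<And>x. isCont f x" for f :: "complex \<times> complex \<times> complex \<times> complex \<Rightarrow> complex"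
    by (rule continuous_on_compose2[OF continuous_at_imp_continuous_on p, of UNIV]) (use that in auto)
  show "continuous_on S (\<lambda>x. left1 \<alpha> (a x) (b x) (c x) (l x) z)"
    using comp[of f1] C by (simp add: f1_def)
  show "continuous_on S (\<lambda>x. left2 \<alpha> (a x) (b x) (c x) (l x) z)"
    using comp[of f2] C by (simp add: f2_def)
  show "continuous_on S (\<lambda>x. right1 \<alpha> (a x) (b x) (c x) (l x) z)"
    using comp[of g1] C by (simp add: g1_def)
  show "continuous_on S (\<lambda>x. right2 \<alpha> (a x) (b x) (c x) (l x) z)"
    using comp[of g2] C by (simp add: g2_def)
qed

lemma solutions_tendsto:
  assumes \<alpha>: "\<alpha> \<ge> 1 / 2" and lim: "(a \<longlongrightarrow> a0) F" "(b \<longlongrightarrow> b0) F" "(c \<longlongrightarrow> c0) F" "(l \<longlongrightarrow> l0) F"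
    and z: "z \<in> {0<..<1}"
  shows "((\<lambda>x. left1 \<alpha> (a x) (b x) (c x) (l x) z) \<longlongrightarrow> left1 \<alpha> a0 b0 c0 l0 z) F"
    "((\<lambda>x. left2 \<alpha> (a x) (b x) (c x) (l x) z) \<longlongrightarrow> left2 \<alpha> a0 b0 c0 l0 z) F"
    "((\<lambda>x. right1 \<alpha> (a x) (b x) (c x) (l x) z) \<longlongrightarrow> right1 \<alpha> a0 b0 c0 l0 z) F"
    "((\<lambda>x. right2 \<alpha> (a x) (b x) (c x) (l x) z) \<longlongrightarrow> right2 \<alpha> a0 b0 c0 l0 z) F"
proof -
  have p: "((\<lambda>x. (a x, b x, c x, l x)) \<longlongrightarrow> (a0, b0, c0, l0)) F"
    by (intro tendsto_Pair lim)
  have c: "continuous_on UNIV (\<lambda>p::complex\<times>complex\<times>complex\<times>complex. fst p)"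
    "continuous_on UNIV (\<lambda>p::complex\<times>complex\<times>complex\<times>complex. fst (snd p))"
    "continuous_on UNIV (\<lambda>p::complex\<times>complex\<times>complex\<times>complex. fst (snd (snd p)))"
    "continuous_on UNIV (\<lambda>p::complex\<times>complex\<times>complex\<times>complex. snd (snd (snd p)))"
    by (intro continuous_intros)+
  note S = solutions_continuous[OF \<alpha> c z]
  show "((\<lambda>x. left1 \<alpha> (a x) (b x) (c x) (l x) z) \<longlongrightarrow> left1 \<alpha> a0 b0 c0 l0 z) F"
    using continuous_on_tendsto_compose[OF S(1) p] by simp
  show "((\<lambda>x. left2 \<alpha> (a x) (b x) (c x) (l x) z) \<longlongrightarrow> left2 \<alpha> a0 b0 c0 l0 z) F"
    using continuous_on_tendsto_compose[OF S(2) p] by simp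
  show "((\<lambda>x. right1 \<alpha> (a x) (b x) (c x) (l x) z) \<longlongrightarrow> right1 \<alpha> a0 b0 c0 l0 z) F"
    using continuous_on_tendsto_compose[OF S(3) p] by simp
  show "((\<lambda>x. right2 \<alpha> (a x) (b x) (c x) (l x) z) \<longlongrightarrow> right2 \<alpha> a0 b0 c0 l0 z) F"
    using continuous_on_tendsto_compose[OF S(4) p] by simp
qed

section \<open>Simplicity of the zeros\<close>

lemma real_square: "x \<in> \<real> \<Longrightarrow> x * x = complex_of_real ((norm x)\<^sup>2)"
  by (metis Reals_cnj_iff complex_norm_square)

text \<open>
  The limit is the integral of \<open>|x\<^sub>1|\<^sup>2 / (1 - z) + |x\<^sub>2|\<^sup>2 / z\<close>, taken by dominated convergence; this is
  positive because \<open>x\<close> is real and nonzero.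
\<close>

lemma weight_pairing_limit:
  assumes st: "{s<..<t} \<subseteq> {0<..<1}" and cx: "continuous_on {s<..<t} x1" "continuous_on {s<..<t} x2"
    and cX: "\<And>n. continuous_on {s<..<t} (X1 n)" "\<And>n. continuous_on {s<..<t} (X2 n)"
    and b: "\<And>n z. z \<in> {s<..<t} \<Longrightarrow> norm (weight_pairing x1 x2 (X1 n) (X2 n) z) \<le> M"
    and lim: "\<And>z. z \<in> {s<..<t} \<Longrightarrow> (\<lambda>n. X1 n z) \<longlonglongrightarrow> x1 z" "\<And>z. z \<in> {s<..<t} \<Longrightarrow> (\<lambda>n. X2 n z) \<longlonglongrightarrow> x2 z"
    and r: "\<And>z. z \<in> {s<..<t} \<Longrightarrow> x1 z \<in> \<real> \<and> x2 z \<in> \<real>"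
    and z0: "z0 \<in> {s<..<t}" "x1 z0 \<noteq> 0 \<or> x2 z0 \<noteq> 0"
  shows "\<exists>I>0. (\<lambda>n. integral {s<..<t} (weight_pairing x1 x2 (X1 n) (X2 n))) \<longlonglongrightarrow> complex_of_real I"
proof -
  define N where "N = (\<lambda>z. (norm (x1 z))\<^sup>2 / (1 - z) + (norm (x2 z))\<^sup>2 / z)"
  have ne: "1 - complex_of_real z \<noteq> 0" "complex_of_real z \<noteq> 0" if "z \<in> {s<..<t}" for z
    using that st by (metis greaterThanLessThan_iff less_irrefl of_real_1 of_real_diff of_real_eq_0_iff right_minus_eq subsetD)
      (use that st in auto)
  have xx: "weight_pairing x1 x2 x1 x2 z = of_real (N z)" if "z \<in> {s<..<t}" for z
    using r[OF that] unfolding weight_pairing_def N_def by (simp add: real_square)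
  have i: "weight_pairing x1 x2 (X1 n) (X2 n) integrable_on {s<..<t}" for n
    by (rule bounded_continuous_integrable_on[OF weight_pairing_continuous[OF cx cX st] b])
  have l: "(\<lambda>n. weight_pairing x1 x2 (X1 n) (X2 n) z) \<longlonglongrightarrow> of_real (N z)" if "z \<in> {s<..<t}" for z
    unfolding xx[OF that, symmetric] weight_pairing_def
    by (intro tendsto_intros lim that; use ne[OF that] in simp)
  have hM: "(\<lambda>z. M) integrable_on {s<..<t}" by (rule integrable_on_const) simp
  have L: "(\<lambda>n. integral {s<..<t} (weight_pairing x1 x2 (X1 n) (X2 n))) \<longlonglongrightarrow> integral {s<..<t} (\<lambda>z. complex_of_real (N z))"
    by (rule dominated_convergence(2)[OF i hM b l])
  have cN: "continuous_on {s<..<t} N" unfolding N_def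
    by (intro continuous_intros cx) (use st in auto)
  have bN: "N z \<le> M" if "z \<in> {s<..<t}" for z
  proof -
    have "norm (complex_of_real (N z)) \<le> M"
      by (rule LIMSEQ_le_const2[OF tendsto_norm[OF l[OF that]]]) (use b[OF that] in auto)
    then show ?thesis by simp
  qed
  have nN: "N z \<ge> 0" if "z \<in> {s<..<t}" for z using that st by (auto simp: N_def subset_iff intro!: add_nonneg_nonneg)
  have "N z0 > 0" using z0 st by (auto simp: N_def subset_iff add_pos_nonneg add_nonneg_pos)
  from integral_positive[OF cN bN nN z0(1) this] have I: "integral {s<..<t} N > 0" .
  have "N integrable_on {s<..<t}" by (rule bounded_continuous_integrable_on[OF cN, of M]) (use bN nN in auto)
  then have "(N has_integral integral {s<..<t} N) {s<..<t}" by blast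
  from has_integral_linear[OF this bounded_linear_of_real, unfolded o_def]
  have "integral {s<..<t} (\<lambda>z. complex_of_real (N z)) = of_real (integral {s<..<t} N)" by (rule integral_unique)
  then show ?thesis using L I by auto
qed

lemma product_sqrt_bound:
  assumes "norm (x::complex) \<le> B * sqrt w" "norm y \<le> B * sqrt w" "w \<ge> 0"
  shows "norm (x * y) \<le> B\<^sup>2 * w"
  by (rule product_bound_of_squares[OF square_bound[OF assms(1,3)] square_bound[OF assms(2,3)]])

lemma solution_isCont:
  assumes "dirac_solution \<alpha> a b c l y1 y2" "z \<in> {0<..<1}"
  shows "isCont y1 z" "isCont y2 z"
  using dirac_solution_continuous[OF assms(1)] assms(2) by (simp_all add: continuous_on_eq_continuous_at)

lemma weight_pairing_bound_near_endpoint: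
  assumes B: "norm (x1 z) \<le> B * sqrt w" "norm (x2 z) \<le> B * sqrt w" "norm (X1 z) \<le> B * sqrt w" "norm (X2 z) \<le> B * sqrt w"
    and w: "w \<ge> 0" "w \<le> z" "w \<le> 1 - z" and z: "z \<in> {0<..<1}"
  shows "norm (weight_pairing x1 x2 X1 X2 z) \<le> B\<^sup>2 + B\<^sup>2"
  unfolding weight_pairing_def
proof (rule norm_triangle_le[OF add_mono])
  have n: "norm (complex_of_real (1 - z)) = 1 - z" "norm (complex_of_real z) = z"
    unfolding norm_of_real using z by auto
  have 1: "norm (x1 z * X1 z) \<le> B\<^sup>2 * (1 - z)"
    using product_sqrt_bound[OF B(1,3) w(1)] mult_left_mono[OF w(3), of "B\<^sup>2"] by simp
  have 2: "norm (x2 z * X2 z) \<le> B\<^sup>2 * z"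
    using product_sqrt_bound[OF B(2,4) w(1)] mult_left_mono[OF w(2), of "B\<^sup>2"] by simp
  show "norm (x1 z * X1 z / of_real (1 - z)) \<le> B\<^sup>2" "norm (x2 z * X2 z / of_real z) \<le> B\<^sup>2"
    unfolding norm_divide n using 1 2 z by (simp_all add: pos_divide_le_eq)
qed

lemma wronskian_sqrt_bound:
  assumes B: "norm x1 \<le> B * sqrt w" "norm x2 \<le> B * sqrt w" "norm X1 \<le> B * sqrt w" "norm (X2::complex) \<le> B * sqrt w"
    and w: "w \<ge> 0"
  shows "norm (x1 * X2 - x2 * X1) \<le> 2 * B\<^sup>2 * w"
  using product_sqrt_bound[OF B(1,4) w] product_sqrt_bound[OF B(2,3) w] norm_triangle_ineq4[of "x1 * X2" "x2 * X1"]
  by linarith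

lemma connection_entire:
  assumes "\<alpha> \<ge> 1 / 2" "a holomorphic_on UNIV" "b holomorphic_on UNIV" "c holomorphic_on UNIV" "l holomorphic_on UNIV"
  shows "(\<lambda>x. connection \<alpha> (a x) (b x) (c x) (l x)) holomorphic_on UNIV"
  unfolding connection_def by (intro holomorphic_intros solutions_entire assms) auto

text \<open>
  Let \<open>x\<close> and \<open>r = k x\<close> be the recessive solutions at the eigenvalue \<open>l\<close>, and let \<open>X\<close> and \<open>R\<close> be those
  for a nearby value \<open>L\<close>. Write \<open>D\<close> for the Wronskian at the midpoint. The identity
  \<open>wronskian_derivative\<close>, integrated over the left and over the right half, gives
  \<open>D(x, X) = (l - L) A\<close> and \<open>D(r, R) = - (l - L) B\<close>, where \<open>A\<close> and \<open>B\<close> converge to positive numbers for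
  \<open>L \<rightarrow> l\<close>. The Pluecker relation \<open>D(x, \<xi>) D(X, R) = D(x, X) D(\<xi>, R) - D(x, R) D(\<xi>, X)\<close> with a fixed
  vector \<open>\<xi>\<close> combines them into the difference quotient of \<open>D(X, R)\<close>, which is the connection
  coefficient at \<open>L\<close>. Its limit is \<open>k lim A + lim B / k\<close>, and this is not zero because \<open>k\<close> is real.
\<close>

lemma connection_simple_zero:
  assumes \<alpha>: "\<alpha> \<ge> 1 / 2" and r: "a \<in> \<real>" "b \<in> \<real>" "c \<in> \<real>" and 0: "connection \<alpha> a b c l = 0"
  shows "deriv (connection \<alpha> a b c) l \<noteq> 0"
proof -
  have rl: "l \<in> \<real>" by (rule connection_zero_real[OF \<alpha> r 0])
  define h :: real where "h = 1 / 2"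
  have h: "h \<in> {0<..<1}" by (simp add: h_def)
  \<comment> \<open>a sequence of real values is enough, since the derivative is known to exist\<close>
  define L where "L = (\<lambda>n. l + of_real (inverse (real (Suc n))))"
  have Llim: "L \<longlonglongrightarrow> l"
    unfolding L_def by (rule tendsto_eq_intros tendsto_of_real LIMSEQ_inverse_real_of_nat refl | simp)+
  have Lne: "L n \<noteq> l" for n by (simp add: L_def del: of_nat_Suc)
  obtain K where K: "params_bounded K \<alpha> a b c l" using params_bounded_exists[OF \<alpha>] by blast
  have K1: "params_bounded (K + 1) \<alpha> a b c l" using K by (auto simp: params_bounded_def)
  have KL: "params_bounded (K + 1) \<alpha> a b c (L n)" for n
  proof -
    have 1: "norm (complex_of_real (inverse (real (Suc n)))) \<le> 1"
      unfolding norm_of_real by (simp add: inverse_eq_divide)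
    have "norm (c + L n) \<le> norm (c + l) + 1" "norm (L n) \<le> norm l + 1"
      unfolding L_def add.assoc[symmetric] by (rule order_trans[OF norm_triangle_ineq] add_left_mono 1)+
    then show ?thesis using K by (auto simp: params_bounded_def)
  qed
  obtain k where k: "k \<noteq> 0" "\<And>z. z \<in> {0<..<1} \<Longrightarrow> right1 \<alpha> a b c l z = k * left1 \<alpha> a b c l z"
    "\<And>z. z \<in> {0<..<1} \<Longrightarrow> right2 \<alpha> a b c l z = k * left2 \<alpha> a b c l z"
    using connection_zero_imp_proportional[OF \<alpha> 0] by blast
  define x1 x2 r1 r2 where "x1 = left1 \<alpha> a b c l" and "x2 = left2 \<alpha> a b c l"
    and "r1 = right1 \<alpha> a b c l" and "r2 = right2 \<alpha> a b c l"
  define X1 X2 R1 R2 where "X1 = (\<lambda>n. left1 \<alpha> a b c (L n))" and "X2 = (\<lambda>n. left2 \<alpha> a b c (L n))"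
    and "R1 = (\<lambda>n. right1 \<alpha> a b c (L n))" and "R2 = (\<lambda>n. right2 \<alpha> a b c (L n))"
  have sx: "dirac_solution \<alpha> a b c l x1 x2" and sr: "dirac_solution \<alpha> a b c l r1 r2"
    unfolding x1_def x2_def r1_def r2_def by (rule left_solution[OF \<alpha>] right_solution[OF \<alpha>])+
  have sX: "dirac_solution \<alpha> a b c (L n) (X1 n) (X2 n)" and sR: "dirac_solution \<alpha> a b c (L n) (R1 n) (R2 n)" for n
    unfolding X1_def X2_def R1_def R2_def by (rule left_solution[OF \<alpha>] right_solution[OF \<alpha>])+
  have limX1: "(\<lambda>n. X1 n z) \<longlonglongrightarrow> x1 z" and limX2: "(\<lambda>n. X2 n z) \<longlonglongrightarrow> x2 z"
    and limR1: "(\<lambda>n. R1 n z) \<longlonglongrightarrow> r1 z" and limR2: "(\<lambda>n. R2 n z) \<longlonglongrightarrow> r2 z" if "z \<in> {0<..<1}" for z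
    using solutions_tendsto[OF \<alpha> tendsto_const[of a] tendsto_const[of b] tendsto_const[of c] Llim that]
    unfolding X1_def X2_def R1_def R2_def x1_def x2_def r1_def r2_def by blast+
  define B where "B = local_bound (K + 1)"
  have bx: "norm (x1 z) \<le> B * sqrt z" "norm (x2 z) \<le> B * sqrt z" "norm (X1 n z) \<le> B * sqrt z" "norm (X2 n z) \<le> B * sqrt z"
    if "z \<in> {0<..<h}" for z n
    unfolding x1_def x2_def X1_def X2_def B_def
    by (rule left_bound[OF K1] left_bound[OF KL]; use that h_def in simp)+
  have br: "norm (r1 z) \<le> B * sqrt (1 - z)" "norm (r2 z) \<le> B * sqrt (1 - z)"
    "norm (R1 n z) \<le> B * sqrt (1 - z)" "norm (R2 n z) \<le> B * sqrt (1 - z)"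
    if "z \<in> {h<..<1}" for z n
    unfolding r1_def r2_def R1_def R2_def B_def
    by (rule right_bound[OF K1] right_bound[OF KL]; use that h_def in simp)+
  have sub: "{0<..<h} \<subseteq> {0<..<1}" "{h<..<1} \<subseteq> {0<..<1}" by (auto simp: h_def)
  have bxX: "norm (weight_pairing x1 x2 (X1 n) (X2 n) z) \<le> B\<^sup>2 + B\<^sup>2" if z: "z \<in> {0<..<h}" for z n
    by (rule weight_pairing_bound_near_endpoint[of x1 z B z x2 "X1 n" "X2 n", OF bx[OF z]]) (use z in \<open>auto simp: h_def\<close>)
  have brR: "norm (weight_pairing r1 r2 (R1 n) (R2 n) z) \<le> B\<^sup>2 + B\<^sup>2" if z: "z \<in> {h<..<1}" for z n
    by (rule weight_pairing_bound_near_endpoint[of r1 z B "1 - z" r2 "R1 n" "R2 n", OF br[OF z]]) (use z in \<open>auto simp: h_def\<close>)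
  note rr = left_right_real[OF \<alpha> r rl, folded x1_def x2_def r1_def r2_def]
  define An where "An = (\<lambda>n. integral {0<..<h} (weight_pairing x1 x2 (X1 n) (X2 n)))"
  define Bn where "Bn = (\<lambda>n. integral {h<..<1} (weight_pairing r1 r2 (R1 n) (R2 n)))"
  note cx = dirac_solution_continuous[OF sx, THEN continuous_on_subset, OF sub(1)]
    and cX = dirac_solution_continuous[OF sX, THEN continuous_on_subset, OF sub(1)]
    and cr = dirac_solution_continuous[OF sr, THEN continuous_on_subset, OF sub(2)]
    and cR = dirac_solution_continuous[OF sR, THEN continuous_on_subset, OF sub(2)]
  have "\<exists>I>0. An \<longlonglongrightarrow> complex_of_real I" unfolding An_def
  proof (rule weight_pairing_limit[OF sub(1) cx cX bxX])
    show "h / 2 \<in> {0<..<h}" using h by simp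
    show "x1 (h / 2) \<noteq> 0 \<or> x2 (h / 2) \<noteq> 0" unfolding x1_def x2_def by (rule left_nonzero[OF \<alpha>]) (simp add: h_def)
    fix z assume "z \<in> {0<..<h}"
    then have z: "z \<in> {0<..<1}" using sub by blast
    show "(\<lambda>n. X1 n z) \<longlonglongrightarrow> x1 z" "(\<lambda>n. X2 n z) \<longlonglongrightarrow> x2 z" by (rule limX1[OF z] limX2[OF z])+
    show "x1 z \<in> \<real> \<and> x2 z \<in> \<real>" using rr(1,2)[OF z] by blast
  qed
  then obtain I1 where I1: "I1 > 0" "An \<longlonglongrightarrow> complex_of_real I1" by blast
  have "\<exists>I>0. Bn \<longlonglongrightarrow> complex_of_real I" unfolding Bn_def
  proof (rule weight_pairing_limit[OF sub(2) cr cR brR])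
    show "3 / 4 \<in> {h<..<1}" by (simp add: h_def)
    show "r1 (3 / 4) \<noteq> 0 \<or> r2 (3 / 4) \<noteq> 0" unfolding r1_def r2_def by (rule right_nonzero[OF \<alpha>]) simp
    fix z assume "z \<in> {h<..<1}"
    then have z: "z \<in> {0<..<1}" using sub by blast
    show "(\<lambda>n. R1 n z) \<longlonglongrightarrow> r1 z" "(\<lambda>n. R2 n z) \<longlonglongrightarrow> r2 z" by (rule limR1[OF z] limR2[OF z])+
    show "r1 z \<in> \<real> \<and> r2 z \<in> \<real>" using rr(3,4)[OF z] by blast
  qed
  then obtain I2 where I2: "I2 > 0" "Bn \<longlonglongrightarrow> complex_of_real I2" by blast
  have wX: "((\<lambda>z. x1 z * X2 n z - x2 z * X1 n z) has_vector_derivative (l - L n) * weight_pairing x1 x2 (X1 n) (X2 n) z) (at z)"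
    if "z \<in> {0<..<1}" for n z
    by (rule has_vector_derivative_eq_rhs[OF wronskian_derivative[OF sx sX that]]) (simp add: weight_pairing_def algebra_simps divide_inverse)
  have wR: "((\<lambda>z. r1 z * R2 n z - r2 z * R1 n z) has_vector_derivative (l - L n) * weight_pairing r1 r2 (R1 n) (R2 n) z) (at z)"
    if "z \<in> {0<..<1}" for n z
    by (rule has_vector_derivative_eq_rhs[OF wronskian_derivative[OF sr sR that]]) (simp add: weight_pairing_def algebra_simps divide_inverse)
  have iX: "weight_pairing x1 x2 (X1 n) (X2 n) integrable_on {0<..<h}" for n
    by (rule bounded_continuous_integrable_on[OF weight_pairing_continuous[OF cx cX sub(1)] bxX])
  have iR: "weight_pairing r1 r2 (R1 n) (R2 n) integrable_on {h<..<1}" for n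
    by (rule bounded_continuous_integrable_on[OF weight_pairing_continuous[OF cr cR sub(2)] brR])
  have DX: "x1 h * X2 n h - x2 h * X1 n h = (l - L n) * An n" for n
  proof -
    have t0: "((\<lambda>z. x1 z * X2 n z - x2 z * X1 n z) \<longlongrightarrow> 0) (at_right 0)"
    proof (rule Lim_null_comparison[OF eventually_mono[OF eventually_at_right_real[of 0 h]]])
      show "norm (x1 z * X2 n z - x2 z * X1 n z) \<le> 2 * B\<^sup>2 * z" if "z \<in> {0<..<h}" for z
        by (rule wronskian_sqrt_bound[OF bx[OF that]]) (use that in auto)
      show "((\<lambda>z. 2 * B\<^sup>2 * z) \<longlongrightarrow> 0) (at_right 0)" by (auto intro!: tendsto_eq_intros)
    qed (use h in auto)
    have "isCont (\<lambda>z. x1 z * X2 n z - x2 z * X1 n z) h"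
      by (intro continuous_intros solution_isCont[OF sx h] solution_isCont[OF sX h])
    then have t1: "((\<lambda>z. x1 z * X2 n z - x2 z * X1 n z) \<longlongrightarrow> x1 h * X2 n h - x2 h * X1 n h) (at_left h)"
      unfolding isCont_def by (rule tendsto_within_subset) simp
    have "((\<lambda>z. (l - L n) * weight_pairing x1 x2 (X1 n) (X2 n) z) has_integral x1 h * X2 n h - x2 h * X1 n h - 0) {0<..<h}"
      by (rule FTC_open_interval[OF _ wX t0 t1]) (use h sub in auto)
    moreover have "((\<lambda>z. (l - L n) * weight_pairing x1 x2 (X1 n) (X2 n) z) has_integral (l - L n) * An n) {0<..<h}"
      unfolding An_def by (intro has_integral_mult_right integrable_integral iX)
    ultimately have "x1 h * X2 n h - x2 h * X1 n h - 0 = (l - L n) * An n" by (rule has_integral_unique)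
    then show ?thesis by simp
  qed
  have DR: "r1 h * R2 n h - r2 h * R1 n h = - ((l - L n) * Bn n)" for n
  proof -
    have t0: "((\<lambda>z. r1 z * R2 n z - r2 z * R1 n z) \<longlongrightarrow> 0) (at_left 1)"
    proof (rule Lim_null_comparison[OF eventually_mono[OF eventually_at_left_real[of h 1]]])
      show "norm (r1 z * R2 n z - r2 z * R1 n z) \<le> 2 * B\<^sup>2 * (1 - z)" if "z \<in> {h<..<1}" for z
        by (rule wronskian_sqrt_bound[OF br[OF that]]) (use that in auto)
      show "((\<lambda>z. 2 * B\<^sup>2 * (1 - z)) \<longlongrightarrow> 0) (at_left 1)" by (auto intro!: tendsto_eq_intros)
    qed (use h in auto)
    have "isCont (\<lambda>z. r1 z * R2 n z - r2 z * R1 n z) h"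
      by (intro continuous_intros solution_isCont[OF sr h] solution_isCont[OF sR h])
    then have t1: "((\<lambda>z. r1 z * R2 n z - r2 z * R1 n z) \<longlongrightarrow> r1 h * R2 n h - r2 h * R1 n h) (at_right h)"
      unfolding isCont_def by (rule tendsto_within_subset) simp
    have "((\<lambda>z. (l - L n) * weight_pairing r1 r2 (R1 n) (R2 n) z) has_integral 0 - (r1 h * R2 n h - r2 h * R1 n h)) {h<..<1}"
      by (rule FTC_open_interval[OF _ wR t1 t0]) (use h sub in auto)
    moreover have "((\<lambda>z. (l - L n) * weight_pairing r1 r2 (R1 n) (R2 n) z) has_integral (l - L n) * Bn n) {h<..<1}"
      unfolding Bn_def by (intro has_integral_mult_right integrable_integral iR)
    ultimately have "0 - (r1 h * R2 n h - r2 h * R1 n h) = (l - L n) * Bn n" by (rule has_integral_unique)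
    then show ?thesis by (simp add: algebra_simps)
  qed
  \<comment> \<open>the fixed vector is \<open>\<xi> = (- x2, x1)\<close> at the midpoint, so that \<open>D(x, \<xi>) = s\<close>\<close>
  define s where "s = x1 h * x1 h + x2 h * x2 h"
  have xh: "x1 h \<noteq> 0 \<or> x2 h \<noteq> 0" unfolding x1_def x2_def by (rule left_nonzero[OF \<alpha> h])
  have "s = of_real ((norm (x1 h))\<^sup>2 + (norm (x2 h))\<^sup>2)" using rr[OF h] by (simp add: s_def real_square)
  moreover have "(norm (x1 h))\<^sup>2 + (norm (x2 h))\<^sup>2 > 0" using xh by (auto simp: add_pos_nonneg add_nonneg_pos)
  ultimately have s: "s \<noteq> 0" by (metis less_irrefl of_real_eq_0_iff)
  have rk: "r1 h = k * x1 h" "r2 h = k * x2 h" using k(2,3)[OF h] by (auto simp: x1_def x2_def r1_def r2_def)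
  have "k = r1 h / x1 h \<or> k = r2 h / x2 h" using xh rk by auto
  then have kr: "k \<in> \<real>" using rr[OF h] by auto
  have quot: "(connection \<alpha> a b c (L n) - connection \<alpha> a b c l) / (L n - l)
     = - (An n * (- x2 h * R2 n h - x1 h * R1 n h) + Bn n / k * (- x2 h * X2 n h - x1 h * X1 n h)) / s" for n
  proof -
    have Dc: "connection \<alpha> a b c (L n) = X1 n h * R2 n h - X2 n h * R1 n h"
      by (simp add: connection_def X1_def X2_def R1_def R2_def h_def)
    have "k * (x1 h * R2 n h - x2 h * R1 n h) = - ((l - L n) * Bn n)"
      using DR[of n] unfolding rk by (simp add: algebra_simps)
    then have xR: "x1 h * R2 n h - x2 h * R1 n h = - ((l - L n) * (Bn n / k))"
      using k(1) by (simp add: field_simps)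
    have "s * connection \<alpha> a b c (L n) = (x1 h * X2 n h - x2 h * X1 n h) * (- x2 h * R2 n h - x1 h * R1 n h)
        - (x1 h * R2 n h - x2 h * R1 n h) * (- x2 h * X2 n h - x1 h * X1 n h)"
      unfolding Dc s_def by (simp add: algebra_simps)
    also have "\<dots> = (l - L n) * (An n * (- x2 h * R2 n h - x1 h * R1 n h) + Bn n / k * (- x2 h * X2 n h - x1 h * X1 n h))"
      unfolding DX xR by (simp add: divide_inverse algebra_simps)
    finally have e: "s * connection \<alpha> a b c (L n) = (l - L n) * (An n * (- x2 h * R2 n h - x1 h * R1 n h) + Bn n / k * (- x2 h * X2 n h - x1 h * X1 n h))" .
    have cancel: "x * Z / (s * y) = - Z / s" if "x = - y" "y \<noteq> 0" "s \<noteq> 0" for x y Z s :: complex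
      using that by simp
    have neg: "l - L n = - (L n - l)" "L n - l \<noteq> 0" using Lne[of n] by simp_all
    have "(connection \<alpha> a b c (L n) - connection \<alpha> a b c l) / (L n - l) = s * connection \<alpha> a b c (L n) / (s * (L n - l))"
      using 0 s by simp
    also have "\<dots> = - (An n * (- x2 h * R2 n h - x1 h * R1 n h) + Bn n / k * (- x2 h * X2 n h - x1 h * X1 n h)) / s"
      unfolding e by (rule cancel) (use neg s in auto)
    finally show ?thesis .
  qed
  have "(\<lambda>n. (connection \<alpha> a b c (L n) - connection \<alpha> a b c l) / (L n - l)) \<longlonglongrightarrow>
    - (of_real I1 * (- x2 h * r2 h - x1 h * r1 h) + of_real I2 / k * (- x2 h * x2 h - x1 h * x1 h)) / s"
    unfolding quot by (intro tendsto_intros I1(2) I2(2) limX1 limX2 limR1 limR2 h s k(1))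
  also have "- (of_real I1 * (- x2 h * r2 h - x1 h * r1 h) + of_real I2 / k * (- x2 h * x2 h - x1 h * x1 h)) / s
      = (of_real I1 * k + of_real I2 / k)"
  proof -
    have eqs: "- x2 h * r2 h - x1 h * r1 h = - k * s" "- x2 h * x2 h - x1 h * x1 h = - s"
      unfolding rk s_def by (simp_all add: algebra_simps)
    have "- (of_real I1 * (- k * s) + of_real I2 / k * (- s)) = (of_real I1 * k + of_real I2 / k) * s"
      by (simp add: algebra_simps)
    then show ?thesis unfolding eqs using s by simp
  qed
  finally have lim1: "(\<lambda>n. (connection \<alpha> a b c (L n) - connection \<alpha> a b c l) / (L n - l)) \<longlonglongrightarrow> of_real I1 * k + of_real I2 / k" .
  have "(\<lambda>x. connection \<alpha> a b c x) holomorphic_on UNIV"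
    by (rule connection_entire[OF \<alpha>]) (auto intro: holomorphic_intros)
  then have "(connection \<alpha> a b c has_field_derivative deriv (connection \<alpha> a b c) l) (at l)"
    using holomorphic_derivI[of _ UNIV] by blast
  then have "((\<lambda>x. (connection \<alpha> a b c x - connection \<alpha> a b c l) / (x - l)) \<longlongrightarrow> deriv (connection \<alpha> a b c) l) (at l)"
    by (simp add: has_field_derivative_iff)
  moreover have "filterlim L (at l) sequentially"
    using Llim Lne by (simp add: filterlim_at)
  ultimately have "(\<lambda>n. (connection \<alpha> a b c (L n) - connection \<alpha> a b c l) / (L n - l)) \<longlonglongrightarrow> deriv (connection \<alpha> a b c) l"
    by (rule filterlim_compose)
  then have d: "deriv (connection \<alpha> a b c) l = of_real I1 * k + of_real I2 / k"
    using lim1 LIMSEQ_unique by blast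
  have "k * (of_real I1 * k + of_real I2 / k) = of_real I1 * (k * k) + of_real I2"
    using k(1) by (simp add: algebra_simps)
  also have "\<dots> = of_real (I1 * (norm k)\<^sup>2 + I2)" using kr by (simp add: real_square)
  also have "\<dots> \<noteq> 0"
  proof -
    have "I1 * (norm k)\<^sup>2 + I2 > 0" using I1 I2 by (simp add: add_nonneg_pos)
    then show ?thesis by (metis less_irrefl of_real_eq_0_iff)
  qed
  finally show ?thesis unfolding d by auto
qed

section \<open>Simple roots of functions that depend on parameters\<close>

lemma circle_integral_continuous:
  fixes F :: "'a::topological_space \<Rightarrow> complex \<Rightarrow> complex"
  assumes r: "r \<ge> 0" and c: "continuous_on (S \<times> sphere z0 r) (\<lambda>(p, \<zeta>). F p \<zeta>)"
  shows "continuous_on S (\<lambda>p. contour_integral (circlepath z0 r) (F p))"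
  unfolding contour_integral_integral vector_derivative_circlepath box_real(2)[symmetric]
proof (rule integral_continuous_on_param)
  have "continuous_on (S \<times> cbox 0 1) (\<lambda>(p, t). (p, circlepath z0 r t))"
    unfolding case_prod_beta circlepath by (intro continuous_intros)
  moreover have "(\<lambda>(p, t). (p, circlepath z0 r t)) ` (S \<times> cbox 0 1) \<subseteq> S \<times> sphere z0 r"
    using path_image_circlepath_nonneg[OF r, of z0] by (auto simp: path_image_def image_iff)
  ultimately have "continuous_on (S \<times> cbox 0 1) (\<lambda>x. (\<lambda>(p, \<zeta>). F p \<zeta>) ((\<lambda>(p, t). (p, circlepath z0 r t)) x))"
    by (rule continuous_on_compose2[OF c])
  then have *: "continuous_on (S \<times> cbox 0 1) (\<lambda>x. F (fst x) (circlepath z0 r (snd x)))"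
    by (simp add: case_prod_beta)
  show "continuous_on (S \<times> cbox 0 1) (\<lambda>(p, t). F p (circlepath z0 r t) * (complex_of_real (2 * pi) * \<i> * of_real r * exp (2 * of_real pi * \<i> * of_real t)))"
    unfolding case_prod_beta by (intro continuous_intros *)
qed

text \<open>
  Morera's theorem: the integral over a triangle may be interchanged with the one over the circle,
  and the inner integral vanishes by Cauchy's theorem.
\<close>

lemma circle_integral_holomorphic:
  fixes F :: "complex \<Rightarrow> complex \<Rightarrow> complex"
  assumes r: "r \<ge> 0" and S: "open S" and c: "continuous_on (S \<times> sphere z0 r) (\<lambda>(w, \<zeta>). F w \<zeta>)"
    and h: "\<And>\<zeta>. \<zeta> \<in> sphere z0 r \<Longrightarrow> (\<lambda>w. F w \<zeta>) holomorphic_on S"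
  shows "(\<lambda>w. contour_integral (circlepath z0 r) (F w)) holomorphic_on S"
proof -
  let ?I = "\<lambda>w. contour_integral (circlepath z0 r) (F w)"
  have pi: "path_image (circlepath z0 r) = sphere z0 r" by (rule path_image_circlepath_nonneg[OF r])
  have cvd: "continuous_on {0..1} (\<lambda>t. vector_derivative (circlepath z0 r) (at t))"
    unfolding vector_derivative_circlepath by (intro continuous_intros)
  have swap: "contour_integral (linepath a b) ?I = contour_integral (circlepath z0 r) (\<lambda>\<zeta>. contour_integral (linepath a b) (\<lambda>w. F w \<zeta>))"
    if "closed_segment a b \<subseteq> S" for a b
  proof (rule contour_integral_swap)
    show "continuous_on (path_image (linepath a b) \<times> path_image (circlepath z0 r)) (\<lambda>(y1, y2). F y1 y2)"
      by (rule continuous_on_subset[OF c]) (use that pi in auto)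
  qed (use cvd in auto)
  have ci: "(\<lambda>\<zeta>. contour_integral (linepath a b) (\<lambda>w. F w \<zeta>)) contour_integrable_on circlepath z0 r"
    if "closed_segment a b \<subseteq> S" for a b
  proof (rule contour_integrable_continuous_circlepath)
    have "continuous_on (sphere z0 r) (\<lambda>\<zeta>. integral (cbox 0 1) (\<lambda>t. F (linepath a b t) \<zeta> * (b - a)))"
    proof (rule integral_continuous_on_param)
      have "continuous_on (sphere z0 r \<times> cbox 0 1) (\<lambda>x. (\<lambda>(w, \<zeta>). F w \<zeta>) (linepath a b (snd x), fst x))"
      proof (rule continuous_on_compose2[OF c])
        show "continuous_on (sphere z0 r \<times> cbox 0 1) (\<lambda>x. (linepath a b (snd x), fst x))"
          unfolding linepath_def by (intro continuous_intros)
        show "(\<lambda>x. (linepath a b (snd x), fst x)) ` (sphere z0 r \<times> cbox 0 1) \<subseteq> S \<times> sphere z0 r"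
          using that linepath_in_path[of _ a b] by fastforce
      qed
      then show "continuous_on (sphere z0 r \<times> cbox 0 1) (\<lambda>(\<zeta>, t). F (linepath a b t) \<zeta> * (b - a))"
        unfolding case_prod_beta by (intro continuous_intros) simp
    qed
    then show "continuous_on (path_image (circlepath z0 r)) (\<lambda>\<zeta>. contour_integral (linepath a b) (\<lambda>w. F w \<zeta>))"
      unfolding pi contour_integral_integral vector_derivative_linepath_at box_real(2) by simp
  qed
  have "?I analytic_on S"
  proof (rule Morera_triangle[OF circle_integral_continuous[OF r c] S], intro impI)
    fix a b d assume tri: "convex hull {a, b, d} \<subseteq> S"
    have seg: "closed_segment a b \<subseteq> S" "closed_segment b d \<subseteq> S" "closed_segment d a \<subseteq> S"
      unfolding segment_convex_hull by (rule order_trans[OF hull_mono tri]; simp)+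
    have "contour_integral (linepath a b) ?I + contour_integral (linepath b d) ?I + contour_integral (linepath d a) ?I
      = contour_integral (circlepath z0 r) (\<lambda>\<zeta>. contour_integral (linepath a b) (\<lambda>w. F w \<zeta>)
         + contour_integral (linepath b d) (\<lambda>w. F w \<zeta>) + contour_integral (linepath d a) (\<lambda>w. F w \<zeta>))"
      unfolding swap[OF seg(1)] swap[OF seg(2)] swap[OF seg(3)]
      using ci[OF seg(1)] ci[OF seg(2)] ci[OF seg(3)] by (simp add: contour_integral_add contour_integrable_add)
    also have "\<dots> = contour_integral (circlepath z0 r) (\<lambda>\<zeta>. 0)"
    proof (rule contour_integral_cong[OF refl])
      fix \<zeta> assume "\<zeta> \<in> path_image (circlepath z0 r)"
      then have hol: "(\<lambda>w. F w \<zeta>) holomorphic_on convex hull {a, b, d}"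
        using h pi holomorphic_on_subset tri by blast
      have "((\<lambda>w. F w \<zeta>) has_contour_integral 0) (linepath a b +++ linepath b d +++ linepath d a)"
        by (rule Cauchy_theorem_triangle[OF hol])
      then show "contour_integral (linepath a b) (\<lambda>w. F w \<zeta>) + contour_integral (linepath b d) (\<lambda>w. F w \<zeta>) + contour_integral (linepath d a) (\<lambda>w. F w \<zeta>) = 0"
        using has_chain_integral_chain_integral3 by blast
    qed
    finally show "contour_integral (linepath a b) ?I + contour_integral (linepath b d) ?I + contour_integral (linepath d a) ?I = 0" by simp
  qed
  then show ?thesis by (rule analytic_imp_holomorphic)
qed

text \<open>
  Factor \<open>G l = (l - w) g l\<close> with \<open>g\<close> free of zeros and apply Cauchy's formula to \<open>1 / g\<close> and \<open>l / g\<close>. The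
  derivative of \<open>G\<close> cancels in the quotient, so the formula expresses the root through values of \<open>G\<close>
  on the circle only.
\<close>

lemma simple_root_contour_formula:
  assumes G: "G holomorphic_on UNIV" and \<sigma>: "\<sigma> > 0" and w: "w \<in> ball l0 \<sigma>" "G w = 0" "deriv G w \<noteq> 0"
    and uniq: "\<And>l. l \<in> cball l0 \<sigma> \<Longrightarrow> G l = 0 \<Longrightarrow> l = w"
  shows "contour_integral (circlepath l0 \<sigma>) (\<lambda>l. 1 / G l) \<noteq> 0"
    and "w = contour_integral (circlepath l0 \<sigma>) (\<lambda>l. l / G l) / contour_integral (circlepath l0 \<sigma>) (\<lambda>l. 1 / G l)"
proof -
  define g where "g = (\<lambda>l. if l = w then deriv G w else (G l - G w) / (l - w))"
  have gh: "g holomorphic_on UNIV" unfolding g_def by (rule pole_lemma[OF G]) simp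
  have g0: "g l \<noteq> 0" if "l \<in> cball l0 \<sigma>" for l
  proof (cases "l = w")
    case True
    then show ?thesis using w(3) by (simp add: g_def)
  next
    case False
    then have "G l \<noteq> 0" using uniq[OF that] by blast
    then show ?thesis using False w(2) by (simp add: g_def)
  qed
  have I: "((\<lambda>l. f l / G l) has_contour_integral 2 * of_real pi * \<i> * (f w / deriv G w)) (circlepath l0 \<sigma>)"
    if f: "f holomorphic_on UNIV" for f
  proof -
    have hq: "(\<lambda>l. f l / g l) holomorphic_on cball l0 \<sigma>"
      by (rule holomorphic_on_divide[OF holomorphic_on_subset[OF f] holomorphic_on_subset[OF gh] g0]) auto
    have "((\<lambda>u. (f u / g u) / (u - w)) has_contour_integral 2 * of_real pi * \<i> * (f w / g w)) (circlepath l0 \<sigma>)"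
    proof (rule Cauchy_integral_circlepath)
      show "continuous_on (cball l0 \<sigma>) (\<lambda>l. f l / g l)" using hq holomorphic_on_imp_continuous_on by blast
      show "(\<lambda>l. f l / g l) holomorphic_on ball l0 \<sigma>" using hq holomorphic_on_subset ball_subset_cball by blast
      show "norm (w - l0) < \<sigma>" using w(1) by (simp add: dist_norm norm_minus_commute)
    qed
    then have "((\<lambda>l. f l / G l) has_contour_integral 2 * of_real pi * \<i> * (f w / g w)) (circlepath l0 \<sigma>)"
    proof (rule has_contour_integral_eq)
      fix x assume "x \<in> path_image (circlepath l0 \<sigma>)"
      then have "dist l0 x = \<sigma>" using \<sigma> by (simp add: path_image_circlepath_nonneg)
      then have "x \<noteq> w" using w(1) by auto
      then show "f x / g x / (x - w) = f x / G x" using w(2) by (simp add: g_def)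
    qed
    then show ?thesis by (simp add: g_def)
  qed
  have D: "contour_integral (circlepath l0 \<sigma>) (\<lambda>l. 1 / G l) = 2 * of_real pi * \<i> * (1 / deriv G w)"
    using contour_integral_unique[OF I[OF holomorphic_on_const[of 1]]] by simp
  have N: "contour_integral (circlepath l0 \<sigma>) (\<lambda>l. l / G l) = 2 * of_real pi * \<i> * (w / deriv G w)"
    using contour_integral_unique[OF I[OF holomorphic_on_ident]] by simp
  show "contour_integral (circlepath l0 \<sigma>) (\<lambda>l. 1 / G l) \<noteq> 0" unfolding D using w(3) by simp
  show "w = contour_integral (circlepath l0 \<sigma>) (\<lambda>l. l / G l) / contour_integral (circlepath l0 \<sigma>) (\<lambda>l. 1 / G l)"
  proof -
    have "x * (w / y) / (x * (1 / y)) = w" if "x \<noteq> 0" "y \<noteq> 0" for x y :: complex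
      using that by simp
    from this[OF _ w(3), of "2 * of_real pi * \<i>"] show ?thesis unfolding D N by simp
  qed
qed

text \<open>
  The simplified Newton map \<open>l \<mapsto> l - G l / d\<close> has derivative of norm at most \<open>1 / 2\<close> and moves the
  centre by at most \<open>\<sigma> / 4\<close>, so it is a contraction of the disc into its interior.
\<close>

lemma nearly_linear_has_unique_root:
  fixes G :: "complex \<Rightarrow> complex"
  assumes G: "G holomorphic_on UNIV" and \<sigma>: "\<sigma> > 0" and d: "d \<noteq> 0"
    and der: "\<And>l. l \<in> cball l0 \<sigma> \<Longrightarrow> norm (deriv G l - d) \<le> norm d / 2"
    and small: "norm (G l0) \<le> norm d * \<sigma> / 4"
  shows "\<exists>!w. w \<in> cball l0 \<sigma> \<and> G w = 0" and "\<And>w. w \<in> cball l0 \<sigma> \<Longrightarrow> G w = 0 \<Longrightarrow> w \<in> ball l0 \<sigma> \<and> deriv G w \<noteq> 0"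
proof -
  have nd: "norm d > 0" using d by simp
  define T where "T = (\<lambda>l. l - G l / d)"
  have lin: "norm (T x - T y) \<le> 1 / 2 * norm (x - y)" if "x \<in> cball l0 \<sigma>" "y \<in> cball l0 \<sigma>" for x y
  proof (rule field_differentiable_bound[OF convex_cball[of l0 \<sigma>]])
    fix z assume z: "z \<in> cball l0 \<sigma>"
    have "(G has_field_derivative deriv G z) (at z)" using holomorphic_derivI[OF G, of z] by simp
    then have "(T has_field_derivative (1 - deriv G z / d)) (at z)"
      unfolding T_def by (intro DERIV_diff DERIV_ident DERIV_cdivide)
    then show "(T has_field_derivative (1 - deriv G z / d)) (at z within cball l0 \<sigma>)"
      by (rule has_field_derivative_at_within)
    have "1 - deriv G z / d = - ((deriv G z - d) / d)" using d by (simp add: field_simps)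
    then have "norm (1 - deriv G z / d) = norm (deriv G z - d) / norm d" by (simp add: norm_divide)
    also have "\<dots> \<le> (norm d / 2) / norm d" by (intro divide_right_mono der z) simp
    also have "\<dots> = 1 / 2" using nd by simp
    finally show "norm (1 - deriv G z / d) \<le> 1 / 2" .
  qed (use that in auto)
  have near: "norm (T x - l0) \<le> 3 / 4 * \<sigma>" if x: "x \<in> cball l0 \<sigma>" for x
  proof -
    have "T x - l0 = (T x - T l0) - G l0 / d" by (simp add: T_def)
    then have "norm (T x - l0) \<le> norm (T x - T l0) + norm (G l0 / d)" by (metis norm_triangle_ineq4)
    also have "\<dots> \<le> 1 / 2 * norm (x - l0) + norm (G l0) / norm d"
      using lin[OF x, of l0] \<sigma> by (simp add: norm_divide)
    also have "\<dots> \<le> 1 / 2 * \<sigma> + (norm d * \<sigma> / 4) / norm d"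
      using x small by (intro add_mono divide_right_mono) (auto simp: dist_norm norm_minus_commute)
    also have "\<dots> = 3 / 4 * \<sigma>" using nd by simp
    finally show ?thesis .
  qed
  have fp: "T w = w \<longleftrightarrow> G w = 0" for w using d by (simp add: T_def)
  have "\<exists>!w\<in>cball l0 \<sigma>. T w = w"
  proof (rule Banach_fix[where c = "1 / 2"])
    show "complete (cball l0 \<sigma>)" by (simp add: complete_eq_closed)
    show "cball l0 \<sigma> \<noteq> {}" using \<sigma> by simp
    show "T ` cball l0 \<sigma> \<subseteq> cball l0 \<sigma>"
    proof (rule image_subsetI)
      fix x assume "x \<in> cball l0 \<sigma>"
      then have "norm (T x - l0) \<le> 3 / 4 * \<sigma>" by (rule near)
      then show "T x \<in> cball l0 \<sigma>" using \<sigma> by (simp add: dist_norm norm_minus_commute)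
    qed
    show "\<And>x y. x \<in> cball l0 \<sigma> \<Longrightarrow> y \<in> cball l0 \<sigma> \<Longrightarrow> dist (T x) (T y) \<le> 1 / 2 * dist x y"
      using lin by (simp add: dist_norm)
  qed auto
  then show "\<exists>!w. w \<in> cball l0 \<sigma> \<and> G w = 0" unfolding fp .
  fix w assume w: "w \<in> cball l0 \<sigma>" "G w = 0"
  have "norm (w - l0) \<le> 3 / 4 * \<sigma>" using near[OF w(1)] fp[of w] w(2) by metis
  then have "w \<in> ball l0 \<sigma>" using \<sigma> by (simp add: dist_norm norm_minus_commute)
  moreover have "deriv G w \<noteq> 0" using der[OF w(1)] nd by auto
  ultimately show "w \<in> ball l0 \<sigma> \<and> deriv G w \<noteq> 0" by blast
qed

text \<open>
  Uniform closeness of \<open>G p\<close> to \<open>G p0\<close> on a compact disc follows from joint continuity, and Cauchy's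
  inequality passes it on to the derivatives on a smaller disc. So \<open>G p\<close> is nearly linear there.
\<close>

lemma simple_root_persists:
  fixes G :: "'p::metric_space \<Rightarrow> complex \<Rightarrow> complex"
  assumes cont: "continuous_on UNIV (\<lambda>(p, l). G p l)" and ent: "\<And>p. G p holomorphic_on UNIV"
    and 0: "G p0 l0 = 0" and d0: "deriv (G p0) l0 \<noteq> 0"
  obtains R \<sigma> \<Lambda> where "R > 0" "\<sigma> > 0"
    "\<And>p. p \<in> ball p0 R \<Longrightarrow> \<Lambda> p \<in> ball l0 \<sigma> \<and> G p (\<Lambda> p) = 0"
    "\<And>p l. p \<in> ball p0 R \<Longrightarrow> l \<in> cball l0 \<sigma> \<Longrightarrow> G p l = 0 \<Longrightarrow> l = \<Lambda> p"
    "\<And>p. p \<in> ball p0 R \<Longrightarrow> contour_integral (circlepath l0 \<sigma>) (\<lambda>l. 1 / G p l) \<noteq> 0 \<and>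
       \<Lambda> p = contour_integral (circlepath l0 \<sigma>) (\<lambda>l. l / G p l) / contour_integral (circlepath l0 \<sigma>) (\<lambda>l. 1 / G p l)"
proof -
  define d where "d = deriv (G p0) l0"
  have nd: "norm d > 0" using d0 by (simp add: d_def)
  have "deriv (G p0) holomorphic_on UNIV" by (rule holomorphic_deriv[OF ent]) simp
  then have "isCont (deriv (G p0)) l0"
    using holomorphic_on_imp_continuous_on continuous_on_eq_continuous_at by blast
  moreover have "norm d / 4 > 0" using nd by simp
  ultimately obtain s where s: "s > 0" "\<And>l. dist l l0 < s \<Longrightarrow> dist (deriv (G p0) l) d < norm d / 4"
    unfolding continuous_at_eps_delta d_def by blast
  define \<sigma> where "\<sigma> = s / 2"
  have \<sigma>: "\<sigma> > 0" "\<sigma> < s" using s by (auto simp: \<sigma>_def)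
  \<comment> \<open>small enough for the derivative bound (divided by the radius \<open>\<sigma>\<close>) and for the value at the centre\<close>
  define e where "e = norm d * \<sigma> / 4"
  have e: "e > 0" using nd \<sigma> by (simp add: e_def)
  obtain X0 where X0: "p0 \<in> X0" "open X0"
    "\<forall>p\<in>X0 \<inter> UNIV. \<forall>l\<in>cball l0 (2 * \<sigma>). dist (G p l) (G p0 l) \<le> e"
  proof -
    have c: "continuous_on (UNIV \<times> cball l0 (2 * \<sigma>)) (\<lambda>(p, l). G p l)"
      by (rule continuous_on_subset[OF cont]) auto
    show ?thesis
      by (rule continuous_on_prod_compactE[OF c compact_cball UNIV_I[of p0] e]) (use that in auto)
  qed
  obtain R where R: "R > 0" "ball p0 R \<subseteq> X0" using X0 open_contains_ball by blast
  have close: "norm (G p l - G p0 l) \<le> e" if "p \<in> ball p0 R" "l \<in> cball l0 (2 * \<sigma>)" for p l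
    using X0(3) R(2) that by (auto simp: dist_norm)
  have der: "norm (deriv (G p) l - d) \<le> norm d / 2" if p: "p \<in> ball p0 R" and l: "l \<in> cball l0 \<sigma>" for p l
  proof -
    have sub: "cball l \<sigma> \<subseteq> cball l0 (2 * \<sigma>)"
    proof
      fix x assume "x \<in> cball l \<sigma>"
      then show "x \<in> cball l0 (2 * \<sigma>)" using l dist_triangle[of l0 x l] by simp
    qed
    have hd: "(\<lambda>l. G p l - G p0 l) holomorphic_on UNIV" by (intro holomorphic_on_diff ent)
    have "norm ((deriv ^^ 1) (\<lambda>l. G p l - G p0 l) l) \<le> fact 1 * e / \<sigma> ^ 1"
    proof (rule Cauchy_inequality)
      show "(\<lambda>l. G p l - G p0 l) holomorphic_on ball l \<sigma>" using hd holomorphic_on_subset by blast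
      show "continuous_on (cball l \<sigma>) (\<lambda>l. G p l - G p0 l)"
        using hd holomorphic_on_imp_continuous_on continuous_on_subset by blast
      show "norm (G p x - G p0 x) \<le> e" if "norm (l - x) = \<sigma>" for x
        by (rule close[OF p]) (use sub that in \<open>auto simp: dist_norm\<close>)
    qed (rule \<sigma>)
    moreover have "deriv (\<lambda>l. G p l - G p0 l) l = deriv (G p) l - deriv (G p0) l"
      by (intro deriv_diff holomorphic_on_imp_differentiable_at[OF ent]) auto
    ultimately have "norm (deriv (G p) l - deriv (G p0) l) \<le> norm d / 4" using \<sigma> by (simp add: e_def)
    moreover have "norm (deriv (G p0) l - d) < norm d / 4"
      using s(2)[of l] l \<sigma> by (simp add: dist_norm norm_minus_commute)
    moreover have "norm (deriv (G p) l - d) \<le> norm (deriv (G p) l - deriv (G p0) l) + norm (deriv (G p0) l - d)"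
      using norm_triangle_ineq[of "deriv (G p) l - deriv (G p0) l" "deriv (G p0) l - d"] by simp
    ultimately show ?thesis by linarith
  qed
  have small: "norm (G p l0) \<le> norm d * \<sigma> / 4" if "p \<in> ball p0 R" for p
    using close[OF that, of l0] 0 \<sigma> by (simp add: e_def)
  have dn: "d \<noteq> 0" using nd by auto
  note U = nearly_linear_has_unique_root[OF ent \<sigma>(1) dn der small]
  define \<Lambda> where "\<Lambda> = (\<lambda>p. THE w. w \<in> cball l0 \<sigma> \<and> G p w = 0)"
  have \<Lambda>: "\<Lambda> p \<in> cball l0 \<sigma> \<and> G p (\<Lambda> p) = 0" if p: "p \<in> ball p0 R" for p
    unfolding \<Lambda>_def by (rule theI'[OF U(1)[OF p _ p]])
  have uniq: "l = \<Lambda> p" if "p \<in> ball p0 R" "l \<in> cball l0 \<sigma>" "G p l = 0" for p l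
    using U(1)[OF that(1) _ that(1)] \<Lambda>[OF that(1)] that by blast
  have in_ball: "\<Lambda> p \<in> ball l0 \<sigma> \<and> deriv (G p) (\<Lambda> p) \<noteq> 0" if p: "p \<in> ball p0 R" for p
    using U(2)[OF p _ p] \<Lambda>[OF p] by blast
  show ?thesis
  proof (rule that[of R \<sigma> \<Lambda>])
    fix p assume p: "p \<in> ball p0 R"
    show "\<Lambda> p \<in> ball l0 \<sigma> \<and> G p (\<Lambda> p) = 0" using in_ball[OF p] \<Lambda>[OF p] by blast
    show "contour_integral (circlepath l0 \<sigma>) (\<lambda>l. 1 / G p l) \<noteq> 0 \<and>
       \<Lambda> p = contour_integral (circlepath l0 \<sigma>) (\<lambda>l. l / G p l) / contour_integral (circlepath l0 \<sigma>) (\<lambda>l. 1 / G p l)"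
      using simple_root_contour_formula[OF ent \<sigma>(1), of "\<Lambda> p" l0 p] in_ball[OF p] \<Lambda>[OF p] uniq[OF p] by blast
  qed (use R \<sigma> uniq in auto)
qed

text \<open>
  In the contour formula the parameter occurs only in the integrand, on a fixed circle on which
  \<open>G p\<close> has no zeros. So regularity in \<open>p\<close> needs no derivative of \<open>G\<close> with respect to both variables,
  and it suffices that \<open>l\<close> is held fixed while \<open>p\<close> varies along a curve.
\<close>

lemma simple_root_holomorphic_branch:
  fixes G :: "'p::metric_space \<Rightarrow> complex \<Rightarrow> complex"
  assumes cont: "continuous_on UNIV (\<lambda>(p, l). G p l)" and ent: "\<And>p. G p holomorphic_on UNIV"
    and 0: "G p0 l0 = 0" and d0: "deriv (G p0) l0 \<noteq> 0"
  obtains R \<Lambda> where "R > 0" "continuous_on (ball p0 R) \<Lambda>" "\<Lambda> p0 = l0" "\<And>p. p \<in> ball p0 R \<Longrightarrow> G p (\<Lambda> p) = 0"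
    "\<forall>S e. open S \<longrightarrow> continuous_on S e \<longrightarrow> e ` S \<subseteq> ball p0 R \<longrightarrow> (\<forall>l. (\<lambda>w. G (e w) l) holomorphic_on S) \<longrightarrow>
      (\<lambda>w. \<Lambda> (e w)) holomorphic_on S"
proof -
  obtain R \<sigma> \<Lambda> where R: "R > 0" "\<sigma> > 0"
    and \<Lambda>: "\<And>p. p \<in> ball p0 R \<Longrightarrow> \<Lambda> p \<in> ball l0 \<sigma> \<and> G p (\<Lambda> p) = 0"
    and uniq: "\<And>p l. p \<in> ball p0 R \<Longrightarrow> l \<in> cball l0 \<sigma> \<Longrightarrow> G p l = 0 \<Longrightarrow> l = \<Lambda> p"
    and form: "\<And>p. p \<in> ball p0 R \<Longrightarrow> contour_integral (circlepath l0 \<sigma>) (\<lambda>l. 1 / G p l) \<noteq> 0 \<and>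
       \<Lambda> p = contour_integral (circlepath l0 \<sigma>) (\<lambda>l. l / G p l) / contour_integral (circlepath l0 \<sigma>) (\<lambda>l. 1 / G p l)"
    by (rule simple_root_persists[OF cont ent 0 d0]) (rule that)
  have nz: "G p l \<noteq> 0" if "p \<in> ball p0 R" "l \<in> sphere l0 \<sigma>" for p l
  proof
    assume "G p l = 0"
    then have "l = \<Lambda> p" using uniq[OF that(1)] that(2) by simp
    then show False using \<Lambda>[OF that(1)] that(2) by simp
  qed
  have gc: "continuous_on T (\<lambda>x. G (u x) (v x))" if "continuous_on T u" "continuous_on T v" for T :: "'t::topological_space set" and u v
  proof -
    have "continuous_on T (\<lambda>x. (\<lambda>(p, l). G p l) (u x, v x))"
      by (rule continuous_on_compose2[OF cont]) (use that in \<open>auto intro!: continuous_intros\<close>)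
    then show ?thesis by simp
  qed
  have kern: "continuous_on (S \<times> sphere l0 \<sigma>) (\<lambda>(w, l). 1 / G (e w) l)" "continuous_on (S \<times> sphere l0 \<sigma>) (\<lambda>(w, l). l / G (e w) l)"
    if e: "continuous_on S e" "e ` S \<subseteq> ball p0 R" for S :: "'t::topological_space set" and e
  proof -
    have "continuous_on (S \<times> sphere l0 \<sigma>) (\<lambda>x. e (fst x))"
      by (rule continuous_on_compose2[OF e(1) continuous_on_fst[OF continuous_on_id]]) auto
    then have g: "continuous_on (S \<times> sphere l0 \<sigma>) (\<lambda>x. G (e (fst x)) (snd x))"
      by (rule gc[OF _ continuous_on_snd[OF continuous_on_id]])
    have n: "\<forall>x\<in>S \<times> sphere l0 \<sigma>. G (e (fst x)) (snd x) \<noteq> 0" using nz e(2) by fastforce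
    show "continuous_on (S \<times> sphere l0 \<sigma>) (\<lambda>(w, l). 1 / G (e w) l)" "continuous_on (S \<times> sphere l0 \<sigma>) (\<lambda>(w, l). l / G (e w) l)"
      unfolding case_prod_beta by (intro continuous_on_divide continuous_intros g n)+
  qed
  show ?thesis
  proof (rule that[of R \<Lambda>])
    show "continuous_on (ball p0 R) \<Lambda>"
    proof -
      note K = kern[of "ball p0 R" "\<lambda>x. x"]
      have "continuous_on (ball p0 R) (\<lambda>p. contour_integral (circlepath l0 \<sigma>) (\<lambda>l. l / G p l) / contour_integral (circlepath l0 \<sigma>) (\<lambda>l. 1 / G p l))"
        by (intro continuous_on_divide circle_integral_continuous K) (use R form in auto)
      then show ?thesis by (rule continuous_on_eq) (use form in auto)
    qed
    show "\<Lambda> p0 = l0" using uniq[of p0 l0] R 0 by simp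
    show "G p (\<Lambda> p) = 0" if "p \<in> ball p0 R" for p using \<Lambda>[OF that] by blast
    show "\<forall>S e. open S \<longrightarrow> continuous_on S e \<longrightarrow> e ` S \<subseteq> ball p0 R \<longrightarrow> (\<forall>l. (\<lambda>w. G (e w) l) holomorphic_on S) \<longrightarrow>
      (\<lambda>w. \<Lambda> (e w)) holomorphic_on S"
    proof (intro allI impI)
    fix S :: "complex set" and e assume S: "open S" and e: "continuous_on S e" "e ` S \<subseteq> ball p0 R" and h': "\<forall>l. (\<lambda>w. G (e w) l) holomorphic_on S"
    note h = h'[rule_format]
    have n: "G (e w) l \<noteq> 0" if "w \<in> S" "l \<in> sphere l0 \<sigma>" for w l using nz e(2) that by blast
    have "(\<lambda>w. contour_integral (circlepath l0 \<sigma>) (\<lambda>l. l / G (e w) l)) holomorphic_on S"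
      by (rule circle_integral_holomorphic[OF less_imp_le[OF R(2)] S kern(2)[OF e]])
         (intro holomorphic_on_divide h holomorphic_on_const n)
    moreover have "(\<lambda>w. contour_integral (circlepath l0 \<sigma>) (\<lambda>l. 1 / G (e w) l)) holomorphic_on S"
      by (rule circle_integral_holomorphic[OF less_imp_le[OF R(2)] S kern(1)[OF e]])
         (intro holomorphic_on_divide h holomorphic_on_const n)
    ultimately have "(\<lambda>w. contour_integral (circlepath l0 \<sigma>) (\<lambda>l. l / G (e w) l) / contour_integral (circlepath l0 \<sigma>) (\<lambda>l. 1 / G (e w) l)) holomorphic_on S"
      by (rule holomorphic_on_divide) (use form e(2) in blast)
    then show "(\<lambda>w. \<Lambda> (e w)) holomorphic_on S"
      by (rule holomorphic_transform) (use form e(2) in auto)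
    qed
  qed (rule R)
qed

section \<open>Power series of separately holomorphic functions\<close>

text \<open>
  The Taylor coefficient as a contour integral. In this form its dependence on further variables is
  visible.
\<close>

definition cauchy_coeff :: "complex \<Rightarrow> real \<Rightarrow> nat \<Rightarrow> (complex \<Rightarrow> complex) \<Rightarrow> complex" where
  "cauchy_coeff z0 r n g = contour_integral (circlepath z0 r) (\<lambda>u. g u / (u - z0) ^ Suc n) / (2 * of_real pi * \<i>)"

lemma cauchy_coeff_eq_deriv:
  assumes "0 < r" "r < s" "g holomorphic_on ball z0 s"
  shows "cauchy_coeff z0 r n g = (deriv ^^ n) g z0 / fact n"
proof -
  have sub: "cball z0 r \<subseteq> ball z0 s" using assms by auto
  have "((\<lambda>u. g u / (u - z0) ^ Suc n) has_contour_integral (2 * pi * \<i> / fact n * (deriv ^^ n) g z0)) (circlepath z0 r)"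
    by (rule Cauchy_has_contour_integral_higher_derivative_circlepath)
       (use assms sub in \<open>auto intro: holomorphic_on_imp_continuous_on holomorphic_on_subset\<close>)
  from contour_integral_unique[OF this] show ?thesis by (simp add: cauchy_coeff_def)
qed

lemma cauchy_coeff_sums:
  assumes "0 < r" "r < s" "g holomorphic_on ball z0 s" "norm x < r"
  shows "(\<lambda>n. cauchy_coeff z0 r n g * x ^ n) sums g (z0 + x)"
proof -
  have "z0 + x \<in> ball z0 s" using assms by (simp add: dist_norm)
  from holomorphic_power_series[OF assms(3) this] show ?thesis
    by (simp add: cauchy_coeff_eq_deriv[OF assms(1-3)])
qed

lemma cauchy_coeff_bound:
  assumes "0 < r" "r < s" "g holomorphic_on ball z0 s" "\<And>u. u \<in> cball z0 r \<Longrightarrow> norm (g u) \<le> M"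
  shows "norm (cauchy_coeff z0 r n g) \<le> M / r ^ n"
proof -
  have sub: "cball z0 r \<subseteq> ball z0 s" "ball z0 r \<subseteq> ball z0 s" using assms by auto
  have "norm ((deriv ^^ n) g z0) \<le> fact n * M / r ^ n"
  proof (rule Cauchy_inequality)
    show "g holomorphic_on ball z0 r" by (rule holomorphic_on_subset[OF assms(3) sub(2)])
    show "continuous_on (cball z0 r) g"
      by (rule continuous_on_subset[OF holomorphic_on_imp_continuous_on[OF assms(3)] sub(1)])
    show "norm (g x) \<le> M" if "norm (z0 - x) = r" for x
      by (rule assms(4)) (use that in \<open>simp add: dist_norm\<close>)
  qed (rule assms(1))
  then have "norm ((deriv ^^ n) g z0) / fact n \<le> (fact n * M / r ^ n) / fact n"
    by (rule divide_right_mono) simp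
  then show ?thesis by (simp add: cauchy_coeff_eq_deriv[OF assms(1-3)] norm_divide)
qed

lemma cauchy_kernel_continuous:
  fixes F :: "'p::topological_space \<Rightarrow> complex \<Rightarrow> complex"
  assumes "0 < r" "continuous_on (S \<times> sphere z0 r) (\<lambda>(p, u). F p u)"
  shows "continuous_on (S \<times> sphere z0 r) (\<lambda>(p, u). F p u / (u - z0) ^ Suc n)"
proof -
  have *: "continuous_on (S \<times> sphere z0 r) (\<lambda>x. F (fst x) (snd x))" using assms(2) by (simp add: case_prod_beta)
  show ?thesis unfolding case_prod_beta
    by (intro continuous_intros *) (use assms(1) in auto)
qed

lemma cauchy_coeff_continuous:
  fixes F :: "'p::topological_space \<Rightarrow> complex \<Rightarrow> complex"
  assumes "0 < r" "continuous_on (S \<times> sphere z0 r) (\<lambda>(p, u). F p u)"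
  shows "continuous_on S (\<lambda>p. cauchy_coeff z0 r n (F p))"
  unfolding cauchy_coeff_def
  by (intro continuous_on_divide circle_integral_continuous cauchy_kernel_continuous assms continuous_on_const)
     (use assms in auto)

lemma cauchy_coeff_holomorphic:
  fixes F :: "complex \<Rightarrow> complex \<Rightarrow> complex"
  assumes "0 < r" "open S" "continuous_on (S \<times> sphere z0 r) (\<lambda>(p, u). F p u)"
    and "\<And>u. u \<in> sphere z0 r \<Longrightarrow> (\<lambda>w. F w u) holomorphic_on S"
  shows "(\<lambda>p. cauchy_coeff z0 r n (F p)) holomorphic_on S"
proof -
  have "(\<lambda>p. contour_integral (circlepath z0 r) (\<lambda>u. F p u / (u - z0) ^ Suc n)) holomorphic_on S"
  proof (rule circle_integral_holomorphic[OF less_imp_le[OF assms(1)] assms(2) cauchy_kernel_continuous[OF assms(1,3)]])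
    fix u assume u: "u \<in> sphere z0 r"
    then have "(u - z0) ^ Suc n \<noteq> 0" using assms(1) by auto
    then show "(\<lambda>w. F w u / (u - z0) ^ Suc n) holomorphic_on S"
      by (intro holomorphic_on_divide assms(4) u holomorphic_on_const)
  qed
  then show ?thesis unfolding cauchy_coeff_def by (intro holomorphic_on_divide holomorphic_on_const) auto
qed

lemma geometric_has_sum:
  assumes "0 \<le> (a::real)" "a < 1"
  shows "((\<lambda>n. a ^ n) has_sum (1 / (1 - a))) UNIV"
  using geometric_sums[of a] assms by (intro sums_nonneg_imp_has_sum) auto

lemma triple_geometric_summable:
  assumes "0 \<le> (M::real)" "0 \<le> a" "a < 1" "0 \<le> b" "b < 1" "0 \<le> c" "c < 1"
  shows "(\<lambda>(m, n, k). M * a ^ m * b ^ n * c ^ k) summable_on UNIV"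
proof -
  have inner: "((\<lambda>(n, k). b ^ n * c ^ k) has_sum (1 / (1 - b) * (1 / (1 - c)))) (UNIV \<times> UNIV)"
  proof -
    have i: "((\<lambda>k. case (n, k) of (n, k) \<Rightarrow> b ^ n * c ^ k) has_sum (b ^ n * (1 / (1 - c)))) UNIV" for n
      using has_sum_cmult_right[OF geometric_has_sum[OF assms(6,7)]] by simp
    have o: "((\<lambda>n. b ^ n * (1 / (1 - c))) has_sum (1 / (1 - b) * (1 / (1 - c)))) UNIV"
      by (rule has_sum_cmult_left[OF geometric_has_sum[OF assms(4,5)]])
    show ?thesis
      by (rule has_sum_SigmaI[OF i o summable_on_SigmaI[OF i has_sum_imp_summable[OF o]]]) (use assms in auto)
  qed
  have i: "((\<lambda>nk. case (m, nk) of (m, n, k) \<Rightarrow> M * a ^ m * b ^ n * c ^ k) has_sum (M * a ^ m * (1 / (1 - b) * (1 / (1 - c))))) (UNIV \<times> UNIV)" for m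
    using has_sum_cmult_right[OF inner, of "M * a ^ m"] by (simp add: case_prod_beta mult.assoc)
  have o: "((\<lambda>m. M * a ^ m * (1 / (1 - b) * (1 / (1 - c)))) has_sum (M * (1 / (1 - a)) * (1 / (1 - b) * (1 / (1 - c))))) UNIV"
    by (intro has_sum_cmult_left has_sum_cmult_right geometric_has_sum assms)
  have "(\<lambda>(m, n, k). M * a ^ m * b ^ n * c ^ k) summable_on (UNIV \<times> (UNIV \<times> UNIV))"
    by (rule summable_on_SigmaI[OF i has_sum_imp_summable[OF o]]) (use assms in auto)
  then show ?thesis by simp
qed

text \<open>
  Expand in the first variable; the coefficients are again continuous and separately holomorphic in
  the remaining variables, so they can be expanded in turn. A bound \<open>M\<^sub>0\<close> for \<open>f\<close> on the closed
  polydisc of radius \<open>r\<close> gives \<open>|C m n k| \<le> M\<^sub>0 / r\<^sup>m\<^sup>+\<^sup>n\<^sup>+\<^sup>k\<close>, so the triple series converges absolutely and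
  equals the iterated one.
\<close>

lemma separately_holomorphic_power_series:
  fixes f :: "complex \<Rightarrow> complex \<Rightarrow> complex \<Rightarrow> complex"
  assumes rs: "0 < r" "r < s"
    and cont: "continuous_on (ball a0 s \<times> ball b0 s \<times> ball c0 s) (\<lambda>(a, b, c). f a b c)"
    and ha: "\<And>b c. b \<in> ball b0 s \<Longrightarrow> c \<in> ball c0 s \<Longrightarrow> (\<lambda>a. f a b c) holomorphic_on ball a0 s"
    and hb: "\<And>a c. a \<in> ball a0 s \<Longrightarrow> c \<in> ball c0 s \<Longrightarrow> (\<lambda>b. f a b c) holomorphic_on ball b0 s"
    and hc: "\<And>a b. a \<in> ball a0 s \<Longrightarrow> b \<in> ball b0 s \<Longrightarrow> (\<lambda>c. f a b c) holomorphic_on ball c0 s"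
  shows "\<exists>C. \<forall>x y z. norm x < r \<longrightarrow> norm y < r \<longrightarrow> norm z < r \<longrightarrow>
    ((\<lambda>(m, n, k). C m n k * x ^ m * y ^ n * z ^ k) has_sum f (a0 + x) (b0 + y) (c0 + z)) UNIV"
proof -
  have sub: "cball p r \<subseteq> ball p s" "sphere p r \<subseteq> ball p s" for p :: complex using rs by auto
  have cont': "continuous_on T (\<lambda>x. f (u x) (v x) (w x))"
    if "continuous_on T u" "continuous_on T v" "continuous_on T w"
      "u ` T \<subseteq> ball a0 s" "v ` T \<subseteq> ball b0 s" "w ` T \<subseteq> ball c0 s" for T :: "'t::topological_space set" and u v w
  proof -
    have "continuous_on T (\<lambda>x. (\<lambda>(a, b, c). f a b c) (u x, v x, w x))"
      by (rule continuous_on_compose2[OF cont]) (use that in \<open>auto intro!: continuous_intros\<close>)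
    then show ?thesis by simp
  qed
  define g1 where "g1 = (\<lambda>m b c. cauchy_coeff a0 r m (\<lambda>a. f a b c))"
  define g2 where "g2 = (\<lambda>m n c. cauchy_coeff b0 r n (\<lambda>b. g1 m b c))"
  define C where "C = (\<lambda>m n k. cauchy_coeff c0 r k (\<lambda>c. g2 m n c))"
  have "compact ((\<lambda>(a, b, c). f a b c) ` (cball a0 r \<times> cball b0 r \<times> cball c0 r))"
    by (intro compact_continuous_image compact_Times compact_cball continuous_on_subset[OF cont] Sigma_mono sub)
  from compact_imp_bounded[OF this]
  obtain M0 where M0: "\<forall>v\<in>(\<lambda>(a, b, c). f a b c) ` (cball a0 r \<times> cball b0 r \<times> cball c0 r). norm v \<le> M0"
    unfolding bounded_iff by blast
  have M: "norm (f a b c) \<le> M0" if "a \<in> cball a0 r" "b \<in> cball b0 r" "c \<in> cball c0 r" for a b c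
  proof -
    have "(\<lambda>(a, b, c). f a b c) (a, b, c) \<in> (\<lambda>(a, b, c). f a b c) ` (cball a0 r \<times> cball b0 r \<times> cball c0 r)"
      by (rule imageI) (use that in blast)
    then show ?thesis using M0 by auto
  qed
  have "norm (f a0 b0 c0) \<le> M0" using rs by (intro M) auto
  then have M0p: "M0 \<ge> 0" using norm_ge_zero order_trans by blast
  have b1: "norm (g1 m b c) \<le> M0 / r ^ m" if "b \<in> cball b0 r" "c \<in> cball c0 r" for m b c
    unfolding g1_def using rs that by (intro cauchy_coeff_bound[OF rs ha] M) auto
  have g1c: "continuous_on T (\<lambda>x. g1 m (v x) (w x))"
    if "continuous_on T v" "continuous_on T w" "v ` T \<subseteq> ball b0 s" "w ` T \<subseteq> ball c0 s" for T :: "(complex \<times> complex) set" and v w m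
    unfolding g1_def
  proof (rule cauchy_coeff_continuous[OF rs(1)])
    have v: "continuous_on (T \<times> sphere a0 r) (\<lambda>x. v (fst x))"
      by (rule continuous_on_compose2[OF that(1) continuous_on_fst[OF continuous_on_id]]) auto
    have w: "continuous_on (T \<times> sphere a0 r) (\<lambda>x. w (fst x))"
      by (rule continuous_on_compose2[OF that(2) continuous_on_fst[OF continuous_on_id]]) auto
    have "continuous_on (T \<times> sphere a0 r) (\<lambda>x. f (snd x) (v (fst x)) (w (fst x)))"
      by (rule cont'[OF continuous_on_snd[OF continuous_on_id] v w]) (use that(3,4) sub in auto)
    then show "continuous_on (T \<times> sphere a0 r) (\<lambda>(x, a). f a (v x) (w x))" by (simp add: case_prod_beta)
  qed
  have g1b: "(\<lambda>b. g1 m b c) holomorphic_on ball b0 s" if c: "c \<in> ball c0 s" for m c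
    unfolding g1_def
  proof (rule cauchy_coeff_holomorphic[OF rs(1) open_ball])
    have "continuous_on (ball b0 s \<times> sphere a0 r) (\<lambda>x. f (snd x) (fst x) c)"
      by (rule cont') (use c sub in \<open>auto intro!: continuous_intros\<close>)
    then show "continuous_on (ball b0 s \<times> sphere a0 r) (\<lambda>(b, a). f a b c)" by (simp add: case_prod_beta)
    show "(\<lambda>b. f a b c) holomorphic_on ball b0 s" if "a \<in> sphere a0 r" for a
      by (rule hb[OF subsetD[OF sub(2) that] c])
  qed
  have g1h: "(\<lambda>c. g1 m b c) holomorphic_on ball c0 s" if b: "b \<in> ball b0 s" for m b
    unfolding g1_def
  proof (rule cauchy_coeff_holomorphic[OF rs(1) open_ball])
    have "continuous_on (ball c0 s \<times> sphere a0 r) (\<lambda>x. f (snd x) b (fst x))"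
      by (rule cont') (use b sub in \<open>auto intro!: continuous_intros\<close>)
    then show "continuous_on (ball c0 s \<times> sphere a0 r) (\<lambda>(c, a). f a b c)" by (simp add: case_prod_beta)
    show "(\<lambda>c. f a b c) holomorphic_on ball c0 s" if "a \<in> sphere a0 r" for a
      by (rule hc[OF subsetD[OF sub(2) that] b])
  qed
  have b2: "norm (g2 m n c) \<le> M0 / r ^ m / r ^ n" if "c \<in> cball c0 r" for m n c
    unfolding g2_def using rs that by (intro cauchy_coeff_bound[OF rs g1b] b1) auto
  have g2h: "(\<lambda>c. g2 m n c) holomorphic_on ball c0 s" for m n
    unfolding g2_def
  proof (rule cauchy_coeff_holomorphic[OF rs(1) open_ball])
    have "continuous_on (ball c0 s \<times> sphere b0 r) (\<lambda>x. g1 m (snd x) (fst x))"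
      by (rule g1c) (use sub in \<open>auto intro!: continuous_intros\<close>)
    then show "continuous_on (ball c0 s \<times> sphere b0 r) (\<lambda>(c, b). g1 m b c)" by (simp add: case_prod_beta)
    show "(\<lambda>c. g1 m b c) holomorphic_on ball c0 s" if "b \<in> sphere b0 r" for b
      by (rule g1h[OF subsetD[OF sub(2) that]])
  qed
  have b3: "norm (C m n k) \<le> M0 / r ^ m / r ^ n / r ^ k" for m n k
    unfolding C_def by (intro cauchy_coeff_bound[OF rs g2h] b2)
  show ?thesis
  proof (intro exI[of _ C] allI impI)
    fix x y z :: complex assume xyz: "norm x < r" "norm y < r" "norm z < r"
    have b0: "b0 + y \<in> ball b0 s" "c0 + z \<in> ball c0 s" using xyz rs by (auto simp: dist_norm)
    have s1: "(\<lambda>m. g1 m (b0 + y) (c0 + z) * x ^ m) sums f (a0 + x) (b0 + y) (c0 + z)"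
      unfolding g1_def by (rule cauchy_coeff_sums[OF rs ha xyz(1)]) (use b0 in auto)
    have s2: "(\<lambda>n. g2 m n (c0 + z) * y ^ n) sums g1 m (b0 + y) (c0 + z)" for m
      unfolding g2_def by (rule cauchy_coeff_sums[OF rs g1b xyz(2)]) (use b0 in auto)
    have s3: "(\<lambda>k. C m n k * z ^ k) sums g2 m n (c0 + z)" for m n
      unfolding C_def by (rule cauchy_coeff_sums[OF rs g2h xyz(3)])
    let ?T = "\<lambda>(m, n, k). C m n k * x ^ m * y ^ n * z ^ k"
    define a b c where "a = norm x / r" and "b = norm y / r" and "c = norm z / r"
    have abc: "0 \<le> a" "a < 1" "0 \<le> b" "b < 1" "0 \<le> c" "c < 1"
      using xyz rs by (auto simp: a_def b_def c_def)
    have Tb: "norm (C m n k * x ^ m * y ^ n * z ^ k) \<le> M0 * a ^ m * b ^ n * c ^ k" for m n k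
    proof -
      have "norm (C m n k * x ^ m * y ^ n * z ^ k) = norm (C m n k) * (norm x ^ m * norm y ^ n * norm z ^ k)"
        by (simp add: norm_mult norm_power)
      also have "\<dots> \<le> M0 / r ^ m / r ^ n / r ^ k * (norm x ^ m * norm y ^ n * norm z ^ k)"
        by (intro mult_right_mono b3) simp
      also have "\<dots> = M0 * a ^ m * b ^ n * c ^ k"
        by (simp add: a_def b_def c_def power_divide)
      finally show ?thesis .
    qed
    have absT: "(\<lambda>p. norm (?T p)) summable_on UNIV"
      by (rule summable_on_comparison_test[OF triple_geometric_summable[OF M0p abc]]) (use Tb in auto)
    then have T: "?T summable_on UNIV" by (rule abs_summable_summable)
    then have T': "?T summable_on (UNIV \<times> (UNIV \<times> UNIV))" by simp
    have i3: "((\<lambda>k. ?T (m, n, k)) has_sum g2 m n (c0 + z) * (x ^ m * y ^ n)) UNIV" for m n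
    proof -
      have "(\<lambda>k. C m n k * z ^ k * (x ^ m * y ^ n)) sums (g2 m n (c0 + z) * (x ^ m * y ^ n))"
        by (rule sums_mult2[OF s3])
      then have "(\<lambda>k. ?T (m, n, k)) sums (g2 m n (c0 + z) * (x ^ m * y ^ n))" by (simp add: mult_ac)
      moreover have "summable (\<lambda>k. norm (?T (m, n, k)))"
      proof (rule summable_comparison_test'[where N = 0])
        show "summable (\<lambda>k. M0 * a ^ m * b ^ n * c ^ k)" using abc by (intro summable_mult summable_geometric) auto
      qed (use Tb in auto)
      ultimately show ?thesis by (intro norm_summable_imp_has_sum) auto
    qed
    have S2: "(\<lambda>nk. ?T (m, nk)) summable_on (UNIV \<times> UNIV)" for m
    proof -
      have "?T summable_on ({m} \<times> (UNIV \<times> UNIV))" by (rule summable_on_subset_banach[OF T]) auto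
      then have "?T summable_on (Pair m ` (UNIV \<times> UNIV))" by (rule back_subst[of "\<lambda>X. ?T summable_on X"]) auto
      then show ?thesis by (subst (asm) summable_on_reindex) (auto simp: inj_on_def o_def)
    qed
    have i2: "infsum (\<lambda>nk. ?T (m, nk)) (UNIV \<times> UNIV) = g1 m (b0 + y) (c0 + z) * x ^ m" for m
    proof -
      have "infsum (\<lambda>nk. ?T (m, nk)) (UNIV \<times> UNIV) = infsum (\<lambda>n. infsum (\<lambda>k. ?T (m, n, k)) UNIV) UNIV"
        by (rule infsum_Sigma_banach[OF S2, symmetric])
      also have "\<dots> = infsum (\<lambda>n. g2 m n (c0 + z) * (x ^ m * y ^ n)) UNIV"
        using infsumI[OF i3] by simp
      also have "\<dots> = g1 m (b0 + y) (c0 + z) * x ^ m"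
      proof (rule infsumI, rule norm_summable_imp_has_sum)
        show "(\<lambda>n. g2 m n (c0 + z) * (x ^ m * y ^ n)) sums (g1 m (b0 + y) (c0 + z) * x ^ m)"
          using sums_mult2[OF s2[of m], of "x ^ m"] by (simp add: mult_ac)
        have "c0 + z \<in> cball c0 r" using xyz by (simp add: dist_norm)
        show "summable (\<lambda>n. norm (g2 m n (c0 + z) * (x ^ m * y ^ n)))"
        proof (rule summable_comparison_test'[where N = 0])
          show "summable (\<lambda>n. M0 * a ^ m * b ^ n)" using abc by (intro summable_mult summable_geometric) auto
          fix n
          have "norm (g2 m n (c0 + z)) * (norm x ^ m * norm y ^ n) \<le> M0 / r ^ m / r ^ n * (norm x ^ m * norm y ^ n)"
            by (intro mult_right_mono b2) (use \<open>c0 + z \<in> cball c0 r\<close> in auto)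
          then show "norm (norm (g2 m n (c0 + z) * (x ^ m * y ^ n))) \<le> M0 * a ^ m * b ^ n"
            by (simp add: norm_mult norm_power a_def b_def power_divide)
        qed
      qed
      finally show ?thesis .
    qed
    have "infsum ?T (UNIV \<times> (UNIV \<times> UNIV)) = infsum (\<lambda>m. infsum (\<lambda>nk. ?T (m, nk)) (UNIV \<times> UNIV)) UNIV"
      by (rule infsum_Sigma_banach[OF T', symmetric])
    also have "\<dots> = infsum (\<lambda>m. g1 m (b0 + y) (c0 + z) * x ^ m) UNIV" using i2 by simp
    also have "\<dots> = f (a0 + x) (b0 + y) (c0 + z)"
    proof (rule infsumI, rule norm_summable_imp_has_sum)
      show "(\<lambda>m. g1 m (b0 + y) (c0 + z) * x ^ m) sums f (a0 + x) (b0 + y) (c0 + z)" by (rule s1)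
      show "summable (\<lambda>m. norm (g1 m (b0 + y) (c0 + z) * x ^ m))"
      proof (rule summable_comparison_test'[where N = 0])
        show "summable (\<lambda>m. M0 * a ^ m)" using abc by (intro summable_mult summable_geometric) auto
        fix m
        have "norm (g1 m (b0 + y) (c0 + z)) * norm x ^ m \<le> M0 / r ^ m * norm x ^ m"
          by (intro mult_right_mono b1) (use xyz in \<open>auto simp: dist_norm\<close>)
        then show "norm (norm (g1 m (b0 + y) (c0 + z) * x ^ m)) \<le> M0 * a ^ m"
          by (simp add: norm_mult norm_power a_def power_divide)
      qed
    qed
    finally have "infsum ?T UNIV = f (a0 + x) (b0 + y) (c0 + z)" by simp
    then show "(?T has_sum f (a0 + x) (b0 + y) (c0 + z)) UNIV" using has_sum_infsum[OF T] by simp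
  qed
qed

section \<open>Derivatives of an eigenvalue\<close>

lemma endpoint_decay_mono:
  assumes "endpoint_decay C y1 y2" "C \<le> C'"
  shows "endpoint_decay C' y1 y2"
  unfolding endpoint_decay_def
proof
  fix z :: real assume z: "z \<in> {0<..<1}"
  have "C * (z * (1 - z)) \<le> C' * (z * (1 - z))" by (rule mult_right_mono[OF assms(2)]) (use z in auto)
  then show "(norm (y1 z))\<^sup>2 \<le> C' * (z * (1 - z)) \<and> (norm (y2 z))\<^sup>2 \<le> C' * (z * (1 - z))"
    using assms(1) z unfolding endpoint_decay_def by (meson order_trans)
qed

lemma params_bounded_eventually:
  assumes K: "params_bounded K \<alpha> a0 b0 c0 l0"
    and lim: "(a \<longlongrightarrow> a0) F" "(b \<longlongrightarrow> b0) F" "(c \<longlongrightarrow> c0) F" "(l \<longlongrightarrow> l0) F"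
  shows "\<forall>\<^sub>F x in F. params_bounded (K + 1) \<alpha> (a x) (b x) (c x) (l x)"
proof -
  have "\<forall>\<^sub>F x in F. norm (c x + l x) < K + 1"
    by (rule order_tendstoD(2)[OF tendsto_norm[OF tendsto_add[OF lim(3,4)]]]) (use K in \<open>simp add: params_bounded_def\<close>)
  moreover have "\<forall>\<^sub>F x in F. norm (l x) < K + 1"
    by (rule order_tendstoD(2)[OF tendsto_norm[OF lim(4)]]) (use K in \<open>simp add: params_bounded_def\<close>)
  moreover have "\<forall>\<^sub>F x in F. norm (2 * b x) < K + 1"
    by (rule order_tendstoD(2)[OF tendsto_norm[OF tendsto_mult_left[OF lim(2)]]]) (use K in \<open>simp add: params_bounded_def\<close>)
  moreover have "\<forall>\<^sub>F x in F. norm (2 * (a x + (b x)\<^sup>2)) < K + 1"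
    by (rule order_tendstoD(2)[OF tendsto_norm[OF tendsto_mult_left[OF tendsto_add[OF lim(1) tendsto_power[OF lim(2)]]]]])
       (use K in \<open>simp add: params_bounded_def\<close>)
  ultimately show ?thesis by eventually_elim (use K in \<open>auto simp: params_bounded_def\<close>)
qed

text \<open>
  Near \<open>1\<close> the decay constant involves the inverse of the factor of proportionality between the two
  recessive solutions. The factors converge to a nonzero limit, as a ratio of components at the
  midpoint shows, so they eventually stay away from zero.
\<close>

lemma left_uniform_decay:
  assumes \<alpha>: "\<alpha> \<ge> 1 / 2" and 0: "connection \<alpha> a0 b0 c0 l0 = 0"
    and lim: "(a \<longlongrightarrow> a0) F" "(b \<longlongrightarrow> b0) F" "(c \<longlongrightarrow> c0) F" "(l \<longlongrightarrow> l0) F"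
    and ev0: "\<forall>\<^sub>F x in F. connection \<alpha> (a x) (b x) (c x) (l x) = 0"
  shows "\<exists>C. endpoint_decay C (left1 \<alpha> a0 b0 c0 l0) (left2 \<alpha> a0 b0 c0 l0) \<and>
    (\<forall>\<^sub>F x in F. endpoint_decay C (left1 \<alpha> (a x) (b x) (c x) (l x)) (left2 \<alpha> (a x) (b x) (c x) (l x)))"
proof -
  define h :: real where "h = 1 / 2"
  have h: "h \<in> {0<..<1}" by (simp add: h_def)
  obtain K where K: "params_bounded K \<alpha> a0 b0 c0 l0" using params_bounded_exists[OF \<alpha>] by blast
  have K1: "params_bounded (K + 1) \<alpha> a0 b0 c0 l0" using K by (auto simp: params_bounded_def)
  obtain k where k: "k \<noteq> 0" "\<And>z. z \<in> {0<..<1} \<Longrightarrow> right1 \<alpha> a0 b0 c0 l0 z = k * left1 \<alpha> a0 b0 c0 l0 z"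
    "\<And>z. z \<in> {0<..<1} \<Longrightarrow> right2 \<alpha> a0 b0 c0 l0 z = k * left2 \<alpha> a0 b0 c0 l0 z"
    using connection_zero_imp_proportional[OF \<alpha> 0] by blast
  note L = solutions_tendsto[OF \<alpha> lim h]
  let ?ratio = "\<lambda>x. \<forall>k'. right1 \<alpha> (a x) (b x) (c x) (l x) h = k' * left1 \<alpha> (a x) (b x) (c x) (l x) h \<longrightarrow>
       right2 \<alpha> (a x) (b x) (c x) (l x) h = k' * left2 \<alpha> (a x) (b x) (c x) (l x) h \<longrightarrow> norm k' > norm k / 2"
  have ratio_ev: "\<forall>\<^sub>F x in F. \<forall>k'. R x = k' * X x \<longrightarrow> norm k' > norm k / 2"
    if X: "(X \<longlongrightarrow> x0) F" and R: "(R \<longlongrightarrow> k * x0) F" and x0: "x0 \<noteq> 0" for X R :: "_ \<Rightarrow> complex" and x0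
  proof -
    have "((\<lambda>x. norm (R x / X x)) \<longlongrightarrow> norm (k * x0 / x0)) F" by (intro tendsto_intros X R x0)
    moreover have "norm k / 2 < norm (k * x0 / x0)" using x0 k(1) by simp
    ultimately have "\<forall>\<^sub>F x in F. norm k / 2 < norm (R x / X x)" by (rule order_tendstoD(1))
    moreover have "\<forall>\<^sub>F x in F. X x \<noteq> 0" by (rule tendsto_imp_eventually_ne[OF X x0])
    ultimately show ?thesis by eventually_elim auto
  qed
  have evk: "\<forall>\<^sub>F x in F. ?ratio x"
  proof (cases "left1 \<alpha> a0 b0 c0 l0 h = 0")
    case False
    from ratio_ev[OF L(1) _ False] L(3) k(2)[OF h]
    have "\<forall>\<^sub>F x in F. \<forall>k'. right1 \<alpha> (a x) (b x) (c x) (l x) h = k' * left1 \<alpha> (a x) (b x) (c x) (l x) h \<longrightarrow> norm k' > norm k / 2"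
      by simp
    then show ?thesis by eventually_elim blast
  next
    case True
    then have "left2 \<alpha> a0 b0 c0 l0 h \<noteq> 0" using left_nonzero[OF \<alpha> h] by blast
    from ratio_ev[OF L(2) _ this] L(4) k(3)[OF h]
    have "\<forall>\<^sub>F x in F. \<forall>k'. right2 \<alpha> (a x) (b x) (c x) (l x) h = k' * left2 \<alpha> (a x) (b x) (c x) (l x) h \<longrightarrow> norm k' > norm k / 2"
      by simp
    then show ?thesis by eventually_elim blast
  qed
  define B where "B = local_bound (K + 1)"
  define C where "C = 2 * B\<^sup>2 * (1 + 1 / (norm k / 2)\<^sup>2)"
  have Cmono: "2 * B\<^sup>2 * (1 + 1 / (norm k')\<^sup>2) \<le> C" if k': "norm k' \<ge> norm k / 2" for k' :: complex
  proof -
    have "(norm k / 2)\<^sup>2 \<le> (norm k')\<^sup>2" by (rule power_mono[OF k']) simp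
    then have "1 / (norm k')\<^sup>2 \<le> 1 / (norm k / 2)\<^sup>2" using k(1) by (intro divide_left_mono) (auto simp: zero_less_mult_iff)
    then show ?thesis unfolding C_def by (intro mult_left_mono add_left_mono) auto
  qed
  have "2 * B\<^sup>2 * (1 + 1 / (norm k)\<^sup>2) \<le> C" by (rule Cmono) simp
  then have "endpoint_decay C (left1 \<alpha> a0 b0 c0 l0) (left2 \<alpha> a0 b0 c0 l0)"
    unfolding B_def by (rule endpoint_decay_mono[OF left_endpoint_decay[OF K1 k], rotated -1]) simp_all
  moreover have "\<forall>\<^sub>F x in F. endpoint_decay C (left1 \<alpha> (a x) (b x) (c x) (l x)) (left2 \<alpha> (a x) (b x) (c x) (l x))"
    using params_bounded_eventually[OF K lim] ev0 evk
  proof eventually_elim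
    case (elim x)
    obtain k' where k': "k' \<noteq> 0" "\<And>z. z \<in> {0<..<1} \<Longrightarrow> right1 \<alpha> (a x) (b x) (c x) (l x) z = k' * left1 \<alpha> (a x) (b x) (c x) (l x) z"
      "\<And>z. z \<in> {0<..<1} \<Longrightarrow> right2 \<alpha> (a x) (b x) (c x) (l x) z = k' * left2 \<alpha> (a x) (b x) (c x) (l x) z"
      using connection_zero_imp_proportional[OF \<alpha> elim(2)] by blast
    have "norm k' \<ge> norm k / 2" using elim(3) k'(2,3)[OF h] by (auto intro: less_imp_le)
    from Cmono[OF this] show ?case
      unfolding B_def by (rule endpoint_decay_mono[OF left_endpoint_decay[OF elim(1) k'], rotated -1]) simp_all
  qed
  ultimately show ?thesis by blast
qed

text \<open>
  First-order perturbation theory without a derivative of the eigenfunction: the integrated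
  Wronskian identity for the eigenfunctions at \<open>(a, b, c)\<close> and at \<open>(a, b, c) + t (e1, e2, e3)\<close> is
  divided by \<open>t\<close>, and the second eigenfunction converges pointwise to the first with a uniform decay
  bound, which is all that dominated convergence requires.
\<close>

lemma hellmann_feynman:
  fixes a b c l e1 e2 e3 D :: complex and t :: "nat \<Rightarrow> complex" and ln :: "nat \<Rightarrow> complex"
  assumes \<alpha>: "\<alpha> \<ge> 1 / 2" and 0: "connection \<alpha> a b c l = 0"
    and t: "t \<longlonglongrightarrow> 0" "\<And>n. t n \<noteq> 0"
    and ln: "\<And>n. connection \<alpha> (a + t n * e1) (b + t n * e2) (c + t n * e3) (ln n) = 0"
    and D: "(\<lambda>n. (ln n - l) / t n) \<longlonglongrightarrow> D"
  defines "y1 \<equiv> left1 \<alpha> a b c l" and "y2 \<equiv> left2 \<alpha> a b c l"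
  shows "((\<lambda>z. 4 * e2 * (y1 z * y2 z) + 2 * (e1 + 2 * b * e2) * (y2 z * y2 z) + e3 * (y2 z * y2 z / of_real z)
     + D * weight_pairing y1 y2 y1 y2 z) has_integral 0) {0<..<1}"
proof -
  have ll: "ln \<longlonglongrightarrow> l"
  proof -
    have "(\<lambda>n. l + t n * ((ln n - l) / t n)) \<longlonglongrightarrow> l + 0 * D" by (intro tendsto_intros t D)
    then show ?thesis using t(2) by simp
  qed
  have la: "(\<lambda>n. a + t n * e1) \<longlonglongrightarrow> a" "(\<lambda>n. b + t n * e2) \<longlonglongrightarrow> b" "(\<lambda>n. c + t n * e3) \<longlonglongrightarrow> c"
    using tendsto_add[OF tendsto_const tendsto_mult_right[OF t(1)]] by fastforce+
  define W1 where "W1 = (\<lambda>n. left1 \<alpha> (a + t n * e1) (b + t n * e2) (c + t n * e3) (ln n))"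
  define W2 where "W2 = (\<lambda>n. left2 \<alpha> (a + t n * e1) (b + t n * e2) (c + t n * e3) (ln n))"
  obtain C where Cy: "endpoint_decay C y1 y2" and evC: "\<forall>\<^sub>F n in sequentially. endpoint_decay C (W1 n) (W2 n)"
    using left_uniform_decay[OF \<alpha> 0 la ll] ln unfolding y1_def y2_def W1_def W2_def by auto
  define q where "q = (\<lambda>n. (ln n - l) / t n)"
  have "\<forall>\<^sub>F n in sequentially. norm (q n) < norm D + 1"
    unfolding q_def by (rule order_tendstoD(2)[OF tendsto_norm[OF D]]) simp
  moreover have "\<forall>\<^sub>F n in sequentially. norm (t n) < 1"
    by (rule order_tendstoD(2)[OF tendsto_norm[OF t(1)]]) simp
  ultimately have "\<forall>\<^sub>F n in sequentially. endpoint_decay C (W1 n) (W2 n) \<and> norm (q n) < norm D + 1 \<and> norm (t n) < 1"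
    using evC by eventually_elim blast
  then obtain N where N: "\<And>n. n \<ge> N \<Longrightarrow> endpoint_decay C (W1 n) (W2 n) \<and> norm (q n) < norm D + 1 \<and> norm (t n) < 1"
    by (auto simp: eventually_sequentially)
  have sy: "dirac_solution \<alpha> a b c l y1 y2" unfolding y1_def y2_def by (rule left_solution[OF \<alpha>])
  have sW: "dirac_solution \<alpha> (a + t n * e1) (b + t n * e2) (c + t n * e3) (ln n) (W1 n) (W2 n)" for n
    unfolding W1_def W2_def by (rule left_solution[OF \<alpha>])
  \<comment> \<open>the integrand of the Wronskian identity after division by \<open>- t n\<close>\<close>
  define J where "J = (\<lambda>n z. 2 * e2 * (y1 z * W2 n z + y2 z * W1 n z) + 2 * (e1 + 2 * b * e2 + t n * e2\<^sup>2) * (y2 z * W2 n z)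
     + e3 * (y2 z * W2 n z / of_real z) + q n * weight_pairing y1 y2 (W1 n) (W2 n) z)"
  have J0: "(J n has_integral 0) {0<..<1}" if n: "n \<ge> N" for n
  proof -
    from has_integral_mult_right[OF wronskian_integral[OF sy Cy sW N[OF n, THEN conjunct1]], of "- 1 / t n"]
    have "((\<lambda>z. - 1 / t n * (2 * (b - (b + t n * e2)) * (y1 z * W2 n z + y2 z * W1 n z)
     + ((c - (c + t n * e3) + (l - ln n)) / of_real z + 2 * (a - (a + t n * e1) + (b\<^sup>2 - (b + t n * e2)\<^sup>2))) * (y2 z * W2 n z)
     + (l - ln n) / of_real (1 - z) * (y1 z * W1 n z))) has_integral 0) {0<..<1}" by simp
    moreover have "- 1 / t n * (2 * (b - (b + t n * e2)) * (y1 z * W2 n z + y2 z * W1 n z)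
     + ((c - (c + t n * e3) + (l - ln n)) / of_real z + 2 * (a - (a + t n * e1) + (b\<^sup>2 - (b + t n * e2)\<^sup>2))) * (y2 z * W2 n z)
     + (l - ln n) / of_real (1 - z) * (y1 z * W1 n z)) = J n z" for z
    proof -
      have lq: "l - ln n = - (t n * q n)" using t(2)[of n] by (simp add: q_def)
      have "(2 * (b - (b + t n * e2)) * (y1 z * W2 n z + y2 z * W1 n z)
         + ((c - (c + t n * e3) + (l - ln n)) / of_real z + 2 * (a - (a + t n * e1) + (b\<^sup>2 - (b + t n * e2)\<^sup>2))) * (y2 z * W2 n z)
         + (l - ln n) / of_real (1 - z) * (y1 z * W1 n z)) = - t n * J n z"
        unfolding lq J_def weight_pairing_def by (simp add: divide_inverse algebra_simps power2_eq_square)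
      then show ?thesis using t(2)[of n] by simp
    qed
    ultimately show ?thesis by simp
  qed
  define P where "P = (\<lambda>z. 2 * e2 * (y1 z * y2 z + y2 z * y1 z) + 2 * (e1 + 2 * b * e2 + 0 * e2\<^sup>2) * (y2 z * y2 z)
     + e3 * (y2 z * y2 z / of_real z) + D * weight_pairing y1 y2 y1 y2 z)"
  define H where "H = 4 * norm e2 * C + (2 * norm (e1 + 2 * b * e2) + 2 * (norm e2)\<^sup>2) * C + norm e3 * C + (norm D + 1) * C"
  have C0: "C \<ge> 0" by (rule endpoint_decay_const_nonneg[OF Cy])
  have bJ: "norm (J (n + N) z) \<le> H" if z: "z \<in> {0<..<1}" for n z
  proof -
    let ?n = "n + N"
    have dW: "endpoint_decay C (W1 ?n) (W2 ?n)" "norm (q ?n) \<le> norm D + 1" "norm (t ?n) \<le> 1" using N[of ?n] by auto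
    have "z * (1 - z) \<le> 1 * 1" using z by (intro mult_mono) auto
    then have z1: "C * (z * (1 - z)) \<le> C" using mult_left_mono[OF _ C0] by fastforce
    note p = decay_products[OF Cy dW(1) z]
    have p2: "norm (y2 z * W2 ?n z / of_real z) \<le> C"
    proof -
      have "norm (y2 z * W2 ?n z / of_real z) \<le> C * (1 - z)"
        using p(4) z by (simp add: norm_divide pos_divide_le_eq mult_ac)
      also have "\<dots> \<le> C * 1" using z C0 by (intro mult_left_mono) auto
      finally show ?thesis by simp
    qed
    have "norm (2 * e2 * (y1 z * W2 ?n z + y2 z * W1 ?n z)) = 2 * norm e2 * norm (y1 z * W2 ?n z + y2 z * W1 ?n z)"
      unfolding norm_mult by simp
    also have "\<dots> \<le> 2 * norm e2 * (C + C)"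
      by (intro mult_left_mono norm_triangle_le) (use p(2,3) z1 in auto)
    finally have n1: "norm (2 * e2 * (y1 z * W2 ?n z + y2 z * W1 ?n z)) \<le> 4 * norm e2 * C" by simp
    have "norm (e1 + 2 * b * e2 + t ?n * e2\<^sup>2) \<le> norm (e1 + 2 * b * e2) + norm (t ?n) * (norm e2)\<^sup>2"
      using norm_triangle_ineq[of "e1 + 2 * b * e2" "t ?n * e2\<^sup>2"] by (simp add: norm_mult norm_power)
    also have "\<dots> \<le> norm (e1 + 2 * b * e2) + 1 * (norm e2)\<^sup>2" by (intro add_left_mono mult_right_mono dW) simp
    finally have n2': "norm (2 * (e1 + 2 * b * e2 + t ?n * e2\<^sup>2)) \<le> 2 * norm (e1 + 2 * b * e2) + 2 * (norm e2)\<^sup>2"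
      unfolding norm_mult[of 2] by simp
    have n2: "norm (2 * (e1 + 2 * b * e2 + t ?n * e2\<^sup>2) * (y2 z * W2 ?n z)) \<le> (2 * norm (e1 + 2 * b * e2) + 2 * (norm e2)\<^sup>2) * C"
      unfolding norm_mult[of "2 * (e1 + 2 * b * e2 + t ?n * e2\<^sup>2)"]
      by (intro mult_mono n2' order_trans[OF p(4) z1]) auto
    have n3: "norm (e3 * (y2 z * W2 ?n z / of_real z)) \<le> norm e3 * C"
      unfolding norm_mult[of e3] by (intro mult_left_mono p2) simp
    have n4: "norm (q ?n * weight_pairing y1 y2 (W1 ?n) (W2 ?n) z) \<le> (norm D + 1) * C"
      unfolding norm_mult by (intro mult_mono dW weight_pairing_bound[OF Cy dW(1) z]) auto
    show ?thesis unfolding J_def H_def by (intro norm_triangle_le add_mono n1 n2 n3 n4)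
  qed
  have lJ: "(\<lambda>n. J (n + N) z) \<longlonglongrightarrow> P z" if z: "z \<in> {0<..<1}" for z
  proof (rule LIMSEQ_ignore_initial_segment)
    have nz: "1 - complex_of_real z \<noteq> 0" "complex_of_real z \<noteq> 0"
      using z by (metis greaterThanLessThan_iff less_irrefl of_real_1 of_real_diff of_real_eq_0_iff right_minus_eq) (use z in auto)
    have lw: "(\<lambda>n. W1 n z) \<longlonglongrightarrow> y1 z" "(\<lambda>n. W2 n z) \<longlonglongrightarrow> y2 z"
      unfolding W1_def W2_def y1_def y2_def by (rule solutions_tendsto[OF \<alpha> la ll z])+
    show "(\<lambda>n. J n z) \<longlonglongrightarrow> P z"
      unfolding J_def P_def weight_pairing_def q_def
      by (intro tendsto_intros lw t(1) D) (use nz in auto)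
  qed
  have hM: "(\<lambda>z::real. H) integrable_on {0<..<1}" by (rule integrable_on_const) simp
  have iJ: "J (n + N) integrable_on {0<..<1}" for n by (rule has_integral_integrable[OF J0]) simp
  note dc = dominated_convergence[OF iJ hM bJ lJ, simplified]
  have "integral {0<..<1} (J (n + N)) = 0" for n by (rule integral_unique[OF J0]) simp
  then have "integral {0<..<1} P = 0" using dc(2) by (simp add: LIMSEQ_const_iff)
  then have "(P has_integral 0) {0<..<1}" using integrable_integral[OF dc(1)] by simp
  then show ?thesis
    by (rule has_integral_eq[rotated]) (simp add: P_def mult.commute)
qed

section \<open>The exact quadratic form behind the differential equation\<close>

text \<open>
  The integrand is the derivative of
  \<open>Q = 2 z y\<^sub>1\<^sup>2 + (2 l b - 1 - 2 m + 4 b z) y\<^sub>1 y\<^sub>2 - 2 (a + b\<^sup>2) (1 - z) y\<^sub>2\<^sup>2\<close>, where \<open>m\<close> plays the role of \<open>\<mu>\<close>.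
  This \<open>Q\<close> is found by an ansatz with coefficients that are linear in \<open>z\<close>, comparing in \<open>Q'\<close> the
  coefficients of \<open>y\<^sub>1\<^sup>2\<close>, \<open>y\<^sub>1 y\<^sub>2\<close> and \<open>y\<^sub>2\<^sup>2\<close>, whose poles at \<open>0\<close> and \<open>1\<close> leave no freedom.
\<close>

lemma quadratic_exact_form:
  fixes a b c l m :: complex
  assumes s: "dirac_solution \<alpha> a b c l y1 y2" and d: "endpoint_decay C y1 y2" and m: "m = 2 * of_real \<alpha> - 1"
  defines "c2 \<equiv> (l + 2) * (a + b\<^sup>2) + l + b + c"
    and "c3 \<equiv> (2 * l + c + 2) * (2 * l * b - 2 * m - 1) - 2 * (m + 1) * (a + b\<^sup>2) + 2 * m"
    and "R \<equiv> (1 + 2 * m - 2 * l * b) * (l + 2) - 2 * m"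
  shows "((\<lambda>z. 4 * c2 * (y1 z * y2 z) + 2 * (2 * a + 2 * b * c2) * (y2 z * y2 z) + c3 * (y2 z * y2 z / of_real z)
     + R * weight_pairing y1 y2 y1 y2 z) has_integral 0) {0<..<1}"
proof -
  define Q where "Q = (\<lambda>z. 2 * of_real z * (y1 z * y1 z) + (2 * l * b - 1 - 2 * m + 4 * b * of_real z) * (y1 z * y2 z)
     - 2 * (a + b\<^sup>2) * of_real (1 - z) * (y2 z * y2 z))"
  have Qd: "(Q has_vector_derivative 4 * c2 * (y1 z * y2 z) + 2 * (2 * a + 2 * b * c2) * (y2 z * y2 z) + c3 * (y2 z * y2 z / of_real z)
     + R * weight_pairing y1 y2 y1 y2 z) (at z)" if z: "z \<in> {0<..<1}" for z
  proof -
    define p q where "p = inverse (complex_of_real z)" and "q = inverse (complex_of_real (1 - z))"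
    have pz: "of_real z * p = 1" and qz: "(1 - of_real z) * q = 1"
      using z by (auto simp: p_def q_def)
    define Y1 Y2 where "Y1 = diag_coeff \<alpha> b z * y1 z + ((c + l) / of_real z + 2 * (a + b\<^sup>2)) * y2 z"
      and "Y2 = - (2 + l / of_real (1 - z)) * y1 z - diag_coeff \<alpha> b z * y2 z"
    have D1: "(y1 has_vector_derivative Y1) (at z)" and D2: "(y2 has_vector_derivative Y2) (at z)"
      using s[unfolded dirac_solution_def, rule_format, OF z] by (auto simp: Y1_def Y2_def)
    have dz: "(complex_of_real has_vector_derivative 1) (at z)"
      using has_vector_derivative_of_real[OF DERIV_ident] by simp
    have dz1: "((\<lambda>z. complex_of_real (1 - z)) has_vector_derivative - 1) (at z)"
    proof -
      have "((\<lambda>z. 1 - z) has_real_derivative - 1) (at z)" by (auto intro!: derivative_eq_intros)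
      from has_vector_derivative_eq_rhs[OF has_vector_derivative_of_real[OF this]] show ?thesis by simp
    qed
    have QD: "(Q has_vector_derivative
        2 * (of_real z * (y1 z * Y1 + Y1 * y1 z) + 1 * (y1 z * y1 z))
        + ((2 * l * b - 1 - 2 * m + 4 * b * of_real z) * (y1 z * Y2 + Y1 * y2 z) + (4 * b * 1) * (y1 z * y2 z))
        - 2 * (a + b\<^sup>2) * (of_real (1 - z) * (y2 z * Y2 + Y2 * y2 z) + - 1 * (y2 z * y2 z))) (at z)"
    proof -
      have 1: "((\<lambda>z. 2 * (of_real z * (y1 z * y1 z))) has_vector_derivative 2 * (of_real z * (y1 z * Y1 + Y1 * y1 z) + 1 * (y1 z * y1 z))) (at z)"
        by (intro has_vector_derivative_mult_right has_vector_derivative_mult dz D1)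
      have 2: "((\<lambda>z. 2 * l * b - 1 - 2 * m + 4 * b * of_real z) has_vector_derivative 4 * b * 1) (at z)"
        using has_vector_derivative_add[OF has_vector_derivative_const has_vector_derivative_mult_right[OF dz, of "4 * b"]] by fastforce
      have 3: "((\<lambda>z. 2 * (a + b\<^sup>2) * (of_real (1 - z) * (y2 z * y2 z))) has_vector_derivative
         2 * (a + b\<^sup>2) * (of_real (1 - z) * (y2 z * Y2 + Y2 * y2 z) + - 1 * (y2 z * y2 z))) (at z)"
        by (intro has_vector_derivative_mult_right has_vector_derivative_mult dz1 D2)
      have QQ: "Q = (\<lambda>z. 2 * (of_real z * (y1 z * y1 z)) + (2 * l * b - 1 - 2 * m + 4 * b * of_real z) * (y1 z * y2 z)
        - 2 * (a + b\<^sup>2) * (of_real (1 - z) * (y2 z * y2 z)))" by (simp add: Q_def mult.assoc)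
      show ?thesis unfolding QQ
        by (rule has_vector_derivative_diff[OF has_vector_derivative_add[OF 1
            has_vector_derivative_mult[OF 2 has_vector_derivative_mult[OF D1 D2]]] 3])
    qed
    have dc: "diag_coeff \<alpha> b z = - of_real \<alpha> * p + of_real \<alpha> * q + 2 * b"
      by (simp add: diag_coeff_def p_def q_def divide_inverse)
    have Y: "Y1 = (- of_real \<alpha> * p + of_real \<alpha> * q + 2 * b) * y1 z + ((c + l) * p + 2 * (a + b\<^sup>2)) * y2 z"
      "Y2 = - (2 + l * q) * y1 z - (- of_real \<alpha> * p + of_real \<alpha> * q + 2 * b) * y2 z"
      by (simp_all add: Y1_def Y2_def dc) (simp_all add: p_def q_def divide_inverse)
    have wp: "weight_pairing y1 y2 y1 y2 z = y1 z * y1 z * q + y2 z * y2 z * p"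
      by (simp add: weight_pairing_def p_def q_def divide_inverse)
    have dp: "y2 z * y2 z / of_real z = y2 z * y2 z * p" by (simp add: p_def divide_inverse)
    \<comment> \<open>a polynomial identity once the inverses of \<open>z\<close> and \<open>1 - z\<close> are treated as variables \<open>p\<close> and \<open>q\<close>\<close>
    have "2 * (x * (u * Y1 + Y1 * u) + 1 * (u * u))
        + ((2 * l * b - 1 - 2 * m + 4 * b * x) * (u * Y2 + Y1 * v) + (4 * b * 1) * (u * v))
        - 2 * (a + b\<^sup>2) * ((1 - x) * (v * Y2 + Y2 * v) + - 1 * (v * v))
      = 4 * c2 * (u * v) + 2 * (2 * a + 2 * b * c2) * (v * v) + c3 * (v * v * p) + R * (u * u * q + v * v * p)"
      if "x * p = 1" "(1 - x) * q = 1" "Y1 = (- A * p + A * q + 2 * b) * u + ((c + l) * p + 2 * (a + b\<^sup>2)) * v"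
        "Y2 = - (2 + l * q) * u - (- A * p + A * q + 2 * b) * v" "m = 2 * A - 1" for x u v A Y1 Y2 :: complex
      using that unfolding c2_def c3_def R_def by algebra
    from this[OF pz qz Y m] show ?thesis
      by (intro has_vector_derivative_eq_rhs[OF QD]) (simp only: wp dp of_real_diff of_real_1)
  qed
  define M where "M = 2 * C + norm (2 * l * b - 1 - 2 * m) * C + 4 * norm b * C + 2 * norm (a + b\<^sup>2) * C"
  have C0: "C \<ge> 0" by (rule endpoint_decay_const_nonneg[OF d])
  have Qb: "norm (Q z) \<le> M * (z * (1 - z))" if z: "z \<in> {0<..<1}" for z
  proof -
    define w where "w = C * (z * (1 - z))"
    have zz: "norm (complex_of_real z) \<le> 1" "norm (complex_of_real (1 - z)) \<le> 1"
      unfolding norm_of_real using z by auto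
    note p = decay_products[OF d d z, folded w_def]
    have n1: "norm (2 * of_real z * (y1 z * y1 z)) \<le> 2 * 1 * w"
      unfolding norm_mult[of "2 * of_real z"] norm_mult[of 2] by (intro mult_mono p) (use zz in auto)
    have "norm (2 * l * b - 1 - 2 * m + 4 * b * of_real z) \<le> norm (2 * l * b - 1 - 2 * m) + 4 * norm b * 1"
      by (rule norm_triangle_le, rule add_left_mono) (use zz in \<open>simp add: norm_mult mult_left_le\<close>)
    then have n2: "norm ((2 * l * b - 1 - 2 * m + 4 * b * of_real z) * (y1 z * y2 z)) \<le> (norm (2 * l * b - 1 - 2 * m) + 4 * norm b * 1) * w"
      unfolding norm_mult[of "2 * l * b - 1 - 2 * m + 4 * b * of_real z"] by (intro mult_mono p) auto
    have n3: "norm (2 * (a + b\<^sup>2) * of_real (1 - z) * (y2 z * y2 z)) \<le> 2 * norm (a + b\<^sup>2) * 1 * w"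
      unfolding norm_mult[of "2 * (a + b\<^sup>2) * of_real (1 - z)"] norm_mult[of "2 * (a + b\<^sup>2)"] norm_mult[of 2]
      by (intro mult_mono p) (use zz in auto)
    have "norm (Q z) \<le> 2 * 1 * w + (norm (2 * l * b - 1 - 2 * m) + 4 * norm b * 1) * w + 2 * norm (a + b\<^sup>2) * 1 * w"
      unfolding Q_def by (rule order_trans[OF norm_triangle_ineq4]) (intro add_mono norm_triangle_le n1 n2 n3)
    also have "\<dots> = M * (z * (1 - z))" by (simp add: M_def w_def algebra_simps)
    finally show ?thesis .
  qed
  have lm: "((\<lambda>z. M * (z * (1 - z))) \<longlongrightarrow> 0) (at_right 0)" "((\<lambda>z. M * (z * (1 - z))) \<longlongrightarrow> 0) (at_left 1)"
    by (auto intro!: tendsto_eq_intros)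
  have "(Q \<longlongrightarrow> 0) (at_right 0)"
    by (rule Lim_null_comparison[OF eventually_mono[OF eventually_at_right_real[of 0 1]] lm(1)]) (use Qb in auto)
  moreover have "(Q \<longlongrightarrow> 0) (at_left 1)"
    by (rule Lim_null_comparison[OF eventually_mono[OF eventually_at_left_real[of 0 1]] lm(2)]) (use Qb in auto)
  ultimately show ?thesis using FTC_open_interval[OF _ Qd, of 0 1 0 0] by simp
qed

text \<open>
  The combination of the three first-order formulas with the coefficients of the differential
  equation differs from the exact form only by a multiple of the squared norm of the eigenfunction.
  Both integrate to zero, so the factor, which is the difference of the two sides of the equation,
  vanishes.
\<close>

lemma eigenvalue_pde:
  fixes a b c l m D1 D2 D3 :: complex
  assumes \<alpha>: "\<alpha> \<ge> 1 / 2" and r: "a \<in> \<real>" "b \<in> \<real>" "c \<in> \<real>" and 0: "connection \<alpha> a b c l = 0"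
    and m: "m = 2 * of_real \<alpha> - 1"
  defines "y1 \<equiv> left1 \<alpha> a b c l" and "y2 \<equiv> left2 \<alpha> a b c l"
  assumes HF: "\<And>e1 e2 e3 D. (e1, e2, e3, D) \<in> {(1, 0, 0, D1), (0, 1, 0, D2), (0, 0, 1, D3)} \<Longrightarrow>
    ((\<lambda>z. 4 * e2 * (y1 z * y2 z) + 2 * (e1 + 2 * b * e2) * (y2 z * y2 z) + e3 * (y2 z * y2 z / of_real z)
     + D * weight_pairing y1 y2 y1 y2 z) has_integral 0) {0<..<1}"
  shows "2 * a * D1 + ((l + 2) * (a + b\<^sup>2) + l + b + c) * D2
     + ((2 * l + c + 2) * (2 * l * b - 2 * m - 1) - 2 * (m + 1) * (a + b\<^sup>2) + 2 * m) * D3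
     = (1 + 2 * m - 2 * l * b) * (l + 2) - 2 * m"
proof -
  define c2 where "c2 = (l + 2) * (a + b\<^sup>2) + l + b + c"
  define c3 where "c3 = (2 * l + c + 2) * (2 * l * b - 2 * m - 1) - 2 * (m + 1) * (a + b\<^sup>2) + 2 * m"
  define R where "R = (1 + 2 * m - 2 * l * b) * (l + 2) - 2 * m"
  define S where "S = 2 * a * D1 + c2 * D2 + c3 * D3"
  have rl: "l \<in> \<real>" by (rule connection_zero_real[OF \<alpha> r 0])
  have s: "dirac_solution \<alpha> a b c l y1 y2" unfolding y1_def y2_def by (rule left_solution[OF \<alpha>])
  obtain C where d: "endpoint_decay C y1 y2"
    using left_uniform_decay[OF \<alpha> 0 tendsto_const tendsto_const tendsto_const tendsto_const, of sequentially] 0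
    unfolding y1_def y2_def by auto
  note Y = dirac_solution_continuous[OF s]
  have "\<exists>I>0. (\<lambda>n::nat. integral {0<..<1} (weight_pairing y1 y2 y1 y2)) \<longlonglongrightarrow> complex_of_real I"
  proof (rule weight_pairing_limit[of 0 1 y1 y2 "\<lambda>_. y1" "\<lambda>_. y2" C "1 / 2"])
    show "norm (weight_pairing y1 y2 y1 y2 z) \<le> C" if "z \<in> {0<..<1}" for z by (rule weight_pairing_bound[OF d d that])
    show "y1 z \<in> \<real> \<and> y2 z \<in> \<real>" if "z \<in> {0<..<1}" for z
      unfolding y1_def y2_def using left_right_real[OF \<alpha> r rl that] by blast
    show "y1 (1 / 2) \<noteq> 0 \<or> y2 (1 / 2) \<noteq> 0" unfolding y1_def y2_def by (rule left_nonzero[OF \<alpha>]) simp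
  qed (use Y in auto)
  then obtain I where I: "I > 0" "integral {0<..<1} (weight_pairing y1 y2 y1 y2) = complex_of_real I"
    by (auto simp: LIMSEQ_const_iff)
  have "weight_pairing y1 y2 y1 y2 integrable_on {0<..<1}"
    by (rule bounded_continuous_integrable_on[OF weight_pairing_continuous[OF Y Y] weight_pairing_bound[OF d d]]) auto
  from has_integral_mult_right[OF integrable_integral[OF this], of "S - R"]
  have 1: "((\<lambda>z. (S - R) * weight_pairing y1 y2 y1 y2 z) has_integral (S - R) * of_real I) {0<..<1}"
    unfolding I(2) .
  have h1: "((\<lambda>z. 2 * (y2 z * y2 z) + D1 * weight_pairing y1 y2 y1 y2 z) has_integral 0) {0<..<1}"
    using HF[of 1 0 0 D1] by simp
  have h2: "((\<lambda>z. 4 * (y1 z * y2 z) + 2 * (2 * b) * (y2 z * y2 z) + D2 * weight_pairing y1 y2 y1 y2 z) has_integral 0) {0<..<1}"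
    using HF[of 0 1 0 D2] by simp
  have h3: "((\<lambda>z. y2 z * y2 z / of_real z + D3 * weight_pairing y1 y2 y1 y2 z) has_integral 0) {0<..<1}"
    using HF[of 0 0 1 D3] by simp
  have h4: "((\<lambda>z. 4 * c2 * (y1 z * y2 z) + 2 * (2 * a + 2 * b * c2) * (y2 z * y2 z) + c3 * (y2 z * y2 z / of_real z)
     + R * weight_pairing y1 y2 y1 y2 z) has_integral 0) {0<..<1}"
    using quadratic_exact_form[OF s d m] unfolding c2_def c3_def R_def .
  have "((\<lambda>z. 2 * a * (2 * (y2 z * y2 z) + D1 * weight_pairing y1 y2 y1 y2 z)
      + c2 * (4 * (y1 z * y2 z) + 2 * (2 * b) * (y2 z * y2 z) + D2 * weight_pairing y1 y2 y1 y2 z)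
      + c3 * (y2 z * y2 z / of_real z + D3 * weight_pairing y1 y2 y1 y2 z)
      - (4 * c2 * (y1 z * y2 z) + 2 * (2 * a + 2 * b * c2) * (y2 z * y2 z) + c3 * (y2 z * y2 z / of_real z)
     + R * weight_pairing y1 y2 y1 y2 z)) has_integral 2 * a * 0 + c2 * 0 + c3 * 0 - 0) {0<..<1}"
    by (intro has_integral_diff has_integral_add has_integral_mult_right h1 h2 h3 h4)
  then have 2: "((\<lambda>z. (S - R) * weight_pairing y1 y2 y1 y2 z) has_integral 2 * a * 0 + c2 * 0 + c3 * 0 - 0) {0<..<1}"
    by (rule has_integral_eq[rotated]) (simp add: S_def algebra_simps)
  have "(S - R) * of_real I = 2 * a * 0 + c2 * 0 + c3 * 0 - 0" by (rule has_integral_unique[OF 1 2])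
  then have "S = R" using I(1) by simp
  then show ?thesis unfolding S_def R_def c2_def c3_def .
qed

section \<open>The analytic branch of eigenvalues\<close>

definition complexify :: "real^3 \<Rightarrow> complex \<times> complex \<times> complex" where
  "complexify u = (of_real (u $ 1), of_real (u $ 2), of_real (u $ 3))"

lemma dist_triple_le: "dist (a, b, c) (a', b', c') \<le> dist a a' + dist b b' + dist c c'"
proof -
  have "dist (a, b, c) (a', b', c') \<le> dist a a' + dist (b, c) (b', c')"
    unfolding dist_Pair_Pair[of a] by (rule sqrt_sum_squares_le_sum) auto
  also have "dist (b, c) (b', c') \<le> dist b b' + dist c c'"
    unfolding dist_Pair_Pair by (rule sqrt_sum_squares_le_sum) auto
  finally show ?thesis by simp
qed

text \<open>
  The radius \<open>R / 3\<close> leaves room for the sum of three coordinate distances.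
\<close>

lemma polydisc_in_ball:
  assumes "dist u0 p + s \<le> R / 3" "a \<in> ball (of_real (p $ 1)) s" "b \<in> ball (of_real (p $ 2)) s" "c \<in> ball (of_real (p $ 3)) s"
  shows "(a, b, c) \<in> ball (complexify u0) R"
proof -
  have one: "dist (complex_of_real (u0 $ i)) x < R / 3" if "x \<in> ball (complex_of_real (p $ i)) s" for i x
  proof -
    have "dist (complex_of_real (u0 $ i)) x \<le> dist (complex_of_real (u0 $ i)) (of_real (p $ i)) + dist (of_real (p $ i)) x"
      by (rule dist_triangle)
    also have "dist (complex_of_real (u0 $ i)) (of_real (p $ i)) = dist (u0 $ i) (p $ i)" by (rule dist_of_real)
    also have "dist (u0 $ i) (p $ i) \<le> dist u0 p" by (rule dist_vec_nth_le)
    finally show ?thesis using that assms(1) by simp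
  qed
  show ?thesis
    unfolding complexify_def mem_ball
    by (rule le_less_trans[OF dist_triple_le]) (use one[OF assms(2)] one[OF assms(3)] one[OF assms(4)] in linarith)
qed

text \<open>
  Translates between multi-indices on the three-element type and triples.
\<close>

lemma bij_betw_exponents: "bij_betw (\<lambda>m::3 \<Rightarrow> nat. (m 1, m 2, m 3)) UNIV UNIV"
proof (rule bij_betwI[where g = "\<lambda>(a, b, c) i. if i = 1 then a else if i = 2 then b else c"])
  show "(case (m 1, m 2, m 3) of (a, b, c) \<Rightarrow> \<lambda>i. if i = 1 then a else if i = 2 then b else c) = m" for m :: "3 \<Rightarrow> nat"
    by (rule ext) (use exhaust_3 in auto)
qed auto

lemma real_analytic_of_separately_holomorphic:
  fixes \<Lambda> :: "complex \<times> complex \<times> complex \<Rightarrow> complex" and u0 :: "real^3"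
  assumes cont: "continuous_on (ball (complexify u0) R) \<Lambda>"
    and h1: "\<And>S b c. open S \<Longrightarrow> (\<lambda>a. (a, b, c)) ` S \<subseteq> ball (complexify u0) R \<Longrightarrow> (\<lambda>a. \<Lambda> (a, b, c)) holomorphic_on S"
    and h2: "\<And>S a c. open S \<Longrightarrow> (\<lambda>b. (a, b, c)) ` S \<subseteq> ball (complexify u0) R \<Longrightarrow> (\<lambda>b. \<Lambda> (a, b, c)) holomorphic_on S"
    and h3: "\<And>S a b. open S \<Longrightarrow> (\<lambda>c. (a, b, c)) ` S \<subseteq> ball (complexify u0) R \<Longrightarrow> (\<lambda>c. \<Lambda> (a, b, c)) holomorphic_on S"
  shows "real_analytic_on (\<lambda>u. Re (\<Lambda> (complexify u))) (ball u0 (R / 3))"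
  unfolding real_analytic_on_def
proof
  fix p assume p: "p \<in> ball u0 (R / 3)"
  define s where "s = R / 3 - dist u0 p"
  have s: "s > 0" "dist u0 p + s \<le> R / 3" using p by (auto simp: s_def)
  define a0 b0 c0 where "a0 = complex_of_real (p $ 1)" and "b0 = complex_of_real (p $ 2)" and "c0 = complex_of_real (p $ 3)"
  note inb = polydisc_in_ball[OF s(2), folded a0_def b0_def c0_def]
  have "\<exists>C. \<forall>x y z. norm x < s / 2 \<longrightarrow> norm y < s / 2 \<longrightarrow> norm z < s / 2 \<longrightarrow>
    ((\<lambda>(m, n, k). C m n k * x ^ m * y ^ n * z ^ k) has_sum \<Lambda> (a0 + x, b0 + y, c0 + z)) UNIV"
  proof (rule separately_holomorphic_power_series[of "s / 2" s a0 b0 c0 "\<lambda>a b c. \<Lambda> (a, b, c)"])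
    show "continuous_on (ball a0 s \<times> ball b0 s \<times> ball c0 s) (\<lambda>(a, b, c). \<Lambda> (a, b, c))"
    proof -
      have "(\<lambda>(a, b, c). \<Lambda> (a, b, c)) = \<Lambda>" by (simp add: fun_eq_iff)
      moreover have "ball a0 s \<times> ball b0 s \<times> ball c0 s \<subseteq> ball (complexify u0) R"
      proof
        fix x assume "x \<in> ball a0 s \<times> ball b0 s \<times> ball c0 s"
        then obtain a b c where "x = (a, b, c)" "a \<in> ball a0 s" "b \<in> ball b0 s" "c \<in> ball c0 s" by blast
        then show "x \<in> ball (complexify u0) R" using inb by simp
      qed
      ultimately show ?thesis using continuous_on_subset[OF cont] by simp
    qed
    show "(\<lambda>a. \<Lambda> (a, b, c)) holomorphic_on ball a0 s" if "b \<in> ball b0 s" "c \<in> ball c0 s" for b c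
      by (rule h1[OF open_ball]) (intro image_subsetI inb that; assumption)
    show "(\<lambda>b. \<Lambda> (a, b, c)) holomorphic_on ball b0 s" if "a \<in> ball a0 s" "c \<in> ball c0 s" for a c
      by (rule h2[OF open_ball]) (intro image_subsetI inb that; assumption)
    show "(\<lambda>c. \<Lambda> (a, b, c)) holomorphic_on ball c0 s" if "a \<in> ball a0 s" "b \<in> ball b0 s" for a b
      by (rule h3[OF open_ball]) (intro image_subsetI inb that; assumption)
  qed (use s in auto)
  then obtain C where C: "\<And>x y z. norm x < s / 2 \<Longrightarrow> norm y < s / 2 \<Longrightarrow> norm z < s / 2 \<Longrightarrow>
    ((\<lambda>(m, n, k). C m n k * x ^ m * y ^ n * z ^ k) has_sum \<Lambda> (a0 + x, b0 + y, c0 + z)) UNIV" by blast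
  show "\<exists>r>0. \<exists>c. \<forall>x\<in>ball p r. ((\<lambda>m. c m * (\<Prod>i\<in>UNIV. (x $ i - p $ i) ^ m i)) has_sum Re (\<Lambda> (complexify x))) UNIV"
  proof (intro exI[of _ "s / 2"] exI[of _ "\<lambda>m. Re (C (m 1) (m 2) (m 3))"] conjI ballI)
    show "s / 2 > 0" using s by simp
    fix x assume x: "x \<in> ball p (s / 2)"
    have nx: "norm (complex_of_real (x $ i - p $ i)) < s / 2" for i
    proof -
      have "norm (complex_of_real (x $ i - p $ i)) = dist (p $ i) (x $ i)"
        unfolding norm_of_real dist_real_def by (rule abs_minus_commute)
      also have "\<dots> \<le> dist p x" by (rule dist_vec_nth_le)
      finally show ?thesis using x by simp
    qed
    have e: "(a0 + of_real (x $ 1 - p $ 1), b0 + of_real (x $ 2 - p $ 2), c0 + of_real (x $ 3 - p $ 3)) = complexify x"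
      by (simp add: complexify_def a0_def b0_def c0_def)
    note HS = has_sum_bounded_linear[OF bounded_linear_Re C[OF nx[of 1] nx[of 2] nx[of 3]], unfolded e]
    have "((\<lambda>(m, n, k). Re (C m n k) * ((x $ 1 - p $ 1) ^ m * (x $ 2 - p $ 2) ^ n * (x $ 3 - p $ 3) ^ k)) has_sum Re (\<Lambda> (complexify x))) UNIV"
    proof (rule iffD1[OF has_sum_cong HS])
      fix q :: "nat \<times> nat \<times> nat"
      obtain m n k where q: "q = (m, n, k)" by (cases q) auto
      have "C m n k * of_real (x $ 1 - p $ 1) ^ m * of_real (x $ 2 - p $ 2) ^ n * of_real (x $ 3 - p $ 3) ^ k
        = C m n k * of_real ((x $ 1 - p $ 1) ^ m * (x $ 2 - p $ 2) ^ n * (x $ 3 - p $ 3) ^ k)"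
        unfolding of_real_mult of_real_power mult.assoc ..
      then show "Re (case q of (m, n, k) \<Rightarrow> C m n k * of_real (x $ 1 - p $ 1) ^ m * of_real (x $ 2 - p $ 2) ^ n * of_real (x $ 3 - p $ 3) ^ k)
        = (case q of (m, n, k) \<Rightarrow> Re (C m n k) * ((x $ 1 - p $ 1) ^ m * (x $ 2 - p $ 2) ^ n * (x $ 3 - p $ 3) ^ k))"
        unfolding q prod.case by (simp only: Re_complex_of_real Im_complex_of_real times_complex.sel mult_zero_right diff_zero)
    qed
    from iffD2[OF has_sum_reindex_bij_betw[OF bij_betw_exponents] this]
    have R: "((\<lambda>m::3 \<Rightarrow> nat. Re (C (m 1) (m 2) (m 3)) * ((x $ 1 - p $ 1) ^ m 1 * (x $ 2 - p $ 2) ^ m 2 * (x $ 3 - p $ 3) ^ m 3)) has_sum Re (\<Lambda> (complexify x))) UNIV"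
      unfolding prod.case .
    have pr: "(\<Prod>i\<in>UNIV. (x $ i - p $ i) ^ m i) = (x $ 1 - p $ 1) ^ m 1 * (x $ 2 - p $ 2) ^ m 2 * (x $ 3 - p $ 3) ^ m 3" for m :: "3 \<Rightarrow> nat"
      unfolding UNIV_3 by simp
    show "((\<lambda>m. Re (C (m 1) (m 2) (m 3)) * (\<Prod>i\<in>UNIV. (x $ i - p $ i) ^ m i)) has_sum Re (\<Lambda> (complexify x))) UNIV"
      unfolding pr by (rule R)
  qed
qed

lemma connection_continuous:
  assumes \<alpha>: "\<alpha> \<ge> 1 / 2"
  shows "continuous_on UNIV (\<lambda>(p, l). connection \<alpha> (fst p) (fst (snd p)) (snd (snd p)) l)"
  unfolding case_prod_beta connection_def
  by (intro continuous_on_diff continuous_on_mult solutions_continuous[OF \<alpha>]; (intro continuous_intros)?) auto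

text \<open>
  The root of the connection coefficient that passes through \<open>l0\<close>, restricted to real parameters. It
  is real there because it is an eigenvalue of a symmetric problem.
\<close>

lemma eigenvalue_branch:
  fixes u0 :: "real^3"
  assumes \<alpha>: "\<alpha> \<ge> 1 / 2" and 0: "connection \<alpha> (of_real (u0 $ 1)) (of_real (u0 $ 2)) (of_real (u0 $ 3)) l0 = 0"
  obtains r \<Lambda> where "r > 0" "complex_of_real (\<Lambda> u0) = l0" "real_analytic_on \<Lambda> (ball u0 r)"
    "\<And>u. u \<in> ball u0 r \<Longrightarrow> connection \<alpha> (of_real (u $ 1)) (of_real (u $ 2)) (of_real (u $ 3)) (of_real (\<Lambda> u)) = 0"
    "\<And>u i. u \<in> ball u0 r \<Longrightarrow> \<exists>D. ((\<lambda>t. \<Lambda> (u + t *\<^sub>R axis i 1)) has_real_derivative D) (at 0)"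
proof -
  define G where "G = (\<lambda>p l. connection \<alpha> (fst p) (fst (snd p)) (snd (snd p)) l)"
  have G0: "G (complexify u0) l0 = 0" using 0 by (simp add: G_def complexify_def)
  have ent: "G p holomorphic_on UNIV" for p
    unfolding G_def by (intro connection_entire[OF \<alpha>] holomorphic_intros)
  have d0: "deriv (G (complexify u0)) l0 \<noteq> 0"
    using connection_simple_zero[OF \<alpha> _ _ _ 0] by (simp add: G_def complexify_def)
  have cG: "continuous_on UNIV (\<lambda>(p, l). G p l)" unfolding G_def by (rule connection_continuous[OF \<alpha>])
  obtain R \<Lambda> where R: "R > 0" and cont: "continuous_on (ball (complexify u0) R) \<Lambda>" and \<Lambda>0: "\<Lambda> (complexify u0) = l0"
    and zero: "\<And>p. p \<in> ball (complexify u0) R \<Longrightarrow> G p (\<Lambda> p) = 0"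
    and hol': "\<forall>S e. open S \<longrightarrow> continuous_on S e \<longrightarrow> e ` S \<subseteq> ball (complexify u0) R \<longrightarrow> (\<forall>l. (\<lambda>w. G (e w) l) holomorphic_on S) \<longrightarrow>
      (\<lambda>w. \<Lambda> (e w)) holomorphic_on S"
    by (rule simple_root_holomorphic_branch[OF cG ent G0 d0]) (rule that)
  note hol = hol'[rule_format]
  have Ghol: "(\<lambda>w. G (f w, g w, h w) l) holomorphic_on S"
    if "f holomorphic_on UNIV" "g holomorphic_on UNIV" "h holomorphic_on UNIV" for f g h l S
    unfolding G_def fst_conv snd_conv
    by (rule holomorphic_on_subset[OF connection_entire[OF \<alpha> that holomorphic_on_const]]) simp
  have holc: "(\<lambda>w. \<Lambda> (f w, g w, h w)) holomorphic_on S"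
    if "f holomorphic_on UNIV" "g holomorphic_on UNIV" "h holomorphic_on UNIV" "open S"
      "(\<lambda>w. (f w, g w, h w)) ` S \<subseteq> ball (complexify u0) R" for f g h S
  proof (rule hol[OF that(4) _ that(5) Ghol[OF that(1-3)]])
    show "continuous_on S (\<lambda>w. (f w, g w, h w))"
      by (intro continuous_on_Pair holomorphic_on_imp_continuous_on[THEN continuous_on_subset[OF _ subset_UNIV]] that)
  qed
  define r where "r = R / 3"
  have inb: "complexify u \<in> ball (complexify u0) R" if "u \<in> ball u0 r" for u
    unfolding complexify_def[of u]
    by (rule polydisc_in_ball[where p = u and s = "r - dist u0 u"]) (use that in \<open>auto simp: r_def\<close>)
  define Lam where "Lam = (\<lambda>u. Re (\<Lambda> (complexify u)))"
  have conn: "connection \<alpha> (of_real (u $ 1)) (of_real (u $ 2)) (of_real (u $ 3)) (\<Lambda> (complexify u)) = 0" if "u \<in> ball u0 r" for u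
    using zero[OF inb[OF that]] by (simp add: G_def complexify_def)
  have real: "complex_of_real (Lam u) = \<Lambda> (complexify u)" if "u \<in> ball u0 r" for u
    using connection_zero_real[OF \<alpha> _ _ _ conn[OF that]] by (simp add: Lam_def)
  show ?thesis
  proof (rule that[of r Lam])
    show "r > 0" using R by (simp add: r_def)
    then have u0: "u0 \<in> ball u0 r" by simp
    show "complex_of_real (Lam u0) = l0" using real[OF u0] \<Lambda>0 by simp
    show "real_analytic_on Lam (ball u0 r)"
      unfolding Lam_def r_def
      by (rule real_analytic_of_separately_holomorphic[OF cont];
          rule holc[OF holomorphic_on_ident holomorphic_on_const holomorphic_on_const]
            holc[OF holomorphic_on_const holomorphic_on_ident holomorphic_on_const]
            holc[OF holomorphic_on_const holomorphic_on_const holomorphic_on_ident])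
    show "connection \<alpha> (of_real (u $ 1)) (of_real (u $ 2)) (of_real (u $ 3)) (of_real (Lam u)) = 0" if "u \<in> ball u0 r" for u
      unfolding real[OF that] by (rule conn[OF that])
    fix u :: "real^3" and i :: 3 assume u: "u \<in> ball u0 r"
    define e where "e = (\<lambda>w. (of_real (u $ 1) + w * of_real (axis i 1 $ 1), of_real (u $ 2) + w * of_real (axis i 1 $ 2), of_real (u $ 3) + w * of_real (axis i (1::real) $ 3)) :: complex \<times> complex \<times> complex)"
    define S where "S = e -` ball (complexify u0) R"
    have "continuous_on UNIV e" unfolding e_def by (intro continuous_intros)
    then have oS: "open S" unfolding S_def using continuous_open_vimage[of "ball (complexify u0) R" e] continuous_on_eq_continuous_at[of UNIV e] by auto
    have h: "(\<lambda>w. \<Lambda> (e w)) holomorphic_on S" unfolding e_def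
    proof (rule holc)
      show "(\<lambda>w. (of_real (u $ 1) + w * of_real (axis i 1 $ 1), of_real (u $ 2) + w * of_real (axis i 1 $ 2), of_real (u $ 3) + w * of_real (axis i (1::real) $ 3))) ` S \<subseteq> ball (complexify u0) R"
        unfolding S_def e_def by blast
    qed (intro holomorphic_intros oS)+
    have "e 0 = complexify u" by (simp add: e_def complexify_def)
    then have "0 \<in> S" using inb[OF u] by (simp add: S_def)
    then have "((\<lambda>w. \<Lambda> (e w)) has_field_derivative deriv (\<lambda>w. \<Lambda> (e w)) 0) (at (of_real 0))"
      using holomorphic_derivI[OF h oS] by simp
    from has_vector_derivative_real_field[OF this]
    have "((\<lambda>t. \<Lambda> (e (of_real t))) has_vector_derivative deriv (\<lambda>w. \<Lambda> (e w)) 0) (at 0)" .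
    from bounded_linear.has_vector_derivative[OF bounded_linear_Re this]
    have "((\<lambda>t. Re (\<Lambda> (e (of_real t)))) has_real_derivative Re (deriv (\<lambda>w. \<Lambda> (e w)) 0)) (at 0)"
      by (simp add: has_real_derivative_iff_has_vector_derivative)
    moreover have "e (of_real t) = complexify (u + t *\<^sub>R axis i 1)" for t
      by (simp add: e_def complexify_def)
    ultimately show "\<exists>D. ((\<lambda>t. Lam (u + t *\<^sub>R axis i 1)) has_real_derivative D) (at 0)"
      unfolding Lam_def by auto
  qed
qed

lemma branch_partial_derivative:
  fixes u0 u :: "real^3"
  assumes \<alpha>: "\<alpha> \<ge> 1 / 2" and u: "u \<in> ball u0 r"
    and conn: "\<And>u. u \<in> ball u0 r \<Longrightarrow> connection \<alpha> (of_real (u $ 1)) (of_real (u $ 2)) (of_real (u $ 3)) (of_real (\<Lambda> u)) = 0"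
    and der: "((\<lambda>t. \<Lambda> (u + t *\<^sub>R axis i 1)) has_real_derivative D) (at 0)"
  defines "y1 \<equiv> left1 \<alpha> (of_real (u $ 1)) (of_real (u $ 2)) (of_real (u $ 3)) (of_real (\<Lambda> u))"
    and "y2 \<equiv> left2 \<alpha> (of_real (u $ 1)) (of_real (u $ 2)) (of_real (u $ 3)) (of_real (\<Lambda> u))"
  shows "((\<lambda>z. 4 * of_real (axis i 1 $ 2) * (y1 z * y2 z) + 2 * (of_real (axis i 1 $ 1) + 2 * of_real (u $ 2) * of_real (axis i 1 $ 2)) * (y2 z * y2 z)
     + of_real (axis i 1 $ 3) * (y2 z * y2 z / of_real z) + of_real D * weight_pairing y1 y2 y1 y2 z) has_integral 0) {0<..<1}"
proof -
  define s where "s = r - dist u0 u"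
  have s: "s > 0" using u by (simp add: s_def)
  \<comment> \<open>steps that stay inside the ball\<close>
  define t where "t = (\<lambda>n. s / 2 * inverse (real (Suc n)))"
  have t0: "t n \<noteq> 0" for n using s by (simp add: t_def)
  have tl: "t \<longlonglongrightarrow> 0" unfolding t_def
    using tendsto_mult_right_zero[OF LIMSEQ_inverse_real_of_nat] by blast
  have tin: "u + t n *\<^sub>R axis i 1 \<in> ball u0 r" for n
  proof -
    have "\<bar>t n\<bar> \<le> s / 2 * 1" unfolding t_def abs_mult using s by (intro mult_mono) (auto simp: inverse_eq_divide)
    moreover have "dist u0 (u + t n *\<^sub>R axis i 1) \<le> dist u0 u + dist u (u + t n *\<^sub>R axis i 1)" by (rule dist_triangle)
    moreover have "dist u (u + t n *\<^sub>R axis i 1) = \<bar>t n\<bar>" by (simp add: dist_norm norm_axis_1)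
    ultimately show ?thesis using s by (simp add: s_def)
  qed
  show ?thesis
    unfolding y1_def y2_def
  proof (rule hellmann_feynman[where t = "\<lambda>n. of_real (t n)" and ln = "\<lambda>n. of_real (\<Lambda> (u + t n *\<^sub>R axis i 1))", OF \<alpha> conn[OF u]])
    show "(\<lambda>n. complex_of_real (t n)) \<longlonglongrightarrow> 0" using tendsto_of_real[OF tl] by simp
    show "complex_of_real (t n) \<noteq> 0" for n using t0 by simp
    show "connection \<alpha> (of_real (u $ 1) + of_real (t n) * of_real (axis i 1 $ 1)) (of_real (u $ 2) + of_real (t n) * of_real (axis i 1 $ 2))
       (of_real (u $ 3) + of_real (t n) * of_real (axis i 1 $ 3)) (of_real (\<Lambda> (u + t n *\<^sub>R axis i 1))) = 0" for n
      using conn[OF tin[of n]] by simp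
    have "((\<lambda>h. (\<Lambda> (u + h *\<^sub>R axis i 1) - \<Lambda> u) / h) \<longlongrightarrow> D) (at 0)"
      using der by (simp add: has_field_derivative_iff)
    moreover have "filterlim t (at 0) sequentially" using tl t0 by (simp add: filterlim_at)
    ultimately have "(\<lambda>n. (\<Lambda> (u + t n *\<^sub>R axis i 1) - \<Lambda> u) / t n) \<longlonglongrightarrow> D" by (rule filterlim_compose)
    from tendsto_of_real[OF this, where 'a = complex]
    show "(\<lambda>n. (complex_of_real (\<Lambda> (u + t n *\<^sub>R axis i 1)) - of_real (\<Lambda> u)) / of_real (t n)) \<longlonglongrightarrow> of_real D"
      by (simp only: of_real_divide of_real_diff)
  qed
qed

theorem theorem2:
  fixes \<mu> :: real and u0 :: "real^3" and \<Lambda>0 :: complex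
  assumes "\<mu> \<ge> 0"
    and "eigenvalue_T \<mu> u0 \<Lambda>0"
  shows "\<exists>(U :: (real^3) set) (\<Lambda> :: real^3 \<Rightarrow> real).
           open U \<and> connected U \<and> u0 \<in> U \<and>
           (\<forall>u\<in>U. eigenvalue_T \<mu> u (complex_of_real (\<Lambda> u))) \<and>
           complex_of_real (\<Lambda> u0) = \<Lambda>0 \<and>
           real_analytic_on \<Lambda> U \<and>
           (\<forall>u\<in>U.
              2 * u$1 * partial_deriv 1 \<Lambda> u
              + ((\<Lambda> u + 2) * (u$1 + (u$2)\<^sup>2) + \<Lambda> u + u$2 + u$3) * partial_deriv 2 \<Lambda> u
              + ((2 * \<Lambda> u + u$3 + 2) * (2 * \<Lambda> u * u$2 - 2 * \<mu> - 1)
                 - 2 * (\<mu> + 1) * (u$1 + (u$2)\<^sup>2) + 2 * \<mu>) * partial_deriv 3 \<Lambda> u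
              = (1 + 2 * \<mu> - 2 * \<Lambda> u * u$2) * (\<Lambda> u + 2) - 2 * \<mu>)"
proof -
  define \<alpha> where "\<alpha> = (\<mu> + 1) / 2"
  have \<alpha>: "\<alpha> \<ge> 1 / 2" using assms(1) by (simp add: \<alpha>_def)
  have 0: "connection \<alpha> (of_real (u0 $ 1)) (of_real (u0 $ 2)) (of_real (u0 $ 3)) \<Lambda>0 = 0"
    unfolding \<alpha>_def by (rule eigenvalue_imp_connection_zero[OF assms])
  obtain r \<Lambda> where r: "r > 0" and \<Lambda>0: "complex_of_real (\<Lambda> u0) = \<Lambda>0" and an: "real_analytic_on \<Lambda> (ball u0 r)"
    and conn: "\<And>u. u \<in> ball u0 r \<Longrightarrow> connection \<alpha> (of_real (u $ 1)) (of_real (u $ 2)) (of_real (u $ 3)) (of_real (\<Lambda> u)) = 0"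
    and der: "\<And>u i. u \<in> ball u0 r \<Longrightarrow> \<exists>D. ((\<lambda>t. \<Lambda> (u + t *\<^sub>R axis i 1)) has_real_derivative D) (at 0)"
    by (rule eigenvalue_branch[OF \<alpha> 0]) (rule that)
  have pde: "2 * u$1 * partial_deriv 1 \<Lambda> u
              + ((\<Lambda> u + 2) * (u$1 + (u$2)\<^sup>2) + \<Lambda> u + u$2 + u$3) * partial_deriv 2 \<Lambda> u
              + ((2 * \<Lambda> u + u$3 + 2) * (2 * \<Lambda> u * u$2 - 2 * \<mu> - 1)
                 - 2 * (\<mu> + 1) * (u$1 + (u$2)\<^sup>2) + 2 * \<mu>) * partial_deriv 3 \<Lambda> u
              = (1 + 2 * \<mu> - 2 * \<Lambda> u * u$2) * (\<Lambda> u + 2) - 2 * \<mu>" if u: "u \<in> ball u0 r" for u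
  proof -
    have pd: "((\<lambda>t. \<Lambda> (u + t *\<^sub>R axis i 1)) has_real_derivative partial_deriv i \<Lambda> u) (at 0)" for i
      using der[OF u, of i] DERIV_imp_deriv unfolding partial_deriv_def by fastforce
    note hf = branch_partial_derivative[OF \<alpha> u conn pd]
    have "2 * of_real (u $ 1) * of_real (partial_deriv 1 \<Lambda> u)
      + ((of_real (\<Lambda> u) + 2) * (of_real (u $ 1) + (of_real (u $ 2))\<^sup>2) + of_real (\<Lambda> u) + of_real (u $ 2) + of_real (u $ 3)) * of_real (partial_deriv 2 \<Lambda> u)
      + ((2 * of_real (\<Lambda> u) + of_real (u $ 3) + 2) * (2 * of_real (\<Lambda> u) * of_real (u $ 2) - 2 * of_real \<mu> - 1)
         - 2 * (of_real \<mu> + 1) * (of_real (u $ 1) + (of_real (u $ 2))\<^sup>2) + 2 * of_real \<mu>) * of_real (partial_deriv 3 \<Lambda> u)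
      = (1 + 2 * of_real \<mu> - 2 * of_real (\<Lambda> u) * of_real (u $ 2)) * (complex_of_real (\<Lambda> u) + 2) - 2 * of_real \<mu>"
    proof (rule eigenvalue_pde[OF \<alpha> _ _ _ conn[OF u]])
      show "complex_of_real \<mu> = 2 * of_real \<alpha> - 1" by (simp add: \<alpha>_def add_divide_distrib)
    next
      fix e1 e2 e3 D :: complex
      let ?y1 = "left1 \<alpha> (of_real (u $ 1)) (of_real (u $ 2)) (of_real (u $ 3)) (of_real (\<Lambda> u))"
      let ?y2 = "left2 \<alpha> (of_real (u $ 1)) (of_real (u $ 2)) (of_real (u $ 3)) (of_real (\<Lambda> u))"
      assume "(e1, e2, e3, D) \<in> {(1, 0, 0, of_real (partial_deriv 1 \<Lambda> u)), (0, 1, 0, of_real (partial_deriv 2 \<Lambda> u)), (0, 0, 1, of_real (partial_deriv 3 \<Lambda> u))}"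
      then have "\<exists>i::3. e1 = of_real (axis i 1 $ 1) \<and> e2 = of_real (axis i 1 $ 2) \<and> e3 = of_real (axis i 1 $ 3) \<and> D = of_real (partial_deriv i \<Lambda> u)"
        by (elim insertE emptyE) (simp_all add: axis_def; metis one_neq_zero)+
      then obtain i :: 3 where i: "e1 = of_real (axis i 1 $ 1)" "e2 = of_real (axis i 1 $ 2)" "e3 = of_real (axis i 1 $ 3)" "D = of_real (partial_deriv i \<Lambda> u)"
        by blast
      show "((\<lambda>z. 4 * e2 * (?y1 z * ?y2 z) + 2 * (e1 + 2 * of_real (u $ 2) * e2) * (?y2 z * ?y2 z)
        + e3 * (?y2 z * ?y2 z / of_real z) + D * weight_pairing ?y1 ?y2 ?y1 ?y2 z) has_integral 0) {0<..<1}"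
        unfolding i by (rule hf)
    qed simp_all
    then show ?thesis
      unfolding of_real_eq_iff[where 'a = complex, symmetric] by simp
  qed
  have ev: "eigenvalue_T \<mu> u (complex_of_real (\<Lambda> u))" if "u \<in> ball u0 r" for u
    by (rule connection_zero_imp_eigenvalue[OF assms(1)]) (use conn[OF that] in \<open>simp add: \<alpha>_def\<close>)
  have "open (ball u0 r) \<and> connected (ball u0 r) \<and> u0 \<in> ball u0 r \<and>
           (\<forall>u\<in>ball u0 r. eigenvalue_T \<mu> u (complex_of_real (\<Lambda> u))) \<and>
           complex_of_real (\<Lambda> u0) = \<Lambda>0 \<and> real_analytic_on \<Lambda> (ball u0 r)"
    using r ev \<Lambda>0 an by (simp add: connected_ball)
  with pde show ?thesis by blast
qed

end
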